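(* Assume (A0)–(A3) as in the context, $r>-1$, and that (M$_p$) holds for some $p>\max\{2,1+r\}$. Let $\alpha\ge0$ and $\xi^{(\alpha)}_1:=\sum_{t=\tau_0}^{\tau_1-1}X_t^\alpha$. Then for any $\varepsilon>0$, for all $x$ sufficiently large, $$x^{-\frac{1+r}{\alpha+2}}(\log x)^{-\varepsilon}\le\mathbb{P}[\xi^{(\alpha)}_1\ge x]\le x^{-\frac{1+r}{\alpha+2}}(\log x)^{\frac{2+2r}{\alpha+2}+1+\varepsilon}.$$ In particular $\mathbb{E}[(\xi^{(\alpha)}_1)^{\frac{1+r}{\alpha+2}}]=\infty$ but $\mathbb{E}[(\xi^{(\alpha)}_1)^{\frac{1+r}{\alpha+2}-\varepsilon}]<\infty$ for every $\varepsilon>0$.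
   Context: $\mathbb{N}=\{1,2,\dots\}$. (A0): $\mathbb{S}$ is a locally finite (every bounded set meets it in finitely many points), unbounded subset of $[0,\infty)$ with $0\in\mathbb{S}$; $(X_t)_{t\in\mathbb{N}}$ is an $\mathbb{S}$-valued process adapted to a filtration $(\mathcal{F}_t)_{t\in\mathbb{N}}$ with $\mathbb{P}[X_1=0]=1$. (A1): for each $x,y\in\mathbb{S}$ there exist $m(x,y)\in\mathbb{N}$, $\varphi(x,y)>0$ with $\mathbb{P}[X_{t+m(X_t,y)}=y\mid\mathcal{F}_t]\ge\varphi(X_t,y)$ a.s. for all $t$. Write $\Delta_t:=X_{t+1}-X_t$. (A2): there are $c\in\mathbb{R}$, $s^2\in(0,\infty)$ with, as $X_t\to\infty$, $\mathbb{E}[\Delta_t\mid\mathcal{F}_t]=cX_t^{-1}+o(X_t^{-1}(\log X_t)^{-1})$ and $\mathbb{E}[\Delta_t^2\mid\mathcal{F}_t]=s^2+o((\log X_t)^{-1})$ a.s., where the implicit constants in $o(\cdot)$ are non-random and uniform in $t$ and in the sample point. Set $r:=-2c/s^2$. Excursions: $\tau_0:=1$, $\tau_n:=\min\{t>\tau_{n-1}:X_t=0\}$ ($\min\emptyset=\infty$), $\eta_n:=\tau_n-\tau_{n-1}$, $\mathcal{E}_n:=(X_t)_{\tau_{n-1}\le t\le\tau_n-1}$, $N:=\min\{n\in\mathbb{N}:\tau_n=\infty\}$. (A3): (a) on $\{N=\infty\}$, $(\mathcal{E}_n)_{n\in\mathbb{N}}$ is i.i.d.; (b) $\mathbb{P}[\eta_{n+1}<\infty\mid\tau_n<\infty]=\mathbb{P}[\eta_1<\infty]$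 for all $n$. (M$_p$): there exist $\delta>0$, $C<\infty$ with $\mathbb{E}[|\Delta_t|^p\mid\mathcal{F}_t]\le C(1+X_t)^{p-2-\delta}$ a.s. for all $t$. Convention $0^0=1$, so $\xi^{(0)}_1=\eta_1$.
   Formalization: The last claim is proved for 0 < ε < (1+r)/(α+2) instead of every ε > 0: for larger ε the exponent is negative and, when α > 0, ξ can be 0 with positive probability (a walk lazy at 0), so that moment would be infinite. *)

theory Defs
  imports "HOL-Probability.Probability"
begin

text \<open>Convention 0 to the power 0 equals 1 (Isabelle's powr has 0 powr 0 = 0).\<close>
definition pow0 :: "real \<Rightarrow> real \<Rightarrow> real" where
  "pow0 x a = (if a = 0 then 1 else x powr a)"

text \<open>Power of an extended nonnegative real by a positive real exponent
  (infinity to a positive power is infinity).\<close>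
definition enn_pow :: "ennreal \<Rightarrow> real \<Rightarrow> ennreal" where
  "enn_pow z a = (if z = \<infinity> then \<infinity> else ennreal (pow0 (enn2real z) a))"

fun exc_time :: "(nat \<Rightarrow> 'a \<Rightarrow> real) \<Rightarrow> nat \<Rightarrow> 'a \<Rightarrow> enat" where
  "exc_time X 0 \<omega> = 1"
| "exc_time X (Suc n) \<omega> =
     (case exc_time X n \<omega> of
        \<infinity> \<Rightarrow> \<infinity>
      | enat k \<Rightarrow> (if \<exists>t>k. X t \<omega> = 0 then enat (LEAST t. k < t \<and> X t \<omega> = 0) else \<infinity>))"

definition exc_len :: "(nat \<Rightarrow> 'a \<Rightarrow> real) \<Rightarrow> nat \<Rightarrow> 'a \<Rightarrow> enat" where
  "exc_len X n \<omega> = exc_time X n \<omega> - exc_time X (n - 1) \<omega>"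

definition exc_count :: "(nat \<Rightarrow> 'a \<Rightarrow> real) \<Rightarrow> 'a \<Rightarrow> enat" where
  "exc_count X \<omega> =
     (if \<exists>n\<ge>1. exc_time X n \<omega> = \<infinity>
      then enat (LEAST n. 1 \<le> n \<and> exc_time X n \<omega> = \<infinity>) else \<infinity>)"

text \<open>The n-th excursion (n >= 1): (X_t) for tau_(n-1) <= t <= tau_n - 1, as a finite list
  (only meaningful when tau_n is finite, in particular on {N = infinity}).\<close>
definition excursion :: "(nat \<Rightarrow> 'a \<Rightarrow> real) \<Rightarrow> nat \<Rightarrow> 'a \<Rightarrow> real list" where
  "excursion X n \<omega> =
     (case (exc_time X (n - 1) \<omega>, exc_time X n \<omega>) of
        (enat a, enat b) \<Rightarrow> map (\<lambda>t. X t \<omega>) [a..<b]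
      | _ \<Rightarrow> [])"

definition xi :: "(nat \<Rightarrow> 'a \<Rightarrow> real) \<Rightarrow> real \<Rightarrow> 'a \<Rightarrow> ennreal" where
  "xi X \<alpha> \<omega> =
     (\<Sum>t. if exc_time X 0 \<omega> \<le> enat t \<and> enat t < exc_time X 1 \<omega>
           then ennreal (pow0 (X t \<omega>) \<alpha>) else 0)"

end

theory Submission
  imports Defs "HOL-Real_Asymp.Real_Asymp"
begin

text \<open>
  An excursion that reaches height \<open>y\<close> lasts for a time of order \<open>y\<^sup>2\<close> at heights of order \<open>y\<close>,
  so \<open>\<xi> \<ge> x\<close> essentially means that the excursion reaches height \<open>y = x\<^bsup>1/(\<alpha>+2)\<^esup>\<close>, up to
  logarithms. With \<open>f(x) = x\<^bsup>1+r\<^esup> (log x)\<^bsup>\<nu>\<^esup>\<close> the leading drift terms of \<open>f(X\<^sub>t)\<close> cancel, and the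
  next one has the sign of \<open>\<nu>\<close>. For \<open>\<nu> < 0\<close> the supermartingale bounds the probability of reaching
  \<open>y\<close> from above; for \<open>\<nu> > 0\<close> the submartingale, truncated at twice the target level to control the
  overshoot, bounds it from below.

  For the duration, \<open>x\<^bsup>a\<^esup>\<close> with \<open>0 < a < min 2 (1 + r)\<close> has drift at most \<open>-c x\<^bsup>a-2\<^esup>\<close>, so from any
  state below \<open>y\<close> the process either exceeds \<open>y\<close> or returns to a bounded set within time of order
  \<open>y\<^sup>2\<close> with probability at least one half. Together with irreducibility this gives a geometric tail
  for the time spent below \<open>y\<close>. Conversely \<open>((y - X)\<^sup>+)\<^sup>2\<close> has bounded drift, so a path at height \<open>y\<close>
  stays above \<open>y/2\<close> for a time of order \<open>y\<^sup>2\<close> with probability at least one half. The moments follow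
  from dyadic sums of the tail.
\<close>

section \<open>The Lyapunov functions\<close>

lemma powr_le_four_powr_abs:
  fixes t q :: real
  assumes "1/4 \<le> t" "t \<le> 4"
  shows "t powr q \<le> 4 powr \<bar>q\<bar>"
proof -
  have "ln t \<le> ln 4" using assms by simp
  moreover have "- ln 4 \<le> ln t"
  proof -
    have "ln (1/4) \<le> ln t" using assms by (subst ln_le_cancel_iff) auto
    then show ?thesis by (simp add: ln_div)
  qed
  ultimately have "\<bar>ln t\<bar> \<le> ln 4" by linarith
  then have "q * ln t \<le> \<bar>q\<bar> * ln 4"
    by (metis abs_ge_self abs_mult abs_ge_zero mult_left_mono order_trans)
  then show ?thesis using assms by (simp add: powr_def)
qed

text \<open>\<open>lyap_c1\<close> and \<open>lyap_c2\<close> are the first two derivatives at \<open>u = 0\<close> of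
  \<open>(1 + u)\<^bsup>a\<^esup> (1 + h log (1 + u))\<^bsup>\<nu>\<^esup>\<close>, which for \<open>h = 1 / log y\<close> is the ratio of
  \<open>y\<^bsup>a\<^esup> (log y)\<^bsup>\<nu>\<^esup>\<close> at \<open>y (1 + u)\<close> and at \<open>y\<close>.\<close>
definition lyap_c1 :: "real \<Rightarrow> real \<Rightarrow> real \<Rightarrow> real" where
  "lyap_c1 a \<nu> h = a + \<nu> * h"

definition lyap_c2 :: "real \<Rightarrow> real \<Rightarrow> real \<Rightarrow> real" where
  "lyap_c2 a \<nu> h = a * (a - 1) + (2 * a - 1) * \<nu> * h + \<nu> * (\<nu> - 1) * h\<^sup>2"

lemma abs_lyap_c1_le: "0 \<le> h \<Longrightarrow> h \<le> 1 \<Longrightarrow> \<bar>lyap_c1 a \<nu> h\<bar> \<le> \<bar>a\<bar> + \<bar>\<nu>\<bar>"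
  unfolding lyap_c1_def
  by (rule order_trans[OF abs_triangle_ineq]) (auto simp: abs_mult mult_left_le)

lemma abs_lyap_c2_le:
  assumes "0 \<le> h" "h \<le> 1"
  shows "\<bar>lyap_c2 a \<nu> h\<bar> \<le> \<bar>a * (a - 1)\<bar> + \<bar>(2 * a - 1) * \<nu>\<bar> + \<bar>\<nu> * (\<nu> - 1)\<bar>"
proof -
  have "h\<^sup>2 \<le> 1" using assms by (simp add: power_le_one)
  then have "\<bar>\<nu> * (\<nu> - 1) * h\<^sup>2\<bar> \<le> \<bar>\<nu> * (\<nu> - 1)\<bar>"
    by (subst abs_mult) (simp add: mult_left_le)
  moreover have "\<bar>(2 * a - 1) * \<nu> * h\<bar> \<le> \<bar>(2 * a - 1) * \<nu>\<bar>"
    using assms by (subst abs_mult) (simp add: mult_left_le)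
  ultimately show ?thesis unfolding lyap_c2_def by linarith
qed

lemma taylor_power_log:
  fixes a \<nu> :: real
  obtains K where "0 \<le> K"
    "\<And>h u. 0 \<le> h \<Longrightarrow> h \<le> 1 \<Longrightarrow> \<bar>u\<bar> \<le> 1/2 \<Longrightarrow>
       \<bar>(1 + u) powr a * (1 + h * ln (1 + u)) powr \<nu>
          - (1 + lyap_c1 a \<nu> h * u + lyap_c2 a \<nu> h / 2 * u\<^sup>2)\<bar> \<le> K * \<bar>u\<bar> ^ 3"
proof -
  define P where "P h j k u = (1 + u) powr (a - j) * (1 + h * ln (1 + u)) powr (\<nu> - k)" for h j k u :: real
  define diff where "diff h m u =
     (if m = 0 then P h 0 0 u
      else if m = 1 then a * P h 1 0 u + \<nu> * h * P h 1 1 u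
      else if m = 2 then a*(a-1) * P h 2 0 u + (2*a-1)*\<nu>*h * P h 2 1 u + \<nu>*(\<nu>-1)*h\<^sup>2 * P h 2 2 u
      else a*(a-1) * ((a-2) * P h 3 0 u + \<nu>*h * P h 3 1 u)
         + (2*a-1)*\<nu>*h * ((a-2) * P h 3 1 u + (\<nu>-1)*h * P h 3 2 u)
         + \<nu>*(\<nu>-1)*h\<^sup>2 * ((a-2) * P h 3 2 u + (\<nu>-2)*h * P h 3 3 u))" for h u and m :: nat
  define Q where "Q k = 4 powr \<bar>a - 3\<bar> * 4 powr \<bar>\<nu> - k\<bar>" for k :: real
  define K where "K = \<bar>a*(a-1)\<bar> * (\<bar>a-2\<bar> * Q 0 + \<bar>\<nu>\<bar> * Q 1)
         + \<bar>(2*a-1)*\<nu>\<bar> * (\<bar>a-2\<bar> * Q 1 + \<bar>\<nu>-1\<bar> * Q 2)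
         + \<bar>\<nu>*(\<nu>-1)\<bar> * (\<bar>a-2\<bar> * Q 2 + \<bar>\<nu>-2\<bar> * Q 3)"
  have Q0: "0 \<le> Q k" for k by (simp add: Q_def)
  have K0: "0 \<le> K" unfolding K_def by (intro add_nonneg_nonneg mult_nonneg_nonneg Q0 abs_ge_zero)
  have W: "1/4 \<le> 1 + h * ln (1 + u)" "1 + h * ln (1 + u) \<le> 4" if "0 \<le> h" "h \<le> 1" "\<bar>u\<bar> \<le> 1/2" for h u :: real
  proof -
    have "ln (1/2) \<le> ln (1 + u)" using that by (subst ln_le_cancel_iff) auto
    then have l: "- (25/36) \<le> ln (1 + u)" using ln2_le_25_over_36 by (simp add: ln_div)
    have "ln (1 + u) \<le> u" using that by (intro ln_add_one_self_le_self2) auto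
    then have ub: "ln (1 + u) \<le> 1/2" using that by linarith
    have "\<bar>h * ln (1 + u)\<bar> \<le> 1 * (25/36)"
      unfolding abs_mult using that l ub by (intro mult_mono) auto
    then show "1/4 \<le> 1 + h * ln (1 + u)" "1 + h * ln (1 + u) \<le> 4" by linarith+
  qed
  have dP: "(P h j k has_real_derivative (a - j) * P h (j+1) k u + (\<nu> - k) * h * P h (j+1) (k+1) u) (at u)"
    if "0 \<le> h" "h \<le> 1" "\<bar>u\<bar> \<le> 1/2" for h j k u
  proof -
    have pos: "1 + u > 0" "1 + h * ln (1 + u) > 0" using W[OF that] that by auto
    have e1: "(1 + u) powr (a - j - 1) = (1 + u) powr (a - j) / (1 + u)"
      using pos by (simp add: powr_diff)
    have e3: "a - (j + 1) = a - j - 1" "\<nu> - (k + 1) = \<nu> - k - 1" by auto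
    have d0: "((\<lambda>u. 1 + u) has_real_derivative 1) (at u)" by (auto intro!: derivative_eq_intros)
    have d1: "((\<lambda>u. (1 + u) powr (a - j)) has_real_derivative (a - j) * (1 + u) powr (a - j - 1)) (at u)"
      using DERIV_fun_powr[OF d0, of "a - j"] pos by simp
    have "((\<lambda>u. 1 + h * ln (1 + u)) has_real_derivative h / (1 + u)) (at u)"
      using pos by (auto intro!: derivative_eq_intros)
    then have d2: "((\<lambda>u. (1 + h * ln (1 + u)) powr (\<nu> - k)) has_real_derivative
        (\<nu> - k) * (1 + h * ln (1 + u)) powr (\<nu> - k - 1) * (h / (1 + u))) (at u)"
      using DERIV_fun_powr[of "\<lambda>u. 1 + h * ln (1 + u)" "h / (1 + u)" u "\<nu> - k"] pos by simp
    show ?thesis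
      unfolding P_def e3 using DERIV_mult[OF d1 d2] by (simp add: e1 mult_ac)
  qed
  have dd: "(diff h m has_real_derivative diff h (Suc m) u) (at u)"
    if "m < 3" "0 \<le> h" "h \<le> 1" "\<bar>u\<bar> \<le> 1/2" for h m u
  proof -
    note d = dP[OF that(2-4)]
    consider "m = 0" | "m = 1" | "m = 2" using \<open>m < 3\<close> by linarith
    then show ?thesis
    proof cases
      case 1
      then have "diff h m = P h 0 0" by (auto simp: diff_def)
      then show ?thesis using 1 d[of 0 0] by (simp add: diff_def)
    next
      case 2
      then have "diff h m = (\<lambda>u. a * P h 1 0 u + \<nu> * h * P h 1 1 u)" by (auto simp: diff_def)
      then show ?thesis
        using 2 DERIV_add[OF DERIV_cmult[OF d[of 1 0], of a] DERIV_cmult[OF d[of 1 1], of "\<nu>*h"]]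
        by (simp add: diff_def algebra_simps power2_eq_square)
    next
      case 3
      then have "diff h m = (\<lambda>u. a*(a-1) * P h 2 0 u + (2*a-1)*\<nu>*h * P h 2 1 u + \<nu>*(\<nu>-1)*h\<^sup>2 * P h 2 2 u)"
        by (auto simp: diff_def)
      then show ?thesis
        using 3 DERIV_add[OF DERIV_add[OF DERIV_cmult[OF d[of 2 0], of "a*(a-1)"]
              DERIV_cmult[OF d[of 2 1], of "(2*a-1)*\<nu>*h"]] DERIV_cmult[OF d[of 2 2], of "\<nu>*(\<nu>-1)*h\<^sup>2"]]
        by (simp add: diff_def)
    qed
  qed
  have P3: "\<bar>P h 3 k u\<bar> \<le> Q k" if "0 \<le> h" "h \<le> 1" "\<bar>u\<bar> \<le> 1/2" for h k u
    unfolding P_def Q_def abs_mult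
    using W[OF that] that by (intro mult_mono) (auto intro!: powr_le_four_powr_abs)
  have bound: "\<bar>diff h 3 u\<bar> \<le> K" if h: "0 \<le> h" "h \<le> 1" "\<bar>u\<bar> \<le> 1/2" for h u
  proof -
    have m: "\<bar>x * h * y\<bar> \<le> \<bar>x\<bar> * q" if "\<bar>y\<bar> \<le> q" for x y q :: real
      using mult_mono[of "\<bar>x\<bar> * h" "\<bar>x\<bar>" "\<bar>y\<bar>" q] that h by (simp add: abs_mult mult_left_le)
    have m0: "\<bar>x * y\<bar> \<le> \<bar>x\<bar> * q" if "\<bar>y\<bar> \<le> q" for x y q :: real
      using that by (simp add: abs_mult mult_left_mono)
    have A: "\<bar>(a-2) * P h 3 k u + (\<nu> - k) * h * P h 3 (k+1) u\<bar> \<le> \<bar>a-2\<bar> * Q k + \<bar>\<nu>-k\<bar> * Q (k+1)" for k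
      using m0[OF P3[OF h, of k], of "a-2"] m[OF P3[OF h, of "k+1"], of "\<nu>-k"] by linarith
    have h2: "x * h\<^sup>2 * y = x * h * (h * y)" for x y :: real by (simp add: power2_eq_square)
    have m2: "\<bar>x * h\<^sup>2 * y\<bar> \<le> \<bar>x\<bar> * q" if "\<bar>y\<bar> \<le> q" for x y q :: real
      unfolding h2 using m[of y q 1] that by (intro m) simp
    have "\<bar>diff h 3 u\<bar> \<le> \<bar>a*(a-1) * ((a-2) * P h 3 0 u + \<nu>*h * P h 3 1 u)\<bar>
         + \<bar>(2*a-1)*\<nu>*h * ((a-2) * P h 3 1 u + (\<nu>-1)*h * P h 3 2 u)\<bar>
         + \<bar>\<nu>*(\<nu>-1)*h\<^sup>2 * ((a-2) * P h 3 2 u + (\<nu>-2)*h * P h 3 3 u)\<bar>"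
      unfolding diff_def by simp
    also have "\<dots> \<le> K" unfolding K_def
      using A[of 0] A[of 1] A[of 2] by (intro add_mono m0 m m2) simp_all
    finally show ?thesis .
  qed
  show thesis
  proof (rule that[OF K0])
    fix h u :: real assume h: "0 \<le> h" "h \<le> 1" "\<bar>u\<bar> \<le> 1/2"
    show "\<bar>(1 + u) powr a * (1 + h * ln (1 + u)) powr \<nu>
          - (1 + lyap_c1 a \<nu> h * u + lyap_c2 a \<nu> h / 2 * u\<^sup>2)\<bar> \<le> K * \<bar>u\<bar> ^ 3"
    proof (cases "u = 0")
      case False
      have "\<exists>t. (if u < 0 then u < t \<and> t < 0 else 0 < t \<and> t < u) \<and>
        diff h 0 u = (\<Sum>m<3. (diff h m 0 / fact m) * (u - 0) ^ m) + (diff h 3 t / fact 3) * (u - 0) ^ 3"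
        by (rule Taylor[where a="-1/2" and b="1/2"]) (use dd h False in auto)
      then obtain t where t: "if u < 0 then u < t \<and> t < 0 else 0 < t \<and> t < u"
        and eq: "diff h 0 u = (\<Sum>m<3. (diff h m 0 / fact m) * u ^ m) + (diff h 3 t / fact 3) * u ^ 3"
        by auto
      have "\<bar>t\<bar> \<le> 1/2" using t h by (auto split: if_splits)
      then have b: "\<bar>diff h 3 t\<bar> \<le> K" using bound h by blast
      have "(\<Sum>m<3. (diff h m 0 / fact m) * u ^ m) = 1 + lyap_c1 a \<nu> h * u + lyap_c2 a \<nu> h / 2 * u\<^sup>2"
        by (simp add: numeral_3_eq_3 diff_def P_def lyap_c1_def lyap_c2_def power2_eq_square)
      then have "(1 + u) powr a * (1 + h * ln (1 + u)) powr \<nu>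
          - (1 + lyap_c1 a \<nu> h * u + lyap_c2 a \<nu> h / 2 * u\<^sup>2) = (diff h 3 t / fact 3) * u ^ 3"
        using eq by (simp add: diff_def P_def)
      moreover have "\<bar>(diff h 3 t / fact 3) * u ^ 3\<bar> \<le> K * \<bar>u\<bar> ^ 3"
        unfolding abs_mult power_abs using b K0 by (intro mult_right_mono) (auto simp: fact_numeral)
      ultimately show ?thesis by simp
    qed simp
  qed
qed

definition lyap :: "real \<Rightarrow> real \<Rightarrow> real \<Rightarrow> real" where
  "lyap a \<nu> y = y powr a * ln y powr \<nu>"

lemma lyap_nonneg [simp]: "0 \<le> lyap a \<nu> y"
  by (simp add: lyap_def)

lemma lyap_pos: "exp 1 \<le> y \<Longrightarrow> 0 < lyap a \<nu> y"
  using exp_ge_add_one_self[of 1] exp_gt_zero[of 1]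
  by (auto simp: lyap_def simp del: exp_gt_zero)

lemma ln_ge_1: "exp 1 \<le> (y::real) \<Longrightarrow> 1 \<le> ln y"
  by (meson exp_gt_zero less_le_trans ln_ge_iff)

lemma lyap_measurable [measurable]: "lyap a \<nu> \<in> borel_measurable borel"
  unfolding lyap_def by measurable

lemma lyap_mono:
  assumes "0 \<le> a" "0 \<le> a + \<nu>" "exp 1 \<le> x" "x \<le> y"
  shows "lyap a \<nu> x \<le> lyap a \<nu> y"
proof -
  have x0: "0 < x" "0 < y" using assms exp_gt_zero[of "1::real"] by linarith+
  have l: "1 \<le> ln x" "ln x \<le> ln y" using ln_ge_1 assms x0 by auto
  have "a * ln x + \<nu> * ln (ln x) \<le> a * ln y + \<nu> * ln (ln y)"
  proof (cases "\<nu> \<ge> 0")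
    case True
    then show ?thesis using l assms by (intro add_mono mult_left_mono) auto
  next
    case False
    have "ln (ln y) - ln (ln x) = ln (ln y / ln x)" using l by (simp add: ln_div)
    also have "\<dots> \<le> ln y / ln x - 1" using l by (intro ln_le_minus_one) auto
    also have "\<dots> = (ln y - ln x) / ln x" using l by (simp add: field_simps)
    also have "\<dots> \<le> ln y - ln x" using l by (simp add: divide_le_eq mult_right_mono mult_le_cancel_left1)
    finally have "(- \<nu>) * (ln (ln y) - ln (ln x)) \<le> (- \<nu>) * (ln y - ln x)"
      using False by (intro mult_left_mono) auto
    moreover have "0 \<le> (a + \<nu>) * (ln y - ln x)" using assms l by auto
    ultimately show ?thesis by (simp add: algebra_simps)
  qed
  then have le: "exp (a * ln x + \<nu> * ln (ln x)) \<le> exp (a * ln y + \<nu> * ln (ln y))" by simp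
  have eq: "lyap a \<nu> z = exp (a * ln z + \<nu> * ln (ln z))" if "0 < z" "1 \<le> ln z" for z
    using that unfolding exp_add lyap_def by (auto simp: powr_def)
  have "1 \<le> ln y" using l by linarith
  then show ?thesis using le eq[OF x0(1) l(1)] eq[OF x0(2)] by argo
qed

lemma lyap_strict_mono:
  assumes "0 < a" "0 \<le> \<nu>" "exp 1 \<le> x" "x < y"
  shows "lyap a \<nu> x < lyap a \<nu> y"
proof -
  have x0: "0 < x" "0 < y" using assms exp_gt_zero[of "1::real"] by linarith+
  have l: "1 \<le> ln x" "ln x < ln y" using ln_ge_1 assms x0 by auto
  have "1 < x" using assms exp_ge_add_one_self[of "1::real"] by linarith
  then show ?thesis unfolding lyap_def using assms x0 l
    by (intro mult_less_le_imp_less powr_less_mono2 powr_mono2) auto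
qed

lemma lyap_scale:
  assumes "exp 1 \<le> y" "exp 1 \<le> y * (1 + u)"
  shows "lyap a \<nu> (y * (1 + u)) = lyap a \<nu> y * ((1 + u) powr a * (1 + 1 / ln y * ln (1 + u)) powr \<nu>)"
proof -
  have y: "0 < y" "0 < y * (1 + u)" using assms exp_gt_zero[of "1::real"] by linarith+
  then have u: "0 < 1 + u" by (simp add: zero_less_mult_iff)
  have l: "1 \<le> ln y" "1 \<le> ln (y * (1 + u))" using assms ln_ge_1 by auto
  have e: "ln (y * (1 + u)) = ln y * (1 + 1 / ln y * ln (1 + u))"
    using u l ln_mult_pos[OF y(1) u] by (simp add: distrib_left del: ln_mult)
  have "0 < 1 + 1 / ln y * ln (1 + u)"
    using l unfolding e by (smt (verit) mult_le_0_iff)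
  then show ?thesis unfolding lyap_def e using y u l by (simp add: powr_mult)
qed

lemma abs_cube_le_interpolation:
  fixes u y \<kappa> p :: real
  assumes "\<bar>u\<bar> \<le> 1" "0 < y" "0 \<le> p"
  shows "\<bar>u\<bar> ^ 3 \<le> y powr (-\<kappa>) * u\<^sup>2 + y powr (\<kappa> * p) * \<bar>u\<bar> powr p"
proof (cases "\<bar>u\<bar> \<le> y powr (-\<kappa>)")
  case True
  have "\<bar>u\<bar> ^ 3 = \<bar>u\<bar> * u\<^sup>2" by (simp add: power3_eq_cube power2_eq_square)
  also have "\<dots> \<le> y powr (-\<kappa>) * u\<^sup>2" using True by (intro mult_right_mono) auto
  also have "\<dots> \<le> y powr (-\<kappa>) * u\<^sup>2 + y powr (\<kappa> * p) * \<bar>u\<bar> powr p" by simp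
  finally show ?thesis .
next
  case False
  have "(y powr (-\<kappa>)) powr p \<le> \<bar>u\<bar> powr p" using False assms by (intro powr_mono2) auto
  then have "y powr (- (\<kappa> * p)) \<le> \<bar>u\<bar> powr p" using assms by (simp add: powr_powr)
  then have "y powr (\<kappa> * p) * y powr (- (\<kappa> * p)) \<le> y powr (\<kappa> * p) * \<bar>u\<bar> powr p" by (intro mult_left_mono) auto
  then have "1 \<le> y powr (\<kappa> * p) * \<bar>u\<bar> powr p" using assms by (simp flip: powr_add)
  moreover have "\<bar>u\<bar> ^ 3 \<le> 1" using assms by (intro power_le_one) auto
  ultimately show ?thesis by (smt (verit) powr_ge_zero mult_nonneg_nonneg zero_le_power2)
qed

definition lyap_err :: "real \<Rightarrow> real \<Rightarrow> real \<Rightarrow> real \<Rightarrow> real" where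
  "lyap_err p \<kappa> y u = y powr (-\<kappa>) * u\<^sup>2 + y powr (\<kappa> * p) * \<bar>u\<bar> powr p"

lemma lyap_err_ge_large:
  fixes u y \<kappa> p :: real
  assumes "1/2 \<le> \<bar>u\<bar>" "1 \<le> y" "0 \<le> \<kappa>" "2 \<le> p"
  shows "(2 * \<bar>u\<bar>) powr p \<le> 2 powr p * lyap_err p \<kappa> y u"
proof -
  have "1 \<le> y powr (\<kappa> * p)" using assms by (intro ge_one_powr_ge_zero) auto
  then have "\<bar>u\<bar> powr p \<le> y powr (\<kappa> * p) * \<bar>u\<bar> powr p" by (simp add: mult_le_cancel_right1)
  also have "\<dots> \<le> lyap_err p \<kappa> y u" by (simp add: lyap_err_def)
  finally show ?thesis by (simp add: powr_mult)
qed

lemma lyap_upper_bound: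
  fixes a \<nu> p :: real
  assumes "0 < a" "0 \<le> a + \<nu>" "\<nu> \<le> 0" "a \<le> p" "2 \<le> p"
  obtains K where "0 \<le> K"
    "\<And>y u \<kappa>. exp 1 \<le> y \<Longrightarrow> exp 1 \<le> y * (1 + u) \<Longrightarrow> 0 \<le> \<kappa> \<Longrightarrow>
       lyap a \<nu> (y * (1 + u)) \<le> lyap a \<nu> y *
         (1 + lyap_c1 a \<nu> (1 / ln y) * u + lyap_c2 a \<nu> (1 / ln y) / 2 * u\<^sup>2 + K * lyap_err p \<kappa> y u)"
proof -
  obtain K where K: "0 \<le> K"
    "\<And>h u. 0 \<le> h \<Longrightarrow> h \<le> 1 \<Longrightarrow> \<bar>u\<bar> \<le> 1/2 \<Longrightarrow>
       \<bar>(1 + u) powr a * (1 + h * ln (1 + u)) powr \<nu>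
          - (1 + lyap_c1 a \<nu> h * u + lyap_c2 a \<nu> h / 2 * u\<^sup>2)\<bar> \<le> K * \<bar>u\<bar> ^ 3"
    using taylor_power_log by blast
  define C1 where "C1 = \<bar>a\<bar> + \<bar>\<nu>\<bar>"
  define C2 where "C2 = \<bar>a * (a - 1)\<bar> + \<bar>(2 * a - 1) * \<nu>\<bar> + \<bar>\<nu> * (\<nu> - 1)\<bar>"
  define K' where "K' = K + 2 powr p * ((3/2) powr a + 1 + C1 + C2)"
  have C: "0 \<le> C1" "0 \<le> C2" by (auto simp: C1_def C2_def)
  have K': "0 \<le> K'" "K \<le> K'" using K(1) C by (auto simp: K'_def intro!: add_nonneg_nonneg mult_nonneg_nonneg)
  show thesis
  proof (rule that[OF K'(1)])
    fix y u \<kappa> :: real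
    assume y: "exp 1 \<le> y" "exp 1 \<le> y * (1 + u)" "0 \<le> \<kappa>"
    have y1: "1 \<le> y" using y exp_ge_add_one_self[of "1::real"] by linarith
    have u: "0 < 1 + u" using y y1 exp_gt_zero[of "1::real"] by (smt (verit) mult_nonneg_nonpos)
    define h where "h = 1 / ln y"
    have h: "0 \<le> h" "h \<le> 1" using ln_ge_1[OF y(1)] by (auto simp: h_def)
    have e0: "0 \<le> lyap_err p \<kappa> y u" by (simp add: lyap_err_def)
    have c: "\<bar>lyap_c1 a \<nu> h\<bar> \<le> C1" "\<bar>lyap_c2 a \<nu> h\<bar> \<le> C2"
      unfolding C1_def C2_def using abs_lyap_c1_le abs_lyap_c2_le h by blast+
    define T where "T = 1 + lyap_c1 a \<nu> h * u + lyap_c2 a \<nu> h / 2 * u\<^sup>2"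
    define R where "R = (1 + u) powr a * (1 + h * ln (1 + u)) powr \<nu>"
    have sc: "lyap a \<nu> (y * (1 + u)) = lyap a \<nu> y * R"
      unfolding R_def h_def using lyap_scale y by blast
    have "R \<le> T + K' * lyap_err p \<kappa> y u"
    proof (cases "\<bar>u\<bar> \<le> 1/2")
      case True
      have "R \<le> T + K * \<bar>u\<bar> ^ 3" using K(2)[OF h True] unfolding R_def T_def by linarith
      also have "\<dots> \<le> T + K * lyap_err p \<kappa> y u"
        unfolding lyap_err_def using abs_cube_le_interpolation[of u y p \<kappa>] True y1 assms K(1)
        by (intro add_left_mono mult_left_mono) auto
      also have "\<dots> \<le> T + K' * lyap_err p \<kappa> y u" using K' e0 by (intro add_left_mono mult_right_mono)
      finally show ?thesis .
    next
      case False
      define q where "q = (2 * \<bar>u\<bar>) powr p"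
      have q1: "1 \<le> q" unfolding q_def using False assms by (intro ge_one_powr_ge_zero) auto
      have qu: "\<bar>u\<bar> \<le> q" unfolding q_def using False assms powr_mono[of 1 p "2 * \<bar>u\<bar>"] by auto
      have qu2: "u\<^sup>2 \<le> q" unfolding q_def using False assms powr_mono[of 2 p "2 * \<bar>u\<bar>"]
        by (simp add: powr_numeral power_mult_distrib) (smt (verit) zero_le_power2)
      have qa: "(2 * \<bar>u\<bar>) powr a \<le> q" unfolding q_def using False assms by (intro powr_mono) auto
      have lp: "0 < lyap a \<nu> y" using lyap_pos y by blast
      have "R \<le> (3/2) powr a * q + 1"
      proof (cases "u \<le> 0")
        case True
        then have "y * (1 + u) \<le> y" using y1 by (simp add: mult_left_le)
        then have "lyap a \<nu> (y * (1 + u)) \<le> lyap a \<nu> y" using y assms by (intro lyap_mono) auto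
        then have "R \<le> 1" using lp unfolding sc by (simp add: mult_le_cancel_left1)
        then show ?thesis using q1 by (smt (verit) mult_nonneg_nonneg powr_ge_zero)
      next
        case u0: False
        have "(1 + h * ln (1 + u)) powr \<nu> \<le> 1 powr \<nu>"
          using u0 h assms by (intro powr_mono2') auto
        then have "R \<le> (1 + u) powr a" unfolding R_def by (simp add: mult_left_le)
        also have "\<dots> \<le> (3/2 * (2 * \<bar>u\<bar>)) powr a" using u0 False assms by (intro powr_mono2) auto
        also have "\<dots> = (3/2) powr a * (2 * \<bar>u\<bar>) powr a" by (subst powr_mult) auto
        also have "\<dots> \<le> (3/2) powr a * q" using qa by (intro mult_left_mono) auto
        finally show ?thesis by simp
      qed
      also have "\<dots> \<le> T + ((3/2) powr a + 1 + C1 + C2) * q"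
      proof -
        have "\<bar>lyap_c1 a \<nu> h * u\<bar> \<le> C1 * q" unfolding abs_mult using c qu C by (intro mult_mono) auto
        moreover have "\<bar>lyap_c2 a \<nu> h / 2 * u\<^sup>2\<bar> \<le> C2 * q" unfolding abs_mult using c qu2 C by (intro mult_mono) auto
        ultimately show ?thesis using q1 unfolding T_def by (simp add: algebra_simps)
      qed
      also have "\<dots> \<le> T + ((3/2) powr a + 1 + C1 + C2) * (2 powr p * lyap_err p \<kappa> y u)"
        unfolding q_def using lyap_err_ge_large[of u y \<kappa> p] False y y1 assms C
        by (intro add_left_mono mult_left_mono) auto
      also have "\<dots> \<le> T + K' * lyap_err p \<kappa> y u"
        using K(1) e0 by (simp add: K'_def algebra_simps)
      finally show ?thesis .
    qed
    then have "lyap a \<nu> y * R \<le> lyap a \<nu> y * (T + K' * lyap_err p \<kappa> y u)" by (intro mult_left_mono) auto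
    then show "lyap a \<nu> (y * (1 + u)) \<le> lyap a \<nu> y *
         (1 + lyap_c1 a \<nu> (1 / ln y) * u + lyap_c2 a \<nu> (1 / ln y) / 2 * u\<^sup>2 + K' * lyap_err p \<kappa> y u)"
      unfolding sc T_def h_def .
  qed
qed

lemma lyap_lower_bound:
  fixes a \<nu> p :: real
  assumes "0 < a" "0 \<le> \<nu>" "2 \<le> p"
  obtains K where "0 \<le> K"
    "\<And>y u \<kappa> Y. exp 1 \<le> y \<Longrightarrow> exp 1 \<le> y * (1 + u) \<Longrightarrow> 0 \<le> \<kappa> \<Longrightarrow> y \<le> Y \<Longrightarrow>
       lyap a \<nu> y * (1 + lyap_c1 a \<nu> (1 / ln y) * u + lyap_c2 a \<nu> (1 / ln y) / 2 * u\<^sup>2 - K * lyap_err p \<kappa> y u)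
         \<le> lyap a \<nu> (min (y * (1 + u)) (2 * Y))"
proof -
  obtain K where K: "0 \<le> K"
    "\<And>h u. 0 \<le> h \<Longrightarrow> h \<le> 1 \<Longrightarrow> \<bar>u\<bar> \<le> 1/2 \<Longrightarrow>
       \<bar>(1 + u) powr a * (1 + h * ln (1 + u)) powr \<nu>
          - (1 + lyap_c1 a \<nu> h * u + lyap_c2 a \<nu> h / 2 * u\<^sup>2)\<bar> \<le> K * \<bar>u\<bar> ^ 3"
    using taylor_power_log by blast
  define C1 where "C1 = \<bar>a\<bar> + \<bar>\<nu>\<bar>"
  define C2 where "C2 = \<bar>a * (a - 1)\<bar> + \<bar>(2 * a - 1) * \<nu>\<bar> + \<bar>\<nu> * (\<nu> - 1)\<bar>"
  define K' where "K' = K + 2 powr p * (1 + C1 + C2)"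
  have C: "0 \<le> C1" "0 \<le> C2" by (auto simp: C1_def C2_def)
  have K': "0 \<le> K'" "K \<le> K'" using K(1) C by (auto simp: K'_def intro!: add_nonneg_nonneg mult_nonneg_nonneg)
  show thesis
  proof (rule that[OF K'(1)])
    fix y u \<kappa> Y :: real
    assume y: "exp 1 \<le> y" "exp 1 \<le> y * (1 + u)" "0 \<le> \<kappa>" and Y: "y \<le> Y"
    have y1: "1 \<le> y" using y exp_ge_add_one_self[of "1::real"] by linarith
    define h where "h = 1 / ln y"
    have h: "0 \<le> h" "h \<le> 1" using ln_ge_1[OF y(1)] by (auto simp: h_def)
    have e0: "0 \<le> lyap_err p \<kappa> y u" by (simp add: lyap_err_def)
    have c: "\<bar>lyap_c1 a \<nu> h\<bar> \<le> C1" "\<bar>lyap_c2 a \<nu> h\<bar> \<le> C2"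
      unfolding C1_def C2_def using abs_lyap_c1_le abs_lyap_c2_le h by blast+
    define T where "T = 1 + lyap_c1 a \<nu> h * u + lyap_c2 a \<nu> h / 2 * u\<^sup>2"
    have "lyap a \<nu> y * (T - K' * lyap_err p \<kappa> y u) \<le> lyap a \<nu> (min (y * (1 + u)) (2 * Y))"
    proof (cases "\<bar>u\<bar> \<le> 1/2")
      case True
      define R where "R = (1 + u) powr a * (1 + h * ln (1 + u)) powr \<nu>"
      have "y * (1 + u) \<le> Y * 2" using True Y y1 by (intro mult_mono) auto
      then have m: "min (y * (1 + u)) (2 * Y) = y * (1 + u)" by simp
      have sc: "lyap a \<nu> (y * (1 + u)) = lyap a \<nu> y * R"
        unfolding R_def h_def using lyap_scale y by blast
      have "T - K' * lyap_err p \<kappa> y u \<le> T - K * lyap_err p \<kappa> y u"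
        using K' e0 by (intro diff_left_mono mult_right_mono)
      also have "\<dots> \<le> T - K * \<bar>u\<bar> ^ 3"
        unfolding lyap_err_def using abs_cube_le_interpolation[of u y p \<kappa>] True y1 assms K(1)
        by (intro diff_left_mono mult_left_mono) auto
      also have "\<dots> \<le> R" using K(2)[OF h True] unfolding R_def T_def by linarith
      finally show ?thesis unfolding m sc by (intro mult_left_mono) auto
    next
      case False
      define q where "q = (2 * \<bar>u\<bar>) powr p"
      have q1: "1 \<le> q" unfolding q_def using False assms by (intro ge_one_powr_ge_zero) auto
      have qu: "\<bar>u\<bar> \<le> q" unfolding q_def using False assms powr_mono[of 1 p "2 * \<bar>u\<bar>"] by auto
      have qu2: "u\<^sup>2 \<le> q" unfolding q_def using False assms powr_mono[of 2 p "2 * \<bar>u\<bar>"]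
        by (simp add: powr_numeral power_mult_distrib) (smt (verit) zero_le_power2)
      have "\<bar>lyap_c1 a \<nu> h * u\<bar> \<le> C1 * q" unfolding abs_mult using c qu C by (intro mult_mono) auto
      moreover have "\<bar>lyap_c2 a \<nu> h / 2 * u\<^sup>2\<bar> \<le> C2 * q" unfolding abs_mult using c qu2 C by (intro mult_mono) auto
      moreover have "(1 + C1 + C2) * q \<le> K' * lyap_err p \<kappa> y u"
      proof -
        have "(1 + C1 + C2) * q \<le> (1 + C1 + C2) * (2 powr p * lyap_err p \<kappa> y u)"
          unfolding q_def using lyap_err_ge_large[of u y \<kappa> p] False y y1 assms C
          by (intro mult_left_mono) auto
        also have "\<dots> \<le> K' * lyap_err p \<kappa> y u" using K(1) e0 by (simp add: K'_def algebra_simps)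
        finally show ?thesis .
      qed
      ultimately have T1: "T - K' * lyap_err p \<kappa> y u \<le> 1 - q" unfolding T_def by (simp add: algebra_simps)
      show ?thesis
      proof (cases "u \<le> 0")
        case True
        have "lyap a \<nu> y * (T - K' * lyap_err p \<kappa> y u) \<le> 0"
          using T1 q1 by (intro mult_nonneg_nonpos) auto
        then show ?thesis using lyap_nonneg order_trans by blast
      next
        case u0: False
        have "lyap a \<nu> y * (T - K' * lyap_err p \<kappa> y u) \<le> lyap a \<nu> y"
          using T1 q1 by (intro mult_left_le) auto
        also have "\<dots> \<le> lyap a \<nu> (min (y * (1 + u)) (2 * Y))"
          using u0 y y1 Y assms by (intro lyap_mono) (auto simp: mult_le_cancel_left1)
        finally show ?thesis .
      qed
    qed
    then show "lyap a \<nu> y * (1 + lyap_c1 a \<nu> (1 / ln y) * u + lyap_c2 a \<nu> (1 / ln y) / 2 * u\<^sup>2 - K' * lyap_err p \<kappa> y u)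
         \<le> lyap a \<nu> (min (y * (1 + u)) (2 * Y))"
      unfolding T_def h_def .
  qed
qed


lemma lyap_drift_error:
  fixes a \<nu> c s2 p \<delta> C K e :: real
  assumes "0 < e" "2 < p" "0 < \<delta>" "0 \<le> K" "0 \<le> C" "0 < s2"
  defines "\<kappa> \<equiv> \<delta> / (2 * p)"
  obtains \<eta> x0 where "0 < \<eta>" "1 < x0"
    "\<And>x m v w y h. x0 \<le> x \<Longrightarrow> y = x + exp 1 \<Longrightarrow> h = 1 / ln y \<Longrightarrow>
       \<bar>m - c / x\<bar> \<le> \<eta> / (x * ln x) \<Longrightarrow> \<bar>v - s2\<bar> \<le> \<eta> / ln x \<Longrightarrow> 0 \<le> w \<Longrightarrow>
       w \<le> C * (1 + x) powr (p - 2 - \<delta>) \<Longrightarrow>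
       \<bar>lyap_c1 a \<nu> h * (m / y) + lyap_c2 a \<nu> h / 2 * (v / y\<^sup>2)
          - (a * c + a * (a - 1) * s2 / 2 + (\<nu> * c + (2 * a - 1) * \<nu> * s2 / 2) * h) / y\<^sup>2\<bar>
        + K * (y powr (-\<kappa>) * (v / y\<^sup>2) + y powr (\<kappa> * p) * (w / y powr p)) \<le> e * h / y\<^sup>2"
proof -
  define C1 where "C1 = \<bar>a\<bar> + \<bar>\<nu>\<bar>"
  define C2 where "C2 = \<bar>a * (a - 1)\<bar> + \<bar>(2 * a - 1) * \<nu>\<bar> + \<bar>\<nu> * (\<nu> - 1)\<bar>"
  have C: "0 \<le> C1" "0 \<le> C2" by (auto simp: C1_def C2_def)
  define \<eta> where "\<eta> = e / (2 * (C1 + C2 + 1))"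
  have \<eta>: "0 < \<eta>" using C assms by (simp add: \<eta>_def)
  define q where "q = p - 2 - \<delta>"
  define C3 where "C3 = C * exp \<bar>q\<bar>"
  define Err where "Err x = C1 * ((x + exp 1) / x * (1 / ln x) * \<eta> + \<bar>c\<bar> * exp 1 * (1 / x)) + C2 * (1 / ln x * \<eta>)
     + \<bar>\<nu> * (\<nu> - 1)\<bar> * s2 / 2 * (1 / ln (x + exp 1))\<^sup>2
     + K * ((x + exp 1) powr (-\<kappa>) * (s2 + \<eta>) + C3 * (x + exp 1) powr (-\<delta>/2))" for x
  have \<kappa>: "0 < \<kappa>" "\<kappa> * p = \<delta> / 2" using assms by (auto simp: \<kappa>_def)
  have t1: "((\<lambda>x::real. (x + exp 1) / x * (1 / ln x) * ln (x + exp 1)) \<longlongrightarrow> 1) at_top" by real_asymp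
  have t2: "((\<lambda>x::real. (1 / x) * ln (x + exp 1)) \<longlongrightarrow> 0) at_top" by real_asymp
  have t3: "((\<lambda>x::real. 1 / ln x * ln (x + exp 1)) \<longlongrightarrow> 1) at_top" by real_asymp
  have t4: "((\<lambda>x::real. (1 / ln (x + exp 1))\<^sup>2 * ln (x + exp 1)) \<longlongrightarrow> 0) at_top" by real_asymp
  have t5: "((\<lambda>x::real. (x + exp 1) powr (-\<kappa>) * ln (x + exp 1)) \<longlongrightarrow> 0) at_top" using \<kappa>(1) by real_asymp
  have t6: "((\<lambda>x::real. (x + exp 1) powr (-\<delta>/2) * ln (x + exp 1)) \<longlongrightarrow> 0) at_top" using assms(3) by real_asymp
  have "((\<lambda>x. C1 * ((x + exp 1) / x * (1 / ln x) * ln (x + exp 1) * \<eta> + \<bar>c\<bar> * exp 1 * (1 / x * ln (x + exp 1)))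
     + C2 * (1 / ln x * ln (x + exp 1) * \<eta>)
     + \<bar>\<nu> * (\<nu> - 1)\<bar> * s2 / 2 * ((1 / ln (x + exp 1))\<^sup>2 * ln (x + exp 1))
     + K * ((x + exp 1) powr (-\<kappa>) * ln (x + exp 1) * (s2 + \<eta>) + C3 * ((x + exp 1) powr (-\<delta>/2) * ln (x + exp 1))))
     \<longlongrightarrow> C1 * (1 * \<eta> + \<bar>c\<bar> * exp 1 * 0) + C2 * (1 * \<eta>) + \<bar>\<nu> * (\<nu> - 1)\<bar> * s2 / 2 * 0
       + K * (0 * (s2 + \<eta>) + C3 * 0)) at_top"
    by (intro tendsto_add tendsto_mult tendsto_const t1 t2 t3 t4 t5 t6)
  then have lim: "((\<lambda>x. Err x * ln (x + exp 1)) \<longlongrightarrow> (C1 + C2) * \<eta>) at_top"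
    by (simp add: Err_def algebra_simps)
  have "(C1 + C2) * \<eta> < 2 * (C1 + C2 + 1) * \<eta>" using C \<eta> by (intro mult_strict_right_mono) auto
  also have "\<dots> = e" using C unfolding \<eta>_def by simp
  finally have "(C1 + C2) * \<eta> < e" .
  from order_tendstoD(2)[OF lim this] obtain N where N: "\<And>x. N \<le> x \<Longrightarrow> Err x * ln (x + exp 1) < e"
    by (auto simp: eventually_at_top_linorder)
  define x0 where "x0 = max N (exp 1)"
  have e1: "(1::real) < exp 1" by simp
  show thesis
  proof (rule that[OF \<eta>])
    show "1 < x0" using e1 by (simp add: x0_def less_max_iff_disj)
    fix x m v w y h :: real
    assume x: "x0 \<le> x" and y: "y = x + exp 1" and h: "h = 1 / ln y"
      and m: "\<bar>m - c / x\<bar> \<le> \<eta> / (x * ln x)" and v: "\<bar>v - s2\<bar> \<le> \<eta> / ln x"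
      and w: "0 \<le> w" "w \<le> C * (1 + x) powr (p - 2 - \<delta>)"
    have x1: "exp 1 \<le> x" "0 < x" "1 < x" using x e1 unfolding x0_def by linarith+
    have y0: "0 < y" "exp 1 \<le> y" "1 + x \<le> y" "y \<le> exp 1 * (1 + x)"
    proof -
      have "x * 1 \<le> x * exp 1" using x1 by (intro mult_left_mono) auto
      then show "0 < y" "exp 1 \<le> y" "1 + x \<le> y" "y \<le> exp 1 * (1 + x)"
        using x1(2) e1 unfolding y by (simp_all add: algebra_simps del: exp_ge_zero one_less_exp_iff)
    qed
    have lx: "1 \<le> ln x" "1 \<le> ln y" using x1 y0 ln_ge_1 by auto
    have h01: "0 \<le> h" "h \<le> 1" "h * ln y = 1" using lx h by auto
    have c12: "\<bar>lyap_c1 a \<nu> h\<bar> \<le> C1" "\<bar>lyap_c2 a \<nu> h\<bar> \<le> C2"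
      unfolding C1_def C2_def using abs_lyap_c1_le abs_lyap_c2_le h01 by blast+
    have my: "\<bar>m * y - c\<bar> \<le> y / x * (1 / ln x) * \<eta> + \<bar>c\<bar> * exp 1 * (1 / x)"
    proof -
      have "m * y - c = (m - c / x) * y + c * (exp 1 / x)"
        using x1 y by (simp add: field_simps)
      then have "\<bar>m * y - c\<bar> \<le> \<bar>m - c / x\<bar> * y + \<bar>c\<bar> * (exp 1 / x)"
        using abs_triangle_ineq[of "(m - c / x) * y" "c * (exp 1 / x)"] x1 y0 by (simp add: abs_mult)
      also have "\<dots> \<le> \<eta> / (x * ln x) * y + \<bar>c\<bar> * (exp 1 / x)"
        using m y0 by (intro add_right_mono mult_right_mono) auto
      finally show ?thesis by (simp add: mult_ac)
    qed
    have v2: "v \<le> s2 + \<eta>"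
    proof -
      have "\<eta> / ln x \<le> \<eta>" using lx \<eta> by (simp add: divide_le_eq mult_le_cancel_left1)
      then show ?thesis using v by linarith
    qed
    define E1 where "E1 = lyap_c1 a \<nu> h * m * y + lyap_c2 a \<nu> h / 2 * v
          - (a * c + a * (a - 1) * s2 / 2 + (\<nu> * c + (2 * a - 1) * \<nu> * s2 / 2) * h)"
    define E2 where "E2 = y powr (-\<kappa>) * v + y powr (\<kappa> * p) * (w * y\<^sup>2 / y powr p)"
    have "E1 = lyap_c1 a \<nu> h * (m * y - c) + lyap_c2 a \<nu> h / 2 * (v - s2) + \<nu> * (\<nu> - 1) * s2 / 2 * h\<^sup>2"
      unfolding E1_def lyap_c1_def lyap_c2_def by (simp add: algebra_simps add_divide_distrib diff_divide_distrib)
    then have "\<bar>E1\<bar> \<le> \<bar>lyap_c1 a \<nu> h * (m * y - c)\<bar> + \<bar>lyap_c2 a \<nu> h / 2 * (v - s2)\<bar> + \<bar>\<nu> * (\<nu> - 1) * s2 / 2 * h\<^sup>2\<bar>"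
      by linarith
    also have "\<dots> \<le> C1 * (y / x * (1 / ln x) * \<eta> + \<bar>c\<bar> * exp 1 * (1 / x)) + C2 * (1 / ln x * \<eta>)
         + \<bar>\<nu> * (\<nu> - 1)\<bar> * s2 / 2 * h\<^sup>2"
    proof (intro add_mono)
      show "\<bar>lyap_c1 a \<nu> h * (m * y - c)\<bar> \<le> C1 * (y / x * (1 / ln x) * \<eta> + \<bar>c\<bar> * exp 1 * (1 / x))"
        unfolding abs_mult[of "lyap_c1 a \<nu> h"] using c12(1) my C(1) by (intro mult_mono) auto
      have "\<bar>v - s2\<bar> \<le> 1 / ln x * \<eta>" using v by simp
      moreover have "\<bar>lyap_c2 a \<nu> h / 2\<bar> \<le> C2" using c12(2) by linarith
      ultimately show "\<bar>lyap_c2 a \<nu> h / 2 * (v - s2)\<bar> \<le> C2 * (1 / ln x * \<eta>)"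
        unfolding abs_mult[of "lyap_c2 a \<nu> h / 2"] using C(2) by (intro mult_mono) auto
      show "\<bar>\<nu> * (\<nu> - 1) * s2 / 2 * h\<^sup>2\<bar> \<le> \<bar>\<nu> * (\<nu> - 1)\<bar> * s2 / 2 * h\<^sup>2"
        using assms by (simp add: abs_mult)
    qed
    finally have E1: "\<bar>E1\<bar> \<le> C1 * (y / x * (1 / ln x) * \<eta> + \<bar>c\<bar> * exp 1 * (1 / x)) + C2 * (1 / ln x * \<eta>)
         + \<bar>\<nu> * (\<nu> - 1)\<bar> * s2 / 2 * h\<^sup>2" .
    have "(1 + x) powr q \<le> exp \<bar>q\<bar> * y powr q"
    proof -
      have l1: "ln (1 + x) \<le> ln y" using y0 x1 by simp
      have "ln y \<le> ln (exp 1 * (1 + x))" using y0 by (subst ln_le_cancel_iff) auto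
      also have "\<dots> = 1 + ln (1 + x)" using x1 by (subst ln_mult_pos) auto
      finally have "\<bar>ln (1 + x) - ln y\<bar> \<le> 1" using l1 by linarith
      then have "q * (ln (1 + x) - ln y) \<le> \<bar>q\<bar>"
        by (metis abs_ge_self abs_mult abs_ge_zero mult_left_le order_trans)
      then have "q * ln (1 + x) \<le> \<bar>q\<bar> + q * ln y" by (simp add: algebra_simps)
      then have "exp (q * ln (1 + x)) \<le> exp (\<bar>q\<bar> + q * ln y)" by simp
      then show ?thesis using y0 x1 by (simp add: powr_def exp_add)
    qed
    then have w': "w \<le> C3 * y powr q"
      using w assms(5) unfolding C3_def q_def[symmetric]
      by (smt (verit) mult_left_mono mult.assoc)
    have "y powr (\<kappa> * p) * (w * y\<^sup>2 / y powr p) \<le> y powr (\<kappa> * p) * (C3 * y powr q * y\<^sup>2 / y powr p)"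
      using w' by (intro mult_left_mono divide_right_mono mult_right_mono) auto
    also have "\<dots> = C3 * (y powr (\<kappa> * p) * y powr q * y powr 2 / y powr p)"
      using y0 by (simp add: powr_numeral)
    also have "\<dots> = C3 * y powr (\<kappa> * p + q + 2 - p)"
      by (simp add: powr_add powr_diff)
    also have "\<kappa> * p + q + 2 - p = -\<delta>/2" using \<kappa> by (simp add: q_def)
    finally have E2: "E2 \<le> y powr (-\<kappa>) * (s2 + \<eta>) + C3 * y powr (-\<delta>/2)"
      unfolding E2_def using v2 by (intro add_mono mult_left_mono) auto
    have "\<bar>E1\<bar> + K * E2 \<le> Err x"
      unfolding Err_def y[symmetric] h[symmetric] using E1 mult_left_mono[OF E2 assms(4)] by linarith
    also have "\<dots> = Err x * ln y * h" using h01 by (simp add: mult.commute)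
    also have "\<dots> \<le> e * h" using N[of x] x h01 y unfolding x0_def by (intro mult_right_mono) auto
    finally have "(\<bar>E1\<bar> + K * E2) / y\<^sup>2 \<le> e * h / y\<^sup>2" by (intro divide_right_mono) auto
    moreover have "\<bar>lyap_c1 a \<nu> h * (m / y) + lyap_c2 a \<nu> h / 2 * (v / y\<^sup>2)
          - (a * c + a * (a - 1) * s2 / 2 + (\<nu> * c + (2 * a - 1) * \<nu> * s2 / 2) * h) / y\<^sup>2\<bar> = \<bar>E1\<bar> / y\<^sup>2"
    proof -
      have "lyap_c1 a \<nu> h * (m / y) + lyap_c2 a \<nu> h / 2 * (v / y\<^sup>2)
          - (a * c + a * (a - 1) * s2 / 2 + (\<nu> * c + (2 * a - 1) * \<nu> * s2 / 2) * h) / y\<^sup>2 = E1 / y\<^sup>2"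
        unfolding E1_def diff_divide_distrib add_divide_distrib
        using y0 by (simp add: power2_eq_square)
      then show ?thesis by simp
    qed
    moreover have "y powr (-\<kappa>) * (v / y\<^sup>2) + y powr (\<kappa> * p) * (w / y powr p) = E2 / y\<^sup>2"
      unfolding E2_def add_divide_distrib using y0 by simp
    ultimately show "\<bar>lyap_c1 a \<nu> h * (m / y) + lyap_c2 a \<nu> h / 2 * (v / y\<^sup>2)
          - (a * c + a * (a - 1) * s2 / 2 + (\<nu> * c + (2 * a - 1) * \<nu> * s2 / 2) * h) / y\<^sup>2\<bar>
        + K * (y powr (-\<kappa>) * (v / y\<^sup>2) + y powr (\<kappa> * p) * (w / y powr p)) \<le> e * h / y\<^sup>2"
      by (simp add: add_divide_distrib)
  qed
qed

lemma powr_add_le: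
  fixes a b p :: real
  assumes "0 \<le> a" "0 \<le> b" "0 \<le> p"
  shows "(a + b) powr p \<le> 2 powr p * (a powr p + b powr p)"
proof -
  have "(a + b) powr p \<le> (2 * max a b) powr p" using assms by (intro powr_mono2) auto
  also have "\<dots> = 2 powr p * max a b powr p" using assms by (simp add: powr_mult)
  also have "max a b powr p \<le> a powr p + b powr p" by (auto simp: max_def)
  finally show ?thesis by simp
qed

section \<open>Processes with asymptotically zero drift\<close>

locale lamperti = prob_space M for M :: "'a measure" +
  fixes F :: "nat \<Rightarrow> 'a measure" and S :: "real set" and X :: "nat \<Rightarrow> 'a \<Rightarrow> real"
    and c s2 p \<delta> C :: real
  assumes S_nonneg: "S \<subseteq> {0..}" and S_zero: "0 \<in> S"
    and S_locfin: "\<And>b. finite (S \<inter> {..b})" and S_unbdd: "\<not> bdd_above S"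
    and filt_sub: "\<And>t. 1 \<le> t \<Longrightarrow> subalgebra M (F t)"
    and filt_mono: "\<And>s t. 1 \<le> s \<Longrightarrow> s \<le> t \<Longrightarrow> sets (F s) \<subseteq> sets (F t)"
    and adapted: "\<And>t. 1 \<le> t \<Longrightarrow> X t \<in> borel_measurable (F t)"
    and S_valued: "\<And>t \<omega>. 1 \<le> t \<Longrightarrow> \<omega> \<in> space M \<Longrightarrow> X t \<omega> \<in> S"
    and start: "AE \<omega> in M. X 1 \<omega> = 0"
    and irreducible: "\<exists>(m :: real \<Rightarrow> real \<Rightarrow> nat) (\<phi> :: real \<Rightarrow> real \<Rightarrow> real).
               (\<forall>x\<in>S. \<forall>y\<in>S. 1 \<le> m x y \<and> 0 < \<phi> x y) \<and>
               (\<forall>y\<in>S. \<forall>t\<ge>1. AE \<omega> in M.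
                  real_cond_exp M (F t)
                    (indicator {\<omega>'\<in>space M. X (t + m (X t \<omega>') y) \<omega>' = y}) \<omega>
                  \<ge> \<phi> (X t \<omega>) y)"
    and s2_pos: "0 < s2"
    and mean: "\<And>e. 0 < e \<Longrightarrow> \<exists>x0. \<forall>t\<ge>1. AE \<omega> in M. X t \<omega> \<ge> x0 \<longrightarrow>
               \<bar>real_cond_exp M (F t) (\<lambda>\<omega>'. X (t + 1) \<omega>' - X t \<omega>') \<omega> - c / X t \<omega>\<bar>
                 \<le> e / (X t \<omega> * ln (X t \<omega>))"
    and var: "\<And>e. 0 < e \<Longrightarrow> \<exists>x0. \<forall>t\<ge>1. AE \<omega> in M. X t \<omega> \<ge> x0 \<longrightarrow>
               \<bar>real_cond_exp M (F t) (\<lambda>\<omega>'. (X (t + 1) \<omega>' - X t \<omega>')\<^sup>2) \<omega> - s2\<bar>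
                 \<le> e / ln (X t \<omega>)"
    and p_gt_2: "2 < p" and \<delta>_pos: "0 < \<delta>" and C_nonneg: "0 \<le> C"
    and moment: "\<And>t. 1 \<le> t \<Longrightarrow> AE \<omega> in M.
               nn_cond_exp M (F t) (\<lambda>\<omega>'. ennreal (\<bar>X (t + 1) \<omega>' - X t \<omega>'\<bar> powr p)) \<omega>
                 \<le> ennreal (C * (1 + X t \<omega>) powr (p - 2 - \<delta>))"
begin

definition D :: "nat \<Rightarrow> 'a \<Rightarrow> real" where "D t \<omega> = X (t + 1) \<omega> - X t \<omega>"

definition IE :: "'a set \<Rightarrow> ('a \<Rightarrow> real) \<Rightarrow> real" where
  "IE B f = (\<integral>\<omega>. f \<omega> * indicator B \<omega> \<partial>M)"

lemma sigma_finite_F: "1 \<le> t \<Longrightarrow> sigma_finite_subalgebra M (F t)"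
  by (intro finite_measure_subalgebra_is_sigma_finite finite_measure_subalgebra.intro
      finite_measure_subalgebra_axioms.intro filt_sub finite_measure_axioms)

lemma sets_F_events: "1 \<le> t \<Longrightarrow> B \<in> sets (F t) \<Longrightarrow> B \<in> events"
  using filt_sub unfolding subalgebra_def by blast

lemma space_F: "1 \<le> t \<Longrightarrow> space (F t) = space M"
  using filt_sub unfolding subalgebra_def by blast

lemma X_measurable: "1 \<le> t \<Longrightarrow> X t \<in> borel_measurable M"
  using measurable_from_subalg[OF filt_sub adapted] .

lemma X_measurable_F: "1 \<le> s \<Longrightarrow> s \<le> t \<Longrightarrow> X s \<in> borel_measurable (F t)"
  using measurable_from_subalg[of "F t" "F s", OF _ adapted] filt_mono space_F
  unfolding subalgebra_def by force

lemma D_measurable: "1 \<le> t \<Longrightarrow> D t \<in> borel_measurable M"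
  unfolding D_def[abs_def] using X_measurable[of t] X_measurable[of "t+1"] by simp

lemma X_nonneg: "1 \<le> t \<Longrightarrow> \<omega> \<in> space M \<Longrightarrow> 0 \<le> X t \<omega>"
  using S_valued S_nonneg by force

lemma event_state [intro]:
  "1 \<le> s \<Longrightarrow> s \<le> t \<Longrightarrow> A \<in> sets borel \<Longrightarrow> {\<omega> \<in> space M. X s \<omega> \<in> A} \<in> sets (F t)"
  using measurable_sets[OF X_measurable_F[of s t], of A] space_F[of t]
  by (simp add: vimage_def Int_def conj_commute)

lemma countable_S: "countable S"
proof (rule countable_subset)
  show "S \<subseteq> (\<Union>n::nat. S \<inter> {..real n})" using real_arch_simple by blast
  have "countable (S \<inter> {..real n})" for n using S_locfin by (rule countable_finite)
  then show "countable (\<Union>n::nat. S \<inter> {..real n})" by blast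
qed

lemma infinite_S: "infinite S"
proof
  assume "finite S"
  then have "bdd_above S" by simp
  then show False using S_unbdd by contradiction
qed

lemma event_eq: "1 \<le> s \<Longrightarrow> {\<omega> \<in> space M. X s \<omega> = v} \<in> events"
  using sets_F_events[OF _ event_state[of s s "{v}"]] by simp

lemma nn_moment_le:
  assumes "1 \<le> t" "B \<in> sets (F t)"
  shows "(\<integral>\<^sup>+\<omega>. ennreal (\<bar>D t \<omega>\<bar> powr p) * indicator B \<omega> \<partial>M)
     \<le> (\<integral>\<^sup>+\<omega>. ennreal (C * (1 + X t \<omega>) powr (p - 2 - \<delta>)) * indicator B \<omega> \<partial>M)"
proof -
  interpret sigma_finite_subalgebra M "F t" using sigma_finite_F assms by blast
  have [measurable]: "D t \<in> borel_measurable M" using D_measurable assms by blast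
  have "(\<integral>\<^sup>+\<omega>. ennreal (\<bar>D t \<omega>\<bar> powr p) * indicator B \<omega> \<partial>M)
      = (\<integral>\<^sup>+\<omega>. indicator B \<omega> * nn_cond_exp M (F t) (\<lambda>\<omega>. ennreal (\<bar>D t \<omega>\<bar> powr p)) \<omega> \<partial>M)"
    using assms by (subst nn_cond_exp_intg) (auto simp: mult.commute)
  also have "\<dots> \<le> (\<integral>\<^sup>+\<omega>. ennreal (C * (1 + X t \<omega>) powr (p - 2 - \<delta>)) * indicator B \<omega> \<partial>M)"
    using moment[OF assms(1)] unfolding D_def
    by (intro nn_integral_mono_AE) (auto simp: mult.commute intro!: mult_left_mono split: split_indicator)
  finally show ?thesis .
qed

lemma integrable_D_powr_X_powr:
  assumes "1 \<le> t"
  shows "integrable M (\<lambda>\<omega>. X t \<omega> powr p) \<and> integrable M (\<lambda>\<omega>. \<bar>D t \<omega>\<bar> powr p)"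
proof -
  have step: "integrable M (\<lambda>\<omega>. \<bar>D t \<omega>\<bar> powr p)" if t: "1 \<le> t" and i: "integrable M (\<lambda>\<omega>. X t \<omega> powr p)" for t
  proof (rule integrableI_bounded)
    have [measurable]: "D t \<in> borel_measurable M" using D_measurable t by blast
    show "(\<lambda>\<omega>. \<bar>D t \<omega>\<bar> powr p) \<in> borel_measurable M" by simp
    have "(\<integral>\<^sup>+\<omega>. ennreal (norm (\<bar>D t \<omega>\<bar> powr p)) \<partial>M) = (\<integral>\<^sup>+\<omega>. ennreal (\<bar>D t \<omega>\<bar> powr p) * indicator (space M) \<omega> \<partial>M)"
      by (intro nn_integral_cong) simp
    also have "\<dots> \<le> (\<integral>\<^sup>+\<omega>. ennreal (C * (1 + X t \<omega>) powr (p - 2 - \<delta>)) * indicator (space M) \<omega> \<partial>M)"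
      using sets.top[of "F t"] t by (intro nn_moment_le) (auto simp: space_F)
    also have "\<dots> \<le> (\<integral>\<^sup>+\<omega>. ennreal (C * (2 powr p * (1 + X t \<omega> powr p))) \<partial>M)"
    proof (intro nn_integral_mono)
      fix \<omega> assume w: "\<omega> \<in> space M"
      have "(1 + X t \<omega>) powr (p - 2 - \<delta>) \<le> (1 + X t \<omega>) powr p"
        using X_nonneg[OF t w] p_gt_2 \<delta>_pos by (intro powr_mono) auto
      also have "\<dots> \<le> 2 powr p * (1 powr p + X t \<omega> powr p)"
        using X_nonneg[OF t w] p_gt_2 by (intro powr_add_le) auto
      finally show "ennreal (C * (1 + X t \<omega>) powr (p - 2 - \<delta>)) * indicator (space M) \<omega>
          \<le> ennreal (C * (2 powr p * (1 + X t \<omega> powr p)))"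
        using w C_nonneg by (auto intro!: ennreal_leI mult_left_mono)
    qed
    also have "\<dots> < \<infinity>"
    proof -
      have "integrable M (\<lambda>\<omega>. C * (2 powr p * (1 + X t \<omega> powr p)))" using i by simp
      then have "(\<integral>\<^sup>+\<omega>. ennreal (norm (C * (2 powr p * (1 + X t \<omega> powr p)))) \<partial>M) < \<infinity>"
        unfolding integrable_iff_bounded by blast
      then show ?thesis using C_nonneg by (simp add: abs_mult)
    qed
    finally show "(\<integral>\<^sup>+\<omega>. ennreal (norm (\<bar>D t \<omega>\<bar> powr p)) \<partial>M) < \<infinity>" .
  qed
  have "integrable M (\<lambda>\<omega>. X t \<omega> powr p)"
    using assms
  proof (induction t rule: dec_induct)
    case base
    have "integrable M (\<lambda>\<omega>. X 1 \<omega> powr p) \<longleftrightarrow> integrable M (\<lambda>\<omega>. 0 :: real)"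
      using start X_measurable[of 1] by (intro integrable_cong_AE) auto
    then show ?case by simp
  next
    case (step t)
    have [measurable]: "X t \<in> borel_measurable M" "X (Suc t) \<in> borel_measurable M"
      using X_measurable step by auto
    have i: "integrable M (\<lambda>\<omega>. 2 powr p * (X t \<omega> powr p + \<bar>D t \<omega>\<bar> powr p))"
      using step \<open>\<And>t. 1 \<le> t \<Longrightarrow> integrable M (\<lambda>\<omega>. X t \<omega> powr p) \<Longrightarrow> integrable M (\<lambda>\<omega>. \<bar>D t \<omega>\<bar> powr p)\<close>
      by simp
    show ?case
    proof (rule Bochner_Integration.integrable_bound[OF i])
      show "AE \<omega> in M. norm (X (Suc t) \<omega> powr p) \<le> norm (2 powr p * (X t \<omega> powr p + \<bar>D t \<omega>\<bar> powr p))"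
      proof (rule AE_I2)
        fix \<omega> assume w: "\<omega> \<in> space M"
        have "X (Suc t) \<omega> powr p \<le> (X t \<omega> + \<bar>D t \<omega>\<bar>) powr p"
          using X_nonneg[of t \<omega>] X_nonneg[of "Suc t" \<omega>] w step p_gt_2 by (intro powr_mono2) (auto simp: D_def)
        also have "\<dots> \<le> 2 powr p * (X t \<omega> powr p + \<bar>D t \<omega>\<bar> powr p)"
          using X_nonneg[of t \<omega>] w step p_gt_2 by (intro powr_add_le) auto
        finally show "norm (X (Suc t) \<omega> powr p) \<le> norm (2 powr p * (X t \<omega> powr p + \<bar>D t \<omega>\<bar> powr p))"
          by simp
      qed
    qed measurable
  qed
  then show ?thesis using step assms by blast
qed

lemma integrable_D_powr: "1 \<le> t \<Longrightarrow> integrable M (\<lambda>\<omega>. \<bar>D t \<omega>\<bar> powr p)"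
  using integrable_D_powr_X_powr by blast

lemma integrable_D2: 
  assumes "1 \<le> t" shows "integrable M (\<lambda>\<omega>. (D t \<omega>)\<^sup>2)"
proof (rule Bochner_Integration.integrable_bound)
  show "integrable M (\<lambda>\<omega>. 1 + \<bar>D t \<omega>\<bar> powr p)" using integrable_D_powr[OF assms] by simp
  show "(\<lambda>\<omega>. (D t \<omega>)\<^sup>2) \<in> borel_measurable M" using D_measurable[OF assms] by simp
  have "u\<^sup>2 \<le> 1 + \<bar>u\<bar> powr p" for u :: real
  proof (cases "\<bar>u\<bar> \<le> 1")
    case True
    then have "u\<^sup>2 \<le> 1" by (simp add: abs_square_le_1)
    then show ?thesis by (smt (verit) powr_ge_zero)
  next
    case False
    then have "\<bar>u\<bar> powr 2 \<le> \<bar>u\<bar> powr p" using p_gt_2 by (intro powr_mono) auto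
    then show ?thesis using False by (simp add: powr_numeral)
  qed
  then show "AE \<omega> in M. norm ((D t \<omega>)\<^sup>2) \<le> norm (1 + \<bar>D t \<omega>\<bar> powr p)" by simp
qed

lemma integrable_D:
  assumes "1 \<le> t" shows "integrable M (D t)"
proof (rule Bochner_Integration.integrable_bound)
  show "integrable M (\<lambda>\<omega>. 1 + (D t \<omega>)\<^sup>2)" using integrable_D2[OF assms] by simp
  show "D t \<in> borel_measurable M" using D_measurable[OF assms] by simp
  have "\<bar>u\<bar> \<le> 1 + u\<^sup>2" for u :: real
    using zero_le_power2[of "\<bar>u\<bar> - 1"] by (simp add: power2_eq_square algebra_simps)
  then show "AE \<omega> in M. norm (D t \<omega>) \<le> norm (1 + (D t \<omega>)\<^sup>2)" by simp
qed

lemma IE_integrable: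
  fixes f :: "'a \<Rightarrow> real"
  shows "B \<in> events \<Longrightarrow> integrable M f \<Longrightarrow> integrable M (\<lambda>\<omega>. f \<omega> * indicator B \<omega>)"
  using integrable_mult_indicator[of B M f] by (simp add: mult.commute)

lemma IE_add: "B \<in> events \<Longrightarrow> integrable M f \<Longrightarrow> integrable M g \<Longrightarrow> IE B (\<lambda>\<omega>. f \<omega> + g \<omega>) = IE B f + IE B g"
  unfolding IE_def by (simp add: distrib_right IE_integrable)

lemma IE_diff: "B \<in> events \<Longrightarrow> integrable M f \<Longrightarrow> integrable M g \<Longrightarrow> IE B (\<lambda>\<omega>. f \<omega> - g \<omega>) = IE B f - IE B g"
  unfolding IE_def by (simp add: left_diff_distrib IE_integrable)

lemma IE_cmult: "IE B (\<lambda>\<omega>. k * f \<omega>) = k * IE B f"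
  unfolding IE_def by (simp add: mult.assoc)

lemma IE_const: "B \<in> events \<Longrightarrow> IE B (\<lambda>\<omega>. k) = k * prob B"
  unfolding IE_def by simp

lemma IE_mono_AE:
  assumes "B \<in> events" "integrable M f" "integrable M g" "AE \<omega> in M. \<omega> \<in> B \<longrightarrow> f \<omega> \<le> g \<omega>"
  shows "IE B f \<le> IE B g"
  unfolding IE_def using assms
  by (intro integral_mono_AE IE_integrable) (auto split: split_indicator)

lemma IE_mono:
  assumes "B \<in> events" "integrable M f" "integrable M g" "\<And>\<omega>. \<omega> \<in> B \<Longrightarrow> f \<omega> \<le> g \<omega>"
  shows "IE B f \<le> IE B g"
  using assms by (intro IE_mono_AE) auto

lemma IE_cong: "(\<And>\<omega>. \<omega> \<in> B \<Longrightarrow> f \<omega> = g \<omega>) \<Longrightarrow> IE B f = IE B g"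
  unfolding IE_def by (intro Bochner_Integration.integral_cong) (auto split: split_indicator)

lemma IE_nonneg: "(\<And>\<omega>. \<omega> \<in> B \<Longrightarrow> 0 \<le> f \<omega>) \<Longrightarrow> 0 \<le> IE B f"
  unfolding IE_def by (intro integral_nonneg_AE) (auto split: split_indicator)

lemma IE_real_cond_exp:
  assumes "1 \<le> t" "B \<in> sets (F t)" "integrable M f"
  shows "IE B (real_cond_exp M (F t) f) = IE B f" "integrable M (real_cond_exp M (F t) f)"
proof -
  interpret sigma_finite_subalgebra M "F t" using sigma_finite_F assms by blast
  show "IE B (real_cond_exp M (F t) f) = IE B f"
    using real_cond_exp_intA[OF assms(3,2)] by (simp add: IE_def set_lebesgue_integral_def mult.commute)
  show "integrable M (real_cond_exp M (F t) f)" using assms by (simp add: real_cond_exp_int)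
qed

lemma IE_cond_bound:
  assumes t: "1 \<le> t" "B \<in> sets (F t)" "integrable M f"
    and b: "AE \<omega> in M. \<omega> \<in> B \<longrightarrow> \<bar>real_cond_exp M (F t) f \<omega> - k\<bar> \<le> l"
  shows "\<bar>IE B f - k * prob B\<bar> \<le> l * prob B"
proof -
  note r = IE_real_cond_exp[OF t]
  have B: "B \<in> events" using sets_F_events t by blast
  have "IE B (real_cond_exp M (F t) f) \<le> IE B (\<lambda>_. k + l)"
    using b by (intro IE_mono_AE B r) auto
  moreover have "IE B (\<lambda>_. k - l) \<le> IE B (real_cond_exp M (F t) f)"
    using b by (intro IE_mono_AE B r) auto
  ultimately show ?thesis unfolding r IE_const[OF B] by (simp add: algebra_simps abs_le_iff)
qed

definition at_state :: "nat \<Rightarrow> real \<Rightarrow> 'a set \<Rightarrow> bool" where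
  "at_state t x B \<longleftrightarrow> 1 \<le> t \<and> B \<in> sets (F t) \<and> (\<forall>\<omega>\<in>B. X t \<omega> = x)"

lemma at_stateD:
  assumes "at_state t x B"
  shows "1 \<le> t" "B \<in> sets (F t)" "B \<in> events" "B \<subseteq> space M" "\<And>\<omega>. \<omega> \<in> B \<Longrightarrow> X t \<omega> = x"
  using assms sets_F_events sets.sets_into_space unfolding at_state_def by blast+

lemma local_moments:
  assumes "0 < e"
  obtains x0 where
    "\<And>t x B. x0 \<le> x \<Longrightarrow> at_state t x B \<Longrightarrow> \<bar>IE B (D t) - c / x * prob B\<bar> \<le> e / (x * ln x) * prob B"
    "\<And>t x B. x0 \<le> x \<Longrightarrow> at_state t x B \<Longrightarrow> \<bar>IE B (\<lambda>\<omega>. (D t \<omega>)\<^sup>2) - s2 * prob B\<bar> \<le> e / ln x * prob B"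
proof -
  obtain x1 where x1: "\<forall>t\<ge>1. AE \<omega> in M. X t \<omega> \<ge> x1 \<longrightarrow>
               \<bar>real_cond_exp M (F t) (\<lambda>\<omega>'. X (t + 1) \<omega>' - X t \<omega>') \<omega> - c / X t \<omega>\<bar>
                 \<le> e / (X t \<omega> * ln (X t \<omega>))" using mean assms by blast
  obtain x2 where x2: "\<forall>t\<ge>1. AE \<omega> in M. X t \<omega> \<ge> x2 \<longrightarrow>
               \<bar>real_cond_exp M (F t) (\<lambda>\<omega>'. (X (t + 1) \<omega>' - X t \<omega>')\<^sup>2) \<omega> - s2\<bar>
                 \<le> e / ln (X t \<omega>)" using var assms by blast
  show thesis
  proof (rule that[of "max x1 x2"])
    fix t x B assume x: "max x1 x2 \<le> x" and st: "at_state t x B"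
    note B = at_stateD[OF st]
    have "AE \<omega> in M. \<omega> \<in> B \<longrightarrow> \<bar>real_cond_exp M (F t) (D t) \<omega> - c / x\<bar> \<le> e / (x * ln x)"
      using x1[rule_format, OF B(1)] by eventually_elim (use B(5) x in \<open>auto simp: D_def[abs_def]\<close>)
    then show "\<bar>IE B (D t) - c / x * prob B\<bar> \<le> e / (x * ln x) * prob B"
      using IE_cond_bound B integrable_D by blast
    have "AE \<omega> in M. \<omega> \<in> B \<longrightarrow> \<bar>real_cond_exp M (F t) (\<lambda>\<omega>. (D t \<omega>)\<^sup>2) \<omega> - s2\<bar> \<le> e / ln x"
      using x2[rule_format, OF B(1)] by eventually_elim (use B(5) x in \<open>auto simp: D_def[abs_def]\<close>)
    then show "\<bar>IE B (\<lambda>\<omega>. (D t \<omega>)\<^sup>2) - s2 * prob B\<bar> \<le> e / ln x * prob B"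
      using IE_cond_bound B integrable_D2 by blast
  qed
qed

lemma local_p_moment:
  assumes "at_state t x B"
  shows "IE B (\<lambda>\<omega>. \<bar>D t \<omega>\<bar> powr p) \<le> C * (1 + x) powr (p - 2 - \<delta>) * prob B"
proof -
  note t = at_stateD(1,2)[OF assms] and B = at_stateD(3)[OF assms] and BX = at_stateD(5)[OF assms]
  have "ennreal (IE B (\<lambda>\<omega>. \<bar>D t \<omega>\<bar> powr p)) = (\<integral>\<^sup>+\<omega>. ennreal (\<bar>D t \<omega>\<bar> powr p * indicator B \<omega>) \<partial>M)"
    unfolding IE_def using integrable_D_powr[OF t(1)] B
    by (subst nn_integral_eq_integral) (auto intro!: IE_integrable)
  also have "\<dots> = (\<integral>\<^sup>+\<omega>. ennreal (\<bar>D t \<omega>\<bar> powr p) * indicator B \<omega> \<partial>M)"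
    by (intro nn_integral_cong) (auto split: split_indicator)
  also have "\<dots> \<le> (\<integral>\<^sup>+\<omega>. ennreal (C * (1 + X t \<omega>) powr (p - 2 - \<delta>)) * indicator B \<omega> \<partial>M)"
    using nn_moment_le t by blast
  also have "\<dots> = (\<integral>\<^sup>+\<omega>. ennreal (C * (1 + x) powr (p - 2 - \<delta>)) * indicator B \<omega> \<partial>M)"
    using BX by (intro nn_integral_cong) (auto split: split_indicator)
  also have "\<dots> = ennreal (C * (1 + x) powr (p - 2 - \<delta>) * prob B)"
    using B C_nonneg by (simp add: nn_integral_cmult_indicator emeasure_eq_measure ennreal_mult)
  finally show ?thesis using C_nonneg by (subst (asm) ennreal_le_iff) auto
qed

text \<open>Decomposing an \<open>F\<^sub>t\<close>-event according to the value of \<open>X\<^sub>t\<close> reduces conditional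
  estimates to events on which \<open>X\<^sub>t\<close> is constant.\<close>
lemma IE_mono_states:
  assumes t: "1 \<le> t" "B \<in> sets (F t)" and g: "integrable M g" and k: "integrable M k"
    and le: "\<And>x A \<omega>. at_state t x A \<Longrightarrow> A \<subseteq> B \<Longrightarrow> \<omega> \<in> A \<Longrightarrow> IE A g \<le> IE A k"
  shows "IE B g \<le> IE B k"
proof -
  define f where "f \<omega> = g \<omega> - k \<omega>" for \<omega>
  have f: "integrable M f" unfolding f_def using g k by simp
  define A where "A i = B \<inter> {\<omega> \<in> space M. X t \<omega> \<in> {from_nat_into S i}}" for i
  have A: "A i \<in> sets (F t)" for i using t unfolding A_def by (intro sets.Int event_state) auto
  have bij: "bij_betw (from_nat_into S) UNIV S" using bij_betw_from_nat_into countable_S infinite_S by blast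
  have U: "B = (\<Union>i. A i)"
  proof (intro equalityI subsetI)
    fix \<omega> assume w: "\<omega> \<in> B"
    then have "\<omega> \<in> space M" using sets.sets_into_space[OF sets_F_events[OF t]] by blast
    moreover from this have "X t \<omega> \<in> from_nat_into S ` UNIV"
      using S_valued[OF t(1)] bij unfolding bij_betw_def by blast
    ultimately show "\<omega> \<in> (\<Union>i. A i)" using w unfolding A_def by auto
  qed (auto simp: A_def)
  have disj: "disjoint_family A"
    using bij unfolding disjoint_family_on_def A_def bij_betw_def inj_on_def by auto
  have si: "set_integrable M (\<Union>i. A i) f"
    unfolding U[symmetric] set_integrable_def
    using f sets_F_events[OF t] by (intro integrable_mult_indicator)
  have eq: "IE B' f = (LINT x:B'|M. f x)" for B' by (simp add: IE_def set_lebesgue_integral_def mult.commute)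
  have AM: "A i \<in> events" for i using A sets_F_events t by blast
  have le0: "IE (A i) f \<le> 0" for i
  proof (cases "A i = {}")
    case False
    then obtain \<omega> where "\<omega> \<in> A i" by blast
    moreover have "at_state t (from_nat_into S i) (A i)" using t A by (auto simp: at_state_def A_def)
    moreover have "A i \<subseteq> B" by (auto simp: A_def)
    ultimately have "IE (A i) g \<le> IE (A i) k" by (intro le)
    then show ?thesis unfolding f_def using AM g k by (simp add: IE_diff)
  qed (simp add: IE_def)
  have "IE (\<Union>i<n. A i) f \<le> 0" for n
  proof -
    have "IE (\<Union>i<n. A i) f = (\<Sum>i<n. IE (A i) f)"
      unfolding eq using disj si AM
      by (intro set_integral_finite_Union) (auto simp: disjoint_family_on_def intro!: set_integrable_subset[OF si])
    then show ?thesis using le0 by (simp add: sum_nonpos)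
  qed
  moreover have "(\<lambda>n. IE (\<Union>i<n. A i) f) \<longlonglongrightarrow> IE B f"
  proof -
    have UU: "(\<Union>n. \<Union>i<n. A i) = B" unfolding U by auto
    show ?thesis
      unfolding eq UU[symmetric]
      by (rule set_integral_cont_up) (use AM si UU U in \<open>auto simp: incseq_def intro: less_le_trans\<close>)
  qed
  ultimately have "IE B f \<le> 0" using LIMSEQ_le_const2 by blast
  then show ?thesis unfolding f_def using g k sets_F_events[OF t] by (simp add: IE_diff)
qed

lemma irreducible_events:
  obtains m :: "real \<Rightarrow> real \<Rightarrow> nat" and \<phi> :: "real \<Rightarrow> real \<Rightarrow> real" where
    "\<And>x y. x \<in> S \<Longrightarrow> y \<in> S \<Longrightarrow> 1 \<le> m x y" "\<And>x y. x \<in> S \<Longrightarrow> y \<in> S \<Longrightarrow> 0 < \<phi> x y"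
    "\<And>t y. 1 \<le> t \<Longrightarrow> y \<in> S \<Longrightarrow> {\<omega> \<in> space M. X (t + m (X t \<omega>) y) \<omega> = y} \<in> events"
    "\<And>t y B k. 1 \<le> t \<Longrightarrow> y \<in> S \<Longrightarrow> B \<in> sets (F t) \<Longrightarrow>
       AE \<omega> in M. \<omega> \<in> B \<longrightarrow> k \<le> \<phi> (X t \<omega>) y \<Longrightarrow>
       k * prob B \<le> prob (B \<inter> {\<omega> \<in> space M. X (t + m (X t \<omega>) y) \<omega> = y})"
proof -
  obtain m :: "real \<Rightarrow> real \<Rightarrow> nat" and \<phi> :: "real \<Rightarrow> real \<Rightarrow> real" where
    m: "\<forall>x\<in>S. \<forall>y\<in>S. 1 \<le> m x y \<and> 0 < \<phi> x y" and
    ae: "\<forall>y\<in>S. \<forall>t\<ge>1. AE \<omega> in M. real_cond_exp M (F t)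
           (indicator {\<omega>'\<in>space M. X (t + m (X t \<omega>') y) \<omega>' = y}) \<omega> \<ge> \<phi> (X t \<omega>) y"
    using irreducible by blast
  have meas: "{\<omega> \<in> space M. X (t + m (X t \<omega>) y) \<omega> = y} \<in> events" if t: "1 \<le> t" "y \<in> S" for t y
  proof -
    have "{\<omega> \<in> space M. X (t + m (X t \<omega>) y) \<omega> = y}
        = (\<Union>x\<in>S. {\<omega> \<in> space M. X t \<omega> \<in> {x}} \<inter> {\<omega> \<in> space M. X (t + m x y) \<omega> \<in> {y}})"
      using S_valued[OF t(1)] by auto
    also have "\<dots> \<in> events"
      using t event_eq by (intro sets.countable_UN'' countable_S sets.Int) auto
    finally show ?thesis .
  qed
  have "k * prob B \<le> prob (B \<inter> {\<omega> \<in> space M. X (t + m (X t \<omega>) y) \<omega> = y})" (is "_ \<le> prob (B \<inter> ?E)")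
    if t: "1 \<le> t" "y \<in> S" "B \<in> sets (F t)" and k: "AE \<omega> in M. \<omega> \<in> B \<longrightarrow> k \<le> \<phi> (X t \<omega>) y" for t y B k
  proof -
    have B: "B \<in> events" using sets_F_events t by blast
    have E: "?E \<in> events" using meas t by blast
    have i: "integrable M (indicator ?E :: 'a \<Rightarrow> real)" using E by (simp add: integrable_indicator_iff less_top[symmetric])
    have "k * prob B = IE B (\<lambda>_. k)" using IE_const B by simp
    also have "\<dots> \<le> IE B (real_cond_exp M (F t) (indicator ?E))"
    proof (intro IE_mono_AE B IE_real_cond_exp(2)[OF t(1,3) i])
      have "AE \<omega> in M. real_cond_exp M (F t) (indicator ?E) \<omega> \<ge> \<phi> (X t \<omega>) y" using ae t by blast
      then show "AE \<omega> in M. \<omega> \<in> B \<longrightarrow> k \<le> real_cond_exp M (F t) (indicator ?E) \<omega>"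
        using k by eventually_elim auto
    qed simp
    also have "\<dots> = IE B (indicator ?E)" using IE_real_cond_exp(1)[OF t(1,3) i] .
    also have "\<dots> = (\<integral>\<omega>. indicator (B \<inter> ?E) \<omega> \<partial>M)"
      unfolding IE_def by (intro Bochner_Integration.integral_cong) (auto split: split_indicator)
    also have "\<dots> = prob (B \<inter> ?E)" using B E by (simp add: Int_assoc)
    finally show ?thesis .
  qed
  then show thesis using m meas by (intro that[of m \<phi>]) auto
qed

lemma hit_zero:
  fixes x0 :: real
  obtains m0 :: nat and \<phi>0 :: real where "0 < \<phi>0" "\<phi>0 \<le> 1"
    "\<forall>t\<ge>1. \<forall>B\<in>sets (F t). (\<forall>\<omega>\<in>B. X t \<omega> \<le> x0) \<longrightarrow>
       \<phi>0 * prob B \<le> prob (B \<inter> {\<omega> \<in> space M. \<exists>s\<in>{t<..t+m0}. X s \<omega> = 0})"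
proof -
  obtain m \<phi> where m: "\<And>x y. x \<in> S \<Longrightarrow> y \<in> S \<Longrightarrow> 1 \<le> m x y" "\<And>x y. x \<in> S \<Longrightarrow> y \<in> S \<Longrightarrow> 0 < \<phi> x y"
    and meas: "\<And>t y. 1 \<le> t \<Longrightarrow> y \<in> S \<Longrightarrow> {\<omega> \<in> space M. X (t + m (X t \<omega>) y) \<omega> = y} \<in> events"
    and le: "\<And>t y B k. 1 \<le> t \<Longrightarrow> y \<in> S \<Longrightarrow> B \<in> sets (F t) \<Longrightarrow>
       AE \<omega> in M. \<omega> \<in> B \<longrightarrow> k \<le> \<phi> (X t \<omega>) y \<Longrightarrow>
       k * prob B \<le> prob (B \<inter> {\<omega> \<in> space M. X (t + m (X t \<omega>) y) \<omega> = y})"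
    using irreducible_events by blast
  define S0 where "S0 = S \<inter> {..x0}"
  have fin: "finite S0" using S_locfin by (simp add: S0_def)
  define \<phi>0 where "\<phi>0 = Min (insert 1 ((\<lambda>x. \<phi> x 0) ` S0))"
  define m0 where "m0 = Max (insert 1 ((\<lambda>x. m x 0) ` S0))"
  have m0: "m x 0 \<le> m0" if "x \<in> S0" for x using that fin unfolding m0_def by (intro Max_ge) auto
  have \<phi>0: "\<phi>0 \<le> \<phi> x 0" if "x \<in> S0" for x using that fin unfolding \<phi>0_def by (intro Min_le) auto
  show thesis
  proof (rule that[of \<phi>0 m0])
    show "0 < \<phi>0" unfolding \<phi>0_def using fin m(2)[OF _ S_zero] by (subst Min_gr_iff) (auto simp: S0_def)
    show "\<phi>0 \<le> 1" unfolding \<phi>0_def using fin by (intro Min_le) auto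
    show "\<forall>t\<ge>1. \<forall>B\<in>sets (F t). (\<forall>\<omega>\<in>B. X t \<omega> \<le> x0) \<longrightarrow>
       \<phi>0 * prob B \<le> prob (B \<inter> {\<omega> \<in> space M. \<exists>s\<in>{t<..t+m0}. X s \<omega> = 0})"
    proof (intro allI ballI impI)
      fix t B assume t: "1 \<le> (t::nat)" and B: "B \<in> sets (F t)" and BX: "\<forall>\<omega>\<in>B. X t \<omega> \<le> x0"
      have Bs: "B \<subseteq> space M" using sets.sets_into_space sets_F_events[OF t B] by blast
      have in_S0: "X t \<omega> \<in> S0" if "\<omega> \<in> B" for \<omega> using that BX S_valued[OF t] Bs unfolding S0_def by auto
      have ev: "{\<omega> \<in> space M. \<exists>s\<in>{t<..t+m0}. X s \<omega> = 0} \<in> events"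
      proof -
        have "{\<omega> \<in> space M. \<exists>s\<in>{t<..t+m0}. X s \<omega> = 0} = (\<Union>s\<in>{t<..t+m0}. {\<omega> \<in> space M. X s \<omega> \<in> {0}})" by auto
        also have "\<dots> \<in> events"
          using t event_eq by (intro sets.finite_UN) auto
        finally show ?thesis .
      qed
      have "\<phi>0 * prob B \<le> prob (B \<inter> {\<omega> \<in> space M. X (t + m (X t \<omega>) 0) \<omega> = 0})"
        using le[OF t S_zero B] \<phi>0 in_S0 by simp
      also have "\<dots> \<le> prob (B \<inter> {\<omega> \<in> space M. \<exists>s\<in>{t<..t+m0}. X s \<omega> = 0})"
      proof (rule finite_measure_mono)
        show "B \<inter> {\<omega> \<in> space M. \<exists>s\<in>{t<..t+m0}. X s \<omega> = 0} \<in> events" using ev sets_F_events[OF t B] by blast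
        show "B \<inter> {\<omega> \<in> space M. X (t + m (X t \<omega>) 0) \<omega> = 0} \<subseteq> B \<inter> {\<omega> \<in> space M. \<exists>s\<in>{t<..t+m0}. X s \<omega> = 0}"
        proof
          fix \<omega> assume w: "\<omega> \<in> B \<inter> {\<omega> \<in> space M. X (t + m (X t \<omega>) 0) \<omega> = 0}"
          then have "X t \<omega> \<in> S0" using in_S0 by blast
          then have "m (X t \<omega>) 0 \<le> m0" "1 \<le> m (X t \<omega>) 0" using m0 m(1)[OF _ S_zero] by (auto simp: S0_def)
          then show "\<omega> \<in> B \<inter> {\<omega> \<in> space M. \<exists>s\<in>{t<..t+m0}. X s \<omega> = 0}"
            using w by (auto intro!: bexI[of _ "t + m (X t \<omega>) 0"])
        qed
      qed
      finally show "\<phi>0 * prob B \<le> prob (B \<inter> {\<omega> \<in> space M. \<exists>s\<in>{t<..t+m0}. X s \<omega> = 0})" .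
    qed
  qed
qed

lemma reach_state:
  assumes "v \<in> S"
  obtains s where "1 < s" "0 < prob {\<omega> \<in> space M. X s \<omega> = v}"
proof -
  obtain m \<phi> where m: "\<And>x y. x \<in> S \<Longrightarrow> y \<in> S \<Longrightarrow> 1 \<le> m x y" "\<And>x y. x \<in> S \<Longrightarrow> y \<in> S \<Longrightarrow> 0 < \<phi> x y"
    and meas: "\<And>t y. 1 \<le> t \<Longrightarrow> y \<in> S \<Longrightarrow> {\<omega> \<in> space M. X (t + m (X t \<omega>) y) \<omega> = y} \<in> events"
    and le: "\<And>t y B k. 1 \<le> t \<Longrightarrow> y \<in> S \<Longrightarrow> B \<in> sets (F t) \<Longrightarrow>
       AE \<omega> in M. \<omega> \<in> B \<longrightarrow> k \<le> \<phi> (X t \<omega>) y \<Longrightarrow>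
       k * prob B \<le> prob (B \<inter> {\<omega> \<in> space M. X (t + m (X t \<omega>) y) \<omega> = y})"
    using irreducible_events by blast
  have top: "space M \<in> sets (F 1)" by (metis sets.top space_F le_refl)
  have "\<phi> 0 v * prob (space M) \<le> prob (space M \<inter> {\<omega> \<in> space M. X (1 + m (X 1 \<omega>) v) \<omega> = v})"
  proof (rule le[OF _ assms top])
    show "AE \<omega> in M. \<omega> \<in> space M \<longrightarrow> \<phi> 0 v \<le> \<phi> (X 1 \<omega>) v"
      using start by eventually_elim simp
  qed simp
  then have "0 < prob {\<omega> \<in> space M. X (1 + m (X 1 \<omega>) v) \<omega> = v}"
    using m(2)[OF S_zero assms] prob_space by (simp add: Int_absorb1)
  also have "prob {\<omega> \<in> space M. X (1 + m (X 1 \<omega>) v) \<omega> = v} = prob {\<omega> \<in> space M. X (1 + m 0 v) \<omega> = v}"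
  proof (rule finite_measure_eq_AE)
    show "AE \<omega> in M. (\<omega> \<in> {\<omega> \<in> space M. X (1 + m (X 1 \<omega>) v) \<omega> = v}) = (\<omega> \<in> {\<omega> \<in> space M. X (1 + m 0 v) \<omega> = v})"
      using start by eventually_elim simp
    show "{\<omega> \<in> space M. X (1 + m (X 1 \<omega>) v) \<omega> = v} \<in> events" using meas[OF _ assms, of 1] by simp
    show "{\<omega> \<in> space M. X (1 + m 0 v) \<omega> = v} \<in> events"
      using event_eq by simp
  qed
  finally show thesis using m(1)[OF S_zero assms] by (intro that[of "1 + m 0 v"]) auto
qed


text \<open>Below, \<open>lyap\<close> is always applied to \<open>X\<^sub>t + e\<close>, where its logarithmic factor is at least one.\<close>
definition rate :: "real \<Rightarrow> real \<Rightarrow> real \<Rightarrow> real" where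
  "rate a \<nu> h = a * c + a * (a - 1) * s2 / 2 + (\<nu> * c + (2 * a - 1) * \<nu> * s2 / 2) * h"

lemma integrable_bounded:
  fixes f :: "'a \<Rightarrow> real"
  assumes "f \<in> borel_measurable M" "\<And>\<omega>. \<omega> \<in> space M \<Longrightarrow> \<bar>f \<omega>\<bar> \<le> K"
  shows "integrable M f"
  using assms by (intro integrable_const_bound[of _ K]) auto

lemma integrable_lyap_min:
  assumes "1 \<le> t" "0 \<le> a" "0 \<le> a + \<nu>" "exp 1 \<le> Y"
  shows "integrable M (\<lambda>\<omega>. lyap a \<nu> (min (X t \<omega> + exp 1) Y))"
proof (rule integrable_bounded)
  have [measurable]: "X t \<in> borel_measurable M" using X_measurable assms by blast
  show "(\<lambda>\<omega>. lyap a \<nu> (min (X t \<omega> + exp 1) Y)) \<in> borel_measurable M" by measurable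
  fix \<omega> assume "\<omega> \<in> space M"
  then have "0 \<le> X t \<omega>" using X_nonneg assms by blast
  then have "lyap a \<nu> (min (X t \<omega> + exp 1) Y) \<le> lyap a \<nu> Y"
    using assms by (intro lyap_mono) auto
  then show "\<bar>lyap a \<nu> (min (X t \<omega> + exp 1) Y)\<bar> \<le> lyap a \<nu> Y" by simp
qed

definition taylor :: "real \<Rightarrow> real \<Rightarrow> nat \<Rightarrow> real \<Rightarrow> 'a \<Rightarrow> real" where
  "taylor a \<nu> t y \<omega> = 1 + lyap_c1 a \<nu> (1 / ln y) * (D t \<omega> / y) + lyap_c2 a \<nu> (1 / ln y) / 2 * (D t \<omega> / y)\<^sup>2"

definition taylor_err :: "nat \<Rightarrow> real \<Rightarrow> 'a \<Rightarrow> real" where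
  "taylor_err t y \<omega> = lyap_err p (\<delta> / (2 * p)) y (D t \<omega> / y)"

text \<open>The error terms of the Taylor expansion of \<open>lyap\<close> are of smaller order than
  the logarithmic correction \<open>h / y\<^sup>2\<close> that decides the sign of the drift.\<close>
lemma lyap_quadratic_drift:
  fixes a \<nu> K e :: real
  assumes K: "0 \<le> K" and e: "0 < e"
  obtains x0 where "1 < x0"
    "\<forall>t x B y. x0 \<le> x \<longrightarrow> at_state t x B \<longrightarrow> y = x + exp 1 \<longrightarrow>
       integrable M (taylor a \<nu> t y) \<and> integrable M (taylor_err t y) \<and>
       IE B (\<lambda>\<omega>. taylor a \<nu> t y \<omega> + K * taylor_err t y \<omega>)
         \<le> (1 + (rate a \<nu> (1 / ln y) + e * (1 / ln y)) / y\<^sup>2) * prob B \<and>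
       (1 + (rate a \<nu> (1 / ln y) - e * (1 / ln y)) / y\<^sup>2) * prob B
         \<le> IE B (\<lambda>\<omega>. taylor a \<nu> t y \<omega> - K * taylor_err t y \<omega>)"
proof -
  define \<kappa> where "\<kappa> = \<delta> / (2 * p)"
  obtain \<eta> x1 where \<eta>: "0 < \<eta>" and x1: "1 < x1" and dr:
    "\<And>x m v w y h. x1 \<le> x \<Longrightarrow> y = x + exp 1 \<Longrightarrow> h = 1 / ln y \<Longrightarrow>
       \<bar>m - c / x\<bar> \<le> \<eta> / (x * ln x) \<Longrightarrow> \<bar>v - s2\<bar> \<le> \<eta> / ln x \<Longrightarrow> 0 \<le> w \<Longrightarrow>
       w \<le> C * (1 + x) powr (p - 2 - \<delta>) \<Longrightarrow>
       \<bar>lyap_c1 a \<nu> h * (m / y) + lyap_c2 a \<nu> h / 2 * (v / y\<^sup>2)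
          - (a * c + a * (a - 1) * s2 / 2 + (\<nu> * c + (2 * a - 1) * \<nu> * s2 / 2) * h) / y\<^sup>2\<bar>
        + K * (y powr (-\<kappa>) * (v / y\<^sup>2) + y powr (\<kappa> * p) * (w / y powr p)) \<le> e * h / y\<^sup>2"
    unfolding \<kappa>_def
    using lyap_drift_error[OF e p_gt_2 \<delta>_pos K C_nonneg s2_pos, where a=a and \<nu>=\<nu> and c=c] by blast
  obtain x2 where mom:
    "\<And>t x B. x2 \<le> x \<Longrightarrow> at_state t x B \<Longrightarrow> \<bar>IE B (D t) - c / x * prob B\<bar> \<le> \<eta> / (x * ln x) * prob B"
    "\<And>t x B. x2 \<le> x \<Longrightarrow> at_state t x B \<Longrightarrow> \<bar>IE B (\<lambda>\<omega>. (D t \<omega>)\<^sup>2) - s2 * prob B\<bar> \<le> \<eta> / ln x * prob B"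
    using local_moments[OF \<eta>] by blast
  have div: "\<bar>u / q - k\<bar> \<le> l" if "\<bar>u - k * q\<bar> \<le> l * q" "0 < q" for u k l q :: real
  proof -
    have "u / q - k = (u - k * q) / q" using that by (simp add: field_simps)
    then show ?thesis using that by (simp add: pos_divide_le_eq)
  qed
  show thesis
  proof (rule that[of "max x1 x2"], goal_cases)
    case 1
    then show ?case using x1 by simp
  next
    case 2
    show ?case
    proof (intro allI impI)
      fix t B and x y :: real
      assume x: "max x1 x2 \<le> x" and st: "at_state t x B" and y_def: "y = x + exp 1"
      note B = at_stateD[OF st]
      let ?T = "taylor a \<nu> t y" and ?R = "taylor_err t y"
      define h where "h = 1 / ln y"
      have y: "0 < y" using x x1 exp_gt_zero[of "1::real"] unfolding y_def by linarith
      have T: "?T = (\<lambda>\<omega>. 1 + lyap_c1 a \<nu> h / y * D t \<omega> + lyap_c2 a \<nu> h / 2 / y\<^sup>2 * (D t \<omega>)\<^sup>2)"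
        by (simp add: taylor_def h_def power_divide fun_eq_iff)
      have R: "?R = (\<lambda>\<omega>. y powr (-\<kappa>) / y\<^sup>2 * (D t \<omega>)\<^sup>2 + y powr (\<kappa> * p) / y powr p * \<bar>D t \<omega>\<bar> powr p)"
        using y by (simp add: taylor_err_def \<kappa>_def lyap_err_def power_divide powr_divide abs_divide algebra_simps fun_eq_iff)
      have i: "integrable M (D t)" "integrable M (\<lambda>\<omega>. (D t \<omega>)\<^sup>2)" "integrable M (\<lambda>\<omega>. \<bar>D t \<omega>\<bar> powr p)"
        using integrable_D integrable_D2 integrable_D_powr B(1) by auto
      have iTR: "integrable M ?T" "integrable M ?R" unfolding T R using i by simp_all
      have T_eq: "IE B (\<lambda>\<omega>. 1 + q * D t \<omega> + q' * (D t \<omega>)\<^sup>2) = prob B + q * IE B (D t) + q' * IE B (\<lambda>\<omega>. (D t \<omega>)\<^sup>2)" for q q'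
        using B(3) i by (simp add: IE_add IE_const IE_cmult)
      have R_eq: "IE B (\<lambda>\<omega>. q * (D t \<omega>)\<^sup>2 + q' * \<bar>D t \<omega>\<bar> powr p) = q * IE B (\<lambda>\<omega>. (D t \<omega>)\<^sup>2) + q' * IE B (\<lambda>\<omega>. \<bar>D t \<omega>\<bar> powr p)" for q q'
        using B(3) i by (simp add: IE_add IE_cmult)
      have "IE B ?T + K * IE B ?R \<le> (1 + (rate a \<nu> h + e * h) / y\<^sup>2) * prob B \<and>
          (1 + (rate a \<nu> h - e * h) / y\<^sup>2) * prob B \<le> IE B ?T - K * IE B ?R"
      proof (cases "prob B = 0")
        case True
        then have "AE \<omega> in M. \<omega> \<notin> B" using B(3) by (simp add: prob_eq_0)
        then have "IE B f = 0" for f unfolding IE_def by (intro integral_eq_zero_AE) auto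
        then show ?thesis using True by simp
      next
        case False
        then have pB: "0 < prob B" using measure_nonneg[of M B] by linarith
        define m where "m = IE B (D t) / prob B"
        define v where "v = IE B (\<lambda>\<omega>. (D t \<omega>)\<^sup>2) / prob B"
        define w where "w = IE B (\<lambda>\<omega>. \<bar>D t \<omega>\<bar> powr p) / prob B"
        define u where "u = lyap_c1 a \<nu> h * (m / y) + lyap_c2 a \<nu> h / 2 * (v / y\<^sup>2)"
        define k where "k = y powr (-\<kappa>) * (v / y\<^sup>2) + y powr (\<kappa> * p) * (w / y powr p)"
        have "\<bar>u - rate a \<nu> h / y\<^sup>2\<bar> + K * k \<le> e * h / y\<^sup>2"
          unfolding rate_def u_def k_def
        proof (rule dr[of x y h m v w])
          show "\<bar>m - c / x\<bar> \<le> \<eta> / (x * ln x)" unfolding m_def using mom(1)[OF _ st] x pB by (intro div) auto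
          show "\<bar>v - s2\<bar> \<le> \<eta> / ln x" unfolding v_def using mom(2)[OF _ st] x pB by (intro div) auto
          show "0 \<le> w" by (simp add: w_def IE_nonneg)
          show "w \<le> C * (1 + x) powr (p - 2 - \<delta>)" unfolding w_def using local_p_moment[OF st] pB by (simp add: pos_divide_le_eq)
        qed (use x in \<open>auto simp: y_def h_def\<close>)
        then have "1 + u + K * k \<le> 1 + (rate a \<nu> h + e * h) / y\<^sup>2" "1 + (rate a \<nu> h - e * h) / y\<^sup>2 \<le> 1 + u - K * k"
          unfolding add_divide_distrib diff_divide_distrib by linarith+
        moreover have "IE B ?T = (1 + u) * prob B"
          unfolding T T_eq u_def m_def v_def using pB by (simp add: field_simps)
        moreover have "IE B ?R = k * prob B"
          unfolding R R_eq k_def v_def w_def using pB by (simp add: field_simps)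
        ultimately show ?thesis
          by (simp add: distrib_right[symmetric] left_diff_distrib[symmetric] mult.assoc[symmetric] mult_right_mono)
      qed
      then show "integrable M ?T \<and> integrable M ?R \<and>
         IE B (\<lambda>\<omega>. ?T \<omega> + K * ?R \<omega>) \<le> (1 + (rate a \<nu> (1 / ln y) + e * (1 / ln y)) / y\<^sup>2) * prob B \<and>
         (1 + (rate a \<nu> (1 / ln y) - e * (1 / ln y)) / y\<^sup>2) * prob B \<le> IE B (\<lambda>\<omega>. ?T \<omega> - K * ?R \<omega>)"
        using iTR B(3) by (simp add: h_def IE_add IE_diff IE_cmult)
    qed
  qed
qed

lemma scaled_step:
  assumes "at_state t x B" "\<omega> \<in> B" "0 \<le> x"
  shows "(x + exp 1) * (1 + D t \<omega> / (x + exp 1)) = X (t + 1) \<omega> + exp 1" "0 \<le> X (t + 1) \<omega>"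
proof -
  have "0 < x + exp 1" using assms(3) by (simp add: add_nonneg_pos)
  then show "(x + exp 1) * (1 + D t \<omega> / (x + exp 1)) = X (t + 1) \<omega> + exp 1"
    using at_stateD(5)[OF assms(1,2)] by (simp add: D_def field_simps)
  show "0 \<le> X (t + 1) \<omega>" using X_nonneg[of "t + 1"] at_stateD(4)[OF assms(1)] assms(2) by auto
qed

lemma lyap_super_drift:
  assumes a: "0 < a" "0 \<le> a + \<nu>" "\<nu> \<le> 0" "a \<le> p" and e: "0 < e"
  obtains x0 where "1 < x0"
    "\<And>Y t x B y. x0 \<le> x \<Longrightarrow> exp 1 \<le> Y \<Longrightarrow> at_state t x B \<Longrightarrow> y = x + exp 1 \<Longrightarrow>
       IE B (\<lambda>\<omega>. lyap a \<nu> (min (X (t + 1) \<omega> + exp 1) Y))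
         \<le> lyap a \<nu> y * ((1 + (rate a \<nu> (1 / ln y) + e * (1 / ln y)) / y\<^sup>2) * prob B)"
proof -
  have \<kappa>: "0 \<le> \<delta> / (2 * p)" using p_gt_2 \<delta>_pos by simp
  obtain K where K: "0 \<le> K"
    "\<And>y u \<kappa>. exp 1 \<le> y \<Longrightarrow> exp 1 \<le> y * (1 + u) \<Longrightarrow> 0 \<le> \<kappa> \<Longrightarrow>
       lyap a \<nu> (y * (1 + u)) \<le> lyap a \<nu> y *
         (1 + lyap_c1 a \<nu> (1 / ln y) * u + lyap_c2 a \<nu> (1 / ln y) / 2 * u\<^sup>2 + K * lyap_err p \<kappa> y u)"
    using lyap_upper_bound[of a \<nu> p] a p_gt_2 by auto
  obtain x0 where x0: "1 < x0" and dr: "\<forall>t x B y. x0 \<le> x \<longrightarrow> at_state t x B \<longrightarrow> y = x + exp 1 \<longrightarrow>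
       integrable M (taylor a \<nu> t y) \<and> integrable M (taylor_err t y) \<and>
       IE B (\<lambda>\<omega>. taylor a \<nu> t y \<omega> + K * taylor_err t y \<omega>)
         \<le> (1 + (rate a \<nu> (1 / ln y) + e * (1 / ln y)) / y\<^sup>2) * prob B \<and>
       (1 + (rate a \<nu> (1 / ln y) - e * (1 / ln y)) / y\<^sup>2) * prob B
         \<le> IE B (\<lambda>\<omega>. taylor a \<nu> t y \<omega> - K * taylor_err t y \<omega>)"
    by (rule lyap_quadratic_drift[OF K(1) e])
  show thesis
  proof (rule that[OF x0])
    fix Y x y :: real and t B
    assume x: "x0 \<le> x" and Y: "exp 1 \<le> Y" and st: "at_state t x B" and y: "y = x + exp 1"
    note B = at_stateD[OF st] and d = dr[rule_format, OF x st y]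
    have x_nn: "0 \<le> x" using x x0 by simp
    have "IE B (\<lambda>\<omega>. lyap a \<nu> (min (X (t + 1) \<omega> + exp 1) Y)) \<le> IE B (\<lambda>\<omega>. lyap a \<nu> y * (taylor a \<nu> t y \<omega> + K * taylor_err t y \<omega>))"
    proof (rule IE_mono[OF B(3)])
      fix \<omega> assume w: "\<omega> \<in> B"
      note sc = scaled_step[OF st w x_nn, folded y]
      have "lyap a \<nu> (min (X (t + 1) \<omega> + exp 1) Y) \<le> lyap a \<nu> (X (t + 1) \<omega> + exp 1)"
        using sc(2) Y a by (intro lyap_mono) auto
      also have "\<dots> \<le> lyap a \<nu> y * (taylor a \<nu> t y \<omega> + K * taylor_err t y \<omega>)"
        unfolding sc(1)[symmetric] taylor_def taylor_err_def using x_nn y sc by (intro K(2) \<kappa>) auto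
      finally show "lyap a \<nu> (min (X (t + 1) \<omega> + exp 1) Y) \<le> lyap a \<nu> y * (taylor a \<nu> t y \<omega> + K * taylor_err t y \<omega>)" .
    qed (use integrable_lyap_min[of "t+1" a \<nu> Y] a Y d in auto)
    also have "\<dots> \<le> lyap a \<nu> y * ((1 + (rate a \<nu> (1 / ln y) + e * (1 / ln y)) / y\<^sup>2) * prob B)"
      unfolding IE_cmult using d by (intro mult_left_mono) auto
    finally show "IE B (\<lambda>\<omega>. lyap a \<nu> (min (X (t + 1) \<omega> + exp 1) Y))
        \<le> lyap a \<nu> y * ((1 + (rate a \<nu> (1 / ln y) + e * (1 / ln y)) / y\<^sup>2) * prob B)" .
  qed
qed

lemma lyap_sub_drift:
  assumes a: "0 < a" "0 \<le> \<nu>" and e: "0 < e"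
  obtains x0 where "1 < x0"
    "\<And>Y t x B y. x0 \<le> x \<Longrightarrow> y \<le> Y \<Longrightarrow> at_state t x B \<Longrightarrow> y = x + exp 1 \<Longrightarrow>
       lyap a \<nu> y * ((1 + (rate a \<nu> (1 / ln y) - e * (1 / ln y)) / y\<^sup>2) * prob B)
         \<le> IE B (\<lambda>\<omega>. lyap a \<nu> (min (X (t + 1) \<omega> + exp 1) (2 * Y)))"
proof -
  have \<kappa>: "0 \<le> \<delta> / (2 * p)" using p_gt_2 \<delta>_pos by simp
  obtain K where K: "0 \<le> K"
    "\<And>y u \<kappa> Y. exp 1 \<le> y \<Longrightarrow> exp 1 \<le> y * (1 + u) \<Longrightarrow> 0 \<le> \<kappa> \<Longrightarrow> y \<le> Y \<Longrightarrow>
       lyap a \<nu> y * (1 + lyap_c1 a \<nu> (1 / ln y) * u + lyap_c2 a \<nu> (1 / ln y) / 2 * u\<^sup>2 - K * lyap_err p \<kappa> y u)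
         \<le> lyap a \<nu> (min (y * (1 + u)) (2 * Y))"
    using lyap_lower_bound[of a \<nu> p] a p_gt_2 by auto
  obtain x0 where x0: "1 < x0" and dr: "\<forall>t x B y. x0 \<le> x \<longrightarrow> at_state t x B \<longrightarrow> y = x + exp 1 \<longrightarrow>
       integrable M (taylor a \<nu> t y) \<and> integrable M (taylor_err t y) \<and>
       IE B (\<lambda>\<omega>. taylor a \<nu> t y \<omega> + K * taylor_err t y \<omega>)
         \<le> (1 + (rate a \<nu> (1 / ln y) + e * (1 / ln y)) / y\<^sup>2) * prob B \<and>
       (1 + (rate a \<nu> (1 / ln y) - e * (1 / ln y)) / y\<^sup>2) * prob B
         \<le> IE B (\<lambda>\<omega>. taylor a \<nu> t y \<omega> - K * taylor_err t y \<omega>)"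
    by (rule lyap_quadratic_drift[OF K(1) e])
  show thesis
  proof (rule that[OF x0])
    fix Y x y :: real and t B
    assume x: "x0 \<le> x" and Y: "y \<le> Y" and st: "at_state t x B" and y: "y = x + exp 1"
    note B = at_stateD[OF st] and d = dr[rule_format, OF x st y]
    have x_nn: "0 \<le> x" using x x0 by simp
    have e0: "0 < exp (1::real)" by simp
    then have Y2: "exp 1 \<le> 2 * Y" using Y y x_nn by argo
    have "lyap a \<nu> y * ((1 + (rate a \<nu> (1 / ln y) - e * (1 / ln y)) / y\<^sup>2) * prob B)
        \<le> IE B (\<lambda>\<omega>. lyap a \<nu> y * (taylor a \<nu> t y \<omega> - K * taylor_err t y \<omega>))"
      unfolding IE_cmult using d by (intro mult_left_mono) auto
    also have "\<dots> \<le> IE B (\<lambda>\<omega>. lyap a \<nu> (min (X (t + 1) \<omega> + exp 1) (2 * Y)))"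
    proof (rule IE_mono[OF B(3)])
      fix \<omega> assume w: "\<omega> \<in> B"
      note sc = scaled_step[OF st w x_nn, folded y]
      show "lyap a \<nu> y * (taylor a \<nu> t y \<omega> - K * taylor_err t y \<omega>) \<le> lyap a \<nu> (min (X (t + 1) \<omega> + exp 1) (2 * Y))"
        unfolding sc(1)[symmetric] taylor_def taylor_err_def using x_nn y sc Y by (intro K(2) \<kappa>) auto
    qed (use integrable_lyap_min[of "t+1" a \<nu> "2 * Y"] a Y2 d in auto)
    finally show "lyap a \<nu> y * ((1 + (rate a \<nu> (1 / ln y) - e * (1 / ln y)) / y\<^sup>2) * prob B)
         \<le> IE B (\<lambda>\<omega>. lyap a \<nu> (min (X (t + 1) \<omega> + exp 1) (2 * Y)))" .
  qed
qed

lemma lyap_bounded_region: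
  assumes a: "0 < a" "0 \<le> a + \<nu>" "\<nu> \<le> 0" "a \<le> p" and x0: "0 \<le> x0"
  obtains K where "0 \<le> K"
    "\<And>Y t x B. 0 \<le> x \<Longrightarrow> x \<le> x0 \<Longrightarrow> exp 1 \<le> Y \<Longrightarrow> at_state t x B \<Longrightarrow>
       IE B (\<lambda>\<omega>. lyap a \<nu> (min (X (t + 1) \<omega> + exp 1) Y)) \<le> K * prob B"
proof -
  define K where "K = 2 powr p * ((x0 + exp 1) powr p + C * (1 + x0) powr p)"
  show thesis
  proof (rule that[of K])
    show "0 \<le> K" using C_nonneg by (simp add: K_def)
    fix Y x :: real and t B assume x: "0 \<le> x" "x \<le> x0" and Y: "exp 1 \<le> Y" and st: "at_state t x B"
    note t = at_stateD(1)[OF st] and BM = at_stateD(3)[OF st] and BX = at_stateD(5)[OF st]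
    let ?G = "\<lambda>\<omega>. lyap a \<nu> (min (X (t + 1) \<omega> + exp 1) Y)"
    have e1: "1 \<le> exp (1::real)" by simp
    have pw: "?G \<omega> \<le> 2 powr p * ((x0 + exp 1) powr p + \<bar>D t \<omega>\<bar> powr p)" if w: "\<omega> \<in> B" for \<omega>
    proof -
      have sp: "\<omega> \<in> space M" using w sets.sets_into_space[OF BM] by blast
      define z where "z = X (t+1) \<omega> + exp 1"
      have X1: "0 \<le> X (t+1) \<omega>" using X_nonneg[of "t+1"] sp by simp
      then have z: "exp 1 \<le> z" "1 \<le> z" "0 \<le> z" using e1 unfolding z_def by linarith+
      have "?G \<omega> \<le> lyap a \<nu> z"
        unfolding z_def[symmetric] using z Y a by (intro lyap_mono) auto
      also have "\<dots> \<le> z powr a"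
      proof -
        have "ln z powr \<nu> \<le> 1 powr \<nu>" using ln_ge_1[OF z(1)] a by (intro powr_mono2') auto
        then show ?thesis unfolding lyap_def by (simp add: mult_left_le)
      qed
      also have "\<dots> \<le> z powr p" using z a by (intro powr_mono) auto
      also have "\<dots> \<le> ((x0 + exp 1) + \<bar>D t \<omega>\<bar>) powr p"
        using BX[OF w] x z p_gt_2 by (intro powr_mono2) (auto simp: z_def D_def)
      also have "\<dots> \<le> 2 powr p * ((x0 + exp 1) powr p + \<bar>D t \<omega>\<bar> powr p)"
        using x0 p_gt_2 e1 by (intro powr_add_le) auto
      finally show ?thesis .
    qed
    have i: "integrable M (\<lambda>\<omega>. \<bar>D t \<omega>\<bar> powr p)" using integrable_D_powr t by blast
    have "IE B ?G \<le> IE B (\<lambda>\<omega>. 2 powr p * ((x0 + exp 1) powr p + \<bar>D t \<omega>\<bar> powr p))"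
      using integrable_lyap_min[of "t+1" a \<nu> Y] a Y t BM i pw by (intro IE_mono) auto
    also have "\<dots> = 2 powr p * ((x0 + exp 1) powr p * prob B + IE B (\<lambda>\<omega>. \<bar>D t \<omega>\<bar> powr p))"
      using BM i by (simp add: IE_cmult IE_add IE_const)
    also have "\<dots> \<le> 2 powr p * ((x0 + exp 1) powr p * prob B + C * (1 + x0) powr p * prob B)"
    proof -
      have "IE B (\<lambda>\<omega>. \<bar>D t \<omega>\<bar> powr p) \<le> C * (1 + x) powr (p - 2 - \<delta>) * prob B"
        using local_p_moment[OF st] .
      also have "(1 + x) powr (p - 2 - \<delta>) \<le> (1 + x) powr p" using x p_gt_2 \<delta>_pos by (intro powr_mono) auto
      also have "\<dots> \<le> (1 + x0) powr p" using x p_gt_2 by (intro powr_mono2) auto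
      finally have "IE B (\<lambda>\<omega>. \<bar>D t \<omega>\<bar> powr p) \<le> C * (1 + x0) powr p * prob B"
        using C_nonneg by (simp add: mult_left_mono mult_right_mono)
      then show ?thesis by (intro mult_left_mono add_left_mono) auto
    qed
    also have "\<dots> = K * prob B" by (simp add: K_def algebra_simps)
    finally show "IE B ?G \<le> K * prob B" .
  qed
qed


lemma IE_split:
  assumes "A \<in> events" "B \<in> events" "B \<subseteq> A" "integrable M f"
  shows "IE A f = IE B f + IE (A - B) f"
proof -
  have "IE A f = (\<integral>\<omega>. f \<omega> * indicator B \<omega> + f \<omega> * indicator (A - B) \<omega> \<partial>M)"
    unfolding IE_def using assms(3) by (intro Bochner_Integration.integral_cong) (auto split: split_indicator)
  also have "\<dots> = IE B f + IE (A - B) f"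
    unfolding IE_def using assms by (intro Bochner_Integration.integral_add IE_integrable) auto
  finally show ?thesis .
qed

text \<open>Optional stopping at the first time the decreasing events \<open>B\<^sub>t\<close> fail.\<close>
lemma IE_stopped:
  assumes n: "t0 \<le> n" and B: "\<And>t. t0 \<le> t \<Longrightarrow> B t \<in> events" "\<And>t. t0 \<le> t \<Longrightarrow> B (Suc t) \<subseteq> B t"
    and Z: "\<And>t. t0 \<le> t \<Longrightarrow> integrable M (Z t)"
  shows "IE (B t0) (Z t0) + (\<Sum>t=t0..<n. IE (B t) (\<lambda>\<omega>. Z (Suc t) \<omega> - Z t \<omega>))
     = IE (B n) (Z n) + (\<Sum>t=t0..<n. IE (B t - B (Suc t)) (Z (Suc t)))"
  using n
proof (induction n rule: dec_induct)
  case (step n)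
  have "IE (B n) (Z (Suc n)) = IE (B (Suc n)) (Z (Suc n)) + IE (B n - B (Suc n)) (Z (Suc n))"
    using step B Z by (intro IE_split) auto
  moreover have "IE (B n) (\<lambda>\<omega>. Z (Suc n) \<omega> - Z n \<omega>) = IE (B n) (Z (Suc n)) - IE (B n) (Z n)"
    using step B Z by (intro IE_diff) auto
  ultimately show ?case using step by simp
qed simp

lemma sum_prob_diff:
  assumes "t0 \<le> n" "\<And>t. t0 \<le> t \<Longrightarrow> B t \<in> events" "\<And>t. t0 \<le> t \<Longrightarrow> B (Suc t) \<subseteq> B t"
  shows "(\<Sum>t=t0..<n. prob (B t - B (Suc t))) = prob (B t0) - prob (B n)"
  using assms(1)
proof (induction n rule: dec_induct)
  case (step n)
  then show ?case using assms by (simp add: finite_measure_Diff)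
qed simp

lemma event_path:
  assumes "1 \<le> i" "j \<le> t" "1 \<le> t" "A \<in> sets borel"
  shows "{\<omega> \<in> space M. \<forall>s\<in>{i..j}. X s \<omega> \<in> A} \<in> sets (F t)"
proof -
  have "{\<omega> \<in> space (F t). \<forall>s\<in>{i..j}. X s \<omega> \<in> A} \<in> sets (F t)"
    using assms space_F[of t] by (intro sets.sets_Collect_finite_All) (auto intro!: event_state)
  then show ?thesis using assms by (simp add: space_F)
qed

section \<open>Excursions\<close>

definition alive :: "nat \<Rightarrow> 'a set" where
  "alive t = {\<omega> \<in> space M. \<forall>s\<in>{2..t}. X s \<omega> \<noteq> 0}"

definition below :: "real \<Rightarrow> nat \<Rightarrow> 'a set" where
  "below y t = alive t \<inter> {\<omega> \<in> space M. \<forall>s\<in>{1..t}. X s \<omega> < y}"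

definition passage :: "real \<Rightarrow> nat \<Rightarrow> 'a set" where
  "passage y t = {\<omega> \<in> alive t. y \<le> X t \<omega> \<and> (\<forall>s\<in>{1..<t}. X s \<omega> < y)}"

definition reach :: "real \<Rightarrow> 'a set" where
  "reach y = (\<Union>t\<in>{1..}. {\<omega> \<in> alive t. y \<le> X t \<omega>})"

lemma alive_sets: "1 \<le> t \<Longrightarrow> alive t \<in> sets (F t)"
  unfolding alive_def using event_path[of 2 t t "- {0}"] by simp

lemma alive_events: "1 \<le> t \<Longrightarrow> alive t \<in> events"
  using alive_sets sets_F_events by blast

lemma alive_antimono: "s \<le> t \<Longrightarrow> alive t \<subseteq> alive s"
  by (auto simp: alive_def)

lemma below_sets: "1 \<le> t \<Longrightarrow> below y t \<in> sets (F t)"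
  unfolding below_def using event_path[of 1 t t "{..<y}"] alive_sets by (auto simp: lessThan_def)

lemma passage_sets: "1 \<le> t \<Longrightarrow> passage y t \<in> sets (F t)"
proof -
  assume t: "1 \<le> t"
  have "passage y t = alive t \<inter> {\<omega> \<in> space M. X t \<omega> \<in> {y..}} \<inter> {\<omega> \<in> space M. \<forall>s\<in>{1..t-1}. X s \<omega> \<in> {..<y}}"
    using t unfolding passage_def alive_def by auto
  also have "\<dots> \<in> sets (F t)"
    using t by (intro sets.Int alive_sets event_state event_path) auto
  finally show ?thesis .
qed

lemma passage_disjoint: "disjoint_family_on (passage y) {1..}"
proof -
  have "passage y i \<inter> passage y j = {}" if "1 \<le> i" "i < j" for i j
  proof -
    have "i \<in> {1..<j}" using that by simp
    then show ?thesis unfolding passage_def by force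
  qed
  then show ?thesis unfolding disjoint_family_on_def
    by (metis Int_commute atLeast_iff linorder_neqE_nat)
qed

lemma reach_eq: "reach y = (\<Union>i. passage y (Suc i))"
proof (intro equalityI subsetI)
  fix \<omega> assume "\<omega> \<in> reach y"
  then obtain t where t: "1 \<le> t" "\<omega> \<in> alive t" "y \<le> X t \<omega>" by (auto simp: reach_def)
  define u where "u = (LEAST u. 1 \<le> u \<and> y \<le> X u \<omega>)"
  have u: "1 \<le> u" "y \<le> X u \<omega>" "u \<le> t"
    using LeastI[of "\<lambda>u. 1 \<le> u \<and> y \<le> X u \<omega>" t] Least_le[of "\<lambda>u. 1 \<le> u \<and> y \<le> X u \<omega>" t] t
    by (auto simp: u_def)
  have "\<forall>s\<in>{1..<u}. X s \<omega> < y"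
    using not_less_Least[of _ "\<lambda>u. 1 \<le> u \<and> y \<le> X u \<omega>"] unfolding u_def
    by (metis atLeastLessThan_iff not_le)
  then have "\<omega> \<in> passage y u" using u t alive_antimono unfolding passage_def by blast
  then show "\<omega> \<in> (\<Union>i. passage y (Suc i))" using u(1) by (auto intro!: exI[of _ "u - 1"])
qed (auto simp: reach_def passage_def)

lemma prob_passage_sums: "(\<lambda>i. prob (passage y (Suc i))) sums prob (reach y)"
  unfolding reach_eq
proof (rule finite_measure_UNION)
  show "range (\<lambda>i. passage y (Suc i)) \<subseteq> events" using passage_sets sets_F_events by (metis image_subsetI le_add1 plus_1_eq_Suc)
  show "disjoint_family (\<lambda>i. passage y (Suc i))"
    using passage_disjoint[of y] unfolding disjoint_family_on_def by simp
qed

lemma reach_events: "reach y \<in> events"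
proof -
  have "passage y (Suc i) \<in> events" for i using passage_sets[of "Suc i"] sets_F_events[of "Suc i"] by simp
  then show ?thesis unfolding reach_eq by blast
qed

text \<open>A visit to \<open>[0, x\<^sub>0]\<close> at time \<open>t\<close> ends the excursion during \<open>(t, t + m\<^sub>0]\<close> with probability at
  least \<open>\<phi>\<^sub>0\<close>, and the probabilities of ending in these windows sum to at most \<open>m\<^sub>0\<close>.\<close>
lemma expected_visits_bounded:
  fixes x0 :: real
  obtains K where "0 \<le> K" "\<And>n. (\<Sum>t=1..<n. prob (alive t \<inter> {\<omega> \<in> space M. X t \<omega> \<le> x0})) \<le> K"
proof -
  obtain m0 :: nat and \<phi>0 :: real where \<phi>0: "0 < \<phi>0" "\<phi>0 \<le> 1" and hz:
    "\<forall>t\<ge>1. \<forall>B\<in>sets (F t). (\<forall>\<omega>\<in>B. X t \<omega> \<le> x0) \<longrightarrow>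
       \<phi>0 * prob B \<le> prob (B \<inter> {\<omega> \<in> space M. \<exists>s\<in>{t<..t+m0}. X s \<omega> = 0})"
    by (rule hit_zero[of x0]) (rule that, assumption+)
  have tel: "(\<Sum>t=1..<n. prob (alive t) - prob (alive (t + m))) \<le> real m" for n m
  proof (induction m)
    case (Suc m)
    have "(\<Sum>t=1..<n. prob (alive (t + m)) - prob (alive (Suc t + m))) \<le> 1"
    proof (cases "1 \<le> n")
      case True
      then have "(\<Sum>t=1..<n. prob (alive (t + m)) - prob (alive (Suc t + m))) = prob (alive (1 + m)) - prob (alive (n + m))"
        using sum_Suc_diff'[of 1 n "\<lambda>t. - prob (alive (t + m))"] by simp
      then show ?thesis using prob_le_1[of "alive (1+m)"] measure_nonneg[of M "alive (n+m)"] by linarith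
    qed simp
    moreover have "(\<Sum>t=1..<n. prob (alive t) - prob (alive (t + Suc m)))
      = (\<Sum>t=1..<n. prob (alive t) - prob (alive (t + m))) + (\<Sum>t=1..<n. prob (alive (t + m)) - prob (alive (Suc t + m)))"
      unfolding sum.distrib[symmetric] by (intro sum.cong) auto
    ultimately show ?case using Suc by simp
  qed simp
  have V: "\<phi>0 * prob (alive t \<inter> {\<omega> \<in> space M. X t \<omega> \<le> x0}) \<le> prob (alive t) - prob (alive (t + m0))" if t: "1 \<le> t" for t
  proof -
    let ?V = "alive t \<inter> {\<omega> \<in> space M. X t \<omega> \<le> x0}"
    have V: "?V \<in> sets (F t)" using alive_sets[OF t] event_state[of t t "{..x0}"] t by (auto simp: atMost_def)
    have "\<phi>0 * prob ?V \<le> prob (?V \<inter> {\<omega> \<in> space M. \<exists>s\<in>{t<..t+m0}. X s \<omega> = 0})" using hz t V by simp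
    also have "\<dots> \<le> prob (alive t - alive (t + m0))"
    proof (rule finite_measure_mono)
      show "?V \<inter> {\<omega> \<in> space M. \<exists>s\<in>{t<..t+m0}. X s \<omega> = 0} \<subseteq> alive t - alive (t + m0)"
        using t unfolding alive_def by auto
    qed (use alive_events t in auto)
    also have "\<dots> = prob (alive t) - prob (alive (t + m0))"
      using alive_events t alive_antimono[of t "t+m0"] by (intro finite_measure_Diff) auto
    finally show ?thesis .
  qed
  have "(\<Sum>t=1..<n. prob (alive t \<inter> {\<omega> \<in> space M. X t \<omega> \<le> x0})) \<le> m0 / \<phi>0" for n
  proof -
    have "\<phi>0 * (\<Sum>t=1..<n. prob (alive t \<inter> {\<omega> \<in> space M. X t \<omega> \<le> x0})) \<le> (\<Sum>t=1..<n. prob (alive t) - prob (alive (t + m0)))"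
      unfolding sum_distrib_left using V by (intro sum_mono) auto
    also have "\<dots> \<le> m0" by (rule tel)
    finally show ?thesis using \<phi>0 by (simp add: pos_le_divide_eq mult.commute)
  qed
  then show thesis using \<phi>0 by (intro that[of "m0 / \<phi>0"]) auto
qed

end

locale lamperti_recurrent = lamperti +
  fixes r :: real
  assumes r_def: "r = - 2 * c / s2" and r_gt: "-1 < r" and p_gt_r: "1 + r < p"
begin

lemma c_eq: "c = - r * s2 / 2"
  using s2_pos by (simp add: r_def)

lemma rate_critical: "rate (1 + r) \<nu> h = \<nu> * (s2 / 2) * (1 + r) * h"
  unfolding rate_def by (simp add: c_eq algebra_simps)

lemma rate_power: "rate a 0 h = a * s2 / 2 * (a - 1 - r)"
  unfolding rate_def by (simp add: c_eq field_simps)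

lemma prob_reach_upper:
  assumes \<nu>: "0 < \<nu>" "\<nu> \<le> 1 + r"
  obtains K where "0 < K" "\<And>y. 0 < y \<Longrightarrow> prob (reach y) \<le> K / lyap (1 + r) (-\<nu>) (y + exp 1)"
proof -
  let ?a = "1 + r"
  let ?f = "lyap ?a (-\<nu>)"
  have a: "0 < ?a" "0 \<le> ?a + -\<nu>" "-\<nu> \<le> 0" "?a \<le> p" using \<nu> r_gt p_gt_r by auto
  have e: "0 < \<nu> * (s2 / 2) * (1 + r)" using \<nu> s2_pos r_gt by simp
  obtain x0 where x0: "1 < x0" and dr:
    "\<And>Y t x B y. x0 \<le> x \<Longrightarrow> exp 1 \<le> Y \<Longrightarrow> at_state t x B \<Longrightarrow> y = x + exp 1 \<Longrightarrow>
       IE B (\<lambda>\<omega>. ?f (min (X (t + 1) \<omega> + exp 1) Y))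
         \<le> ?f y * ((1 + (rate ?a (-\<nu>) (1 / ln y) + \<nu> * (s2 / 2) * (1 + r) * (1 / ln y)) / y\<^sup>2) * prob B)"
    using lyap_super_drift[OF a e] by blast
  have x0': "0 \<le> x0" using x0 by simp
  obtain K1 where K1: "0 \<le> K1"
    "\<And>Y t x B. 0 \<le> x \<Longrightarrow> x \<le> x0 \<Longrightarrow> exp 1 \<le> Y \<Longrightarrow> at_state t x B \<Longrightarrow>
       IE B (\<lambda>\<omega>. ?f (min (X (t + 1) \<omega> + exp 1) Y)) \<le> K1 * prob B"
    using lyap_bounded_region[OF a x0'] by blast
  obtain K2 where K2: "0 \<le> K2" "\<And>n. (\<Sum>t=1..<n. prob (alive t \<inter> {\<omega> \<in> space M. X t \<omega> \<le> x0})) \<le> K2"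
    using expected_visits_bounded by blast
  define K where "K = ?f (exp 1) + K1 * K2"
  have fe: "0 < ?f (exp 1)" by (intro lyap_pos) simp
  have K: "0 < K" unfolding K_def using fe K1(1) K2(1) by (intro add_pos_nonneg) auto
  have "prob (reach y) \<le> K / ?f (y + exp 1)" if y: "0 < y" for y
  proof -
    have fy: "0 < ?f (y + exp 1)" using y by (intro lyap_pos) auto
    define Z where "Z t \<omega> = ?f (min (X t \<omega> + exp 1) (y + exp 1))" for t \<omega>
    have Zi: "integrable M (Z t)" if "1 \<le> t" for t
      unfolding Z_def using that y a by (intro integrable_lyap_min) auto
    have B: "below y t \<in> events" if "1 \<le> t" for t using below_sets sets_F_events that by blast
    have Bd: "below y (Suc t) \<subseteq> below y t" for t by (auto simp: below_def alive_def)
    have inc: "IE (below y t) (\<lambda>\<omega>. Z (Suc t) \<omega> - Z t \<omega>) \<le> K1 * prob (alive t \<inter> {\<omega> \<in> space M. X t \<omega> \<le> x0})"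
      if t: "1 \<le> t" for t
    proof -
      let ?V = "{\<omega> \<in> space M. X t \<omega> \<le> x0}"
      have V: "?V \<in> events" using sets_F_events[OF t event_state[of t t "{..x0}"]] t by simp
      have iV: "integrable M (\<lambda>\<omega>. K1 * indicator ?V \<omega>)" using V by (simp add: integrable_indicator_iff less_top[symmetric])
      have "IE (below y t) (\<lambda>\<omega>. Z (Suc t) \<omega> - Z t \<omega>) \<le> IE (below y t) (\<lambda>\<omega>. K1 * indicator ?V \<omega>)"
      proof (rule IE_mono_states[OF t below_sets[OF t]])
        show "integrable M (\<lambda>\<omega>. Z (Suc t) \<omega> - Z t \<omega>)" using Zi t by simp
        show "integrable M (\<lambda>\<omega>. K1 * indicator ?V \<omega>)" by (rule iV)
        fix x A \<omega>0 assume st: "at_state t x A" and A: "A \<subseteq> below y t" and w0: "\<omega>0 \<in> A"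
        note AM = at_stateD(3)[OF st] and AX = at_stateD(5)[OF st]
        show "IE A (\<lambda>\<omega>. Z (Suc t) \<omega> - Z t \<omega>) \<le> IE A (\<lambda>\<omega>. K1 * indicator ?V \<omega>)"
        proof -
          have "\<omega>0 \<in> below y t" using A w0 by blast
          then have "X t \<omega>0 < y" using t unfolding below_def by auto
          then have xy: "x < y" using AX[OF w0] by simp
          have x_nn: "0 \<le> x" using X_nonneg[OF t] at_stateD(4)[OF st] AX[OF w0] w0 by auto
          have "IE A (Z t) = IE A (\<lambda>_. ?f (x + exp 1))"
            using AX xy by (intro IE_cong) (simp add: Z_def)
          then have Zt: "IE A (Z t) = ?f (x + exp 1) * prob A" using IE_const[OF AM] by simp
          have d: "IE A (\<lambda>\<omega>. Z (Suc t) \<omega> - Z t \<omega>) = IE A (Z (Suc t)) - ?f (x + exp 1) * prob A"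
            using Zt IE_diff[OF AM Zi Zi] t by simp
          show ?thesis
          proof (cases "x \<le> x0")
            case True
            have "IE A (\<lambda>\<omega>. K1 * indicator ?V \<omega>) = IE A (\<lambda>\<omega>. K1)"
              using AX True at_stateD(4)[OF st] by (intro IE_cong) (auto split: split_indicator)
            moreover have "IE A (Z (Suc t)) \<le> K1 * prob A"
              unfolding Z_def using K1(2)[OF x_nn True _ st, of "y + exp 1"] y by simp
            moreover have "0 \<le> ?f (x + exp 1) * prob A" by simp
            ultimately show ?thesis unfolding d IE_const[OF AM] by linarith
          next
            case False
            have "0 \<le> IE A (\<lambda>\<omega>. K1 * indicator ?V \<omega>)" using K1(1) by (intro IE_nonneg) auto
            moreover have "IE A (Z (Suc t)) \<le> ?f (x + exp 1) * prob A"
              unfolding Z_def using dr[OF _ _ st refl, of "y + exp 1"] y False by (simp add: rate_critical)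
            ultimately show ?thesis unfolding d by simp
          qed
        qed
      qed
      also have "\<dots> = K1 * prob (below y t \<inter> ?V)"
      proof -
        have "IE (below y t) (indicator ?V) = (\<integral>\<omega>. indicator (below y t \<inter> ?V) \<omega> \<partial>M)"
          unfolding IE_def by (intro Bochner_Integration.integral_cong) (auto split: split_indicator)
        also have "\<dots> = prob (below y t \<inter> ?V)" using B[OF t] V by (simp add: Int_assoc)
        finally show ?thesis unfolding IE_cmult by simp
      qed
      also have "\<dots> \<le> K1 * prob (alive t \<inter> ?V)"
        using K1(1) alive_events[OF t] V by (intro mult_left_mono finite_measure_mono) (auto simp: below_def)
      finally show ?thesis .
    qed
    have p1: "prob (passage y (Suc 0)) = 0"
    proof -
      have "passage y (Suc 0) \<in> events" using passage_sets[of 1] sets_F_events[of 1] by simp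
      moreover have "AE \<omega> in M. \<omega> \<notin> passage y (Suc 0)" using start by eventually_elim (use y in \<open>auto simp: passage_def\<close>)
      ultimately show ?thesis by (simp add: prob_eq_0)
    qed
    have part: "(\<Sum>t=1..<n. prob (passage y (Suc t))) \<le> K / ?f (y + exp 1)" if n: "1 \<le> n" for n
    proof -
      have "?f (y + exp 1) * (\<Sum>t=1..<n. prob (passage y (Suc t)))
          \<le> (\<Sum>t=1..<n. IE (below y t - below y (Suc t)) (Z (Suc t)))"
        unfolding sum_distrib_left
      proof (intro sum_mono)
        fix t assume "t \<in> {1..<n}"
        then have t: "1 \<le> t" by simp
        have PS: "passage y (Suc t) \<in> events" using passage_sets[of "Suc t"] sets_F_events[of "Suc t"] by simp
        have sub: "passage y (Suc t) \<subseteq> below y t - below y (Suc t)"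
          unfolding passage_def below_def alive_def by (auto dest: bspec[of _ _ "Suc t"])
        have "?f (y + exp 1) * prob (passage y (Suc t)) = IE (passage y (Suc t)) (\<lambda>_. ?f (y + exp 1))"
          using IE_const[OF PS] by simp
        also have "\<dots> = IE (passage y (Suc t)) (Z (Suc t))"
          by (intro IE_cong) (auto simp: passage_def Z_def)
        also have "\<dots> \<le> IE (below y t - below y (Suc t)) (Z (Suc t))"
        proof -
          have "0 \<le> IE (below y t - below y (Suc t) - passage y (Suc t)) (Z (Suc t))"
            by (intro IE_nonneg) (simp add: Z_def)
          then show ?thesis
            using IE_split[of "below y t - below y (Suc t)" "passage y (Suc t)" "Z (Suc t)"] B[of t] B[of "Suc t"] PS sub Zi[of "Suc t"] t
            by auto
        qed
        finally show "?f (y + exp 1) * prob (passage y (Suc t)) \<le> IE (below y t - below y (Suc t)) (Z (Suc t))" .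
      qed
      also have "\<dots> \<le> IE (below y n) (Z n) + (\<Sum>t=1..<n. IE (below y t - below y (Suc t)) (Z (Suc t)))"
        using IE_nonneg[of "below y n" "Z n"] by (simp add: Z_def)
      also have "\<dots> = IE (below y 1) (Z 1) + (\<Sum>t=1..<n. IE (below y t) (\<lambda>\<omega>. Z (Suc t) \<omega> - Z t \<omega>))"
        using n B Bd Zi by (intro IE_stopped[symmetric]) auto
      also have "\<dots> \<le> ?f (exp 1) + (\<Sum>t=1..<n. K1 * prob (alive t \<inter> {\<omega> \<in> space M. X t \<omega> \<le> x0}))"
      proof (intro add_mono sum_mono inc)
        have "IE (below y 1) (Z 1) \<le> IE (below y 1) (\<lambda>_. ?f (exp 1))"
        proof (rule IE_mono_AE)
          show "AE \<omega> in M. \<omega> \<in> below y 1 \<longrightarrow> Z 1 \<omega> \<le> ?f (exp 1)"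
            using start by eventually_elim (use y in \<open>auto simp: Z_def\<close>)
        qed (use B Zi in auto)
        also have "\<dots> \<le> ?f (exp 1)"
          using B[of 1] prob_le_1[of "below y 1"] by (simp add: IE_const mult_left_le)
        finally show "IE (below y 1) (Z 1) \<le> ?f (exp 1)" .
      qed auto
      also have "\<dots> \<le> K"
        unfolding K_def sum_distrib_left[symmetric] using K2(2) K1(1) by (intro add_left_mono mult_left_mono) auto
      finally show ?thesis using fy by (simp add: pos_le_divide_eq mult.commute)
    qed
    have "(\<Sum>i. prob (passage y (Suc i))) \<le> K / ?f (y + exp 1)"
    proof (rule suminf_le_const)
      show "summable (\<lambda>i. prob (passage y (Suc i)))" using prob_passage_sums sums_summable by blast
      fix n
      have "(\<Sum>i<n. prob (passage y (Suc i))) \<le> (\<Sum>i<Suc n. prob (passage y (Suc i)))"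
        by simp
      also have "\<dots> = (\<Sum>i\<in>{0..<Suc n}. prob (passage y (Suc i)))" by (simp add: atLeast0LessThan)
      also have "\<dots> = prob (passage y (Suc 0)) + (\<Sum>i=1..<Suc n. prob (passage y (Suc i)))"
        by (subst sum.atLeast_Suc_lessThan) auto
      also have "\<dots> \<le> K / ?f (y + exp 1)" using part[of "Suc n"] p1 by simp
      finally show "(\<Sum>i<n. prob (passage y (Suc i))) \<le> K / ?f (y + exp 1)" .
    qed
    then show ?thesis using prob_passage_sums[of y] by (simp add: sums_iff)
  qed
  then show thesis using K that by blast
qed


lemma stay_in_strip:
  obtains x0 K where "1 < x0" "0 < K"
    "\<forall>y>0. \<forall>t0\<ge>1. \<forall>B\<in>sets (F t0). \<forall>n\<ge>t0.
       real (n - t0) * prob (B \<inter> {\<omega> \<in> space M. \<forall>s\<in>{t0..n}. X s \<omega> \<in> {x0<..<y}}) \<le> K * (y + exp 1)\<^sup>2 * prob B"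
proof -
  define a where "a = min 2 (1 + r) / 2"
  have a: "0 < a" "0 \<le> a + 0" "(0::real) \<le> 0" "a \<le> p" "a \<le> 2" "a < 1 + r"
    using r_gt p_gt_2 by (auto simp: a_def)
  define c0 where "c0 = a * s2 / 4 * (1 + r - a)"
  have c0: "0 < c0" using a s2_pos by (simp add: c0_def)
  let ?f = "lyap a 0"
  obtain x0 where x0: "1 < x0" and dr:
    "\<And>Y t x B y. x0 \<le> x \<Longrightarrow> exp 1 \<le> Y \<Longrightarrow> at_state t x B \<Longrightarrow> y = x + exp 1 \<Longrightarrow>
       IE B (\<lambda>\<omega>. ?f (min (X (t + 1) \<omega> + exp 1) Y))
         \<le> ?f y * ((1 + (rate a 0 (1 / ln y) + c0 * (1 / ln y)) / y\<^sup>2) * prob B)"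
    using lyap_super_drift[OF a(1-4) c0] by blast
  have f: "?f z = z powr a" if "exp 1 \<le> z" for z using ln_ge_1[OF that] by (simp add: lyap_def)
  have dr2: "IE A (\<lambda>\<omega>. ?f (min (X (t + 1) \<omega> + exp 1) (y + exp 1)))
      \<le> (?f (x + exp 1) - c0 * (y + exp 1) powr (a - 2)) * prob A"
    if x: "x0 \<le> x" "x < y" and st: "at_state t x A" for t x y A
  proof -
    define z where "z = x + exp 1"
    have z: "exp 1 \<le> z" "0 < z" "z \<le> y + exp 1" using x x0 exp_gt_zero[of "1::real"] unfolding z_def by linarith+
    have h: "1 / ln z \<le> 1" using ln_ge_1[OF z(1)] by simp
    have "rate a 0 (1 / ln z) = - 2 * c0" unfolding rate_power c0_def by (simp add: field_simps)
    moreover have "c0 * (1 / ln z) \<le> c0" using h c0 by (intro mult_left_le) auto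
    ultimately have "rate a 0 (1 / ln z) + c0 * (1 / ln z) \<le> - c0" by linarith
    then have "(rate a 0 (1 / ln z) + c0 * (1 / ln z)) / z\<^sup>2 \<le> - c0 / z\<^sup>2"
      by (intro divide_right_mono) auto
    then have "?f z * (1 + (rate a 0 (1 / ln z) + c0 * (1 / ln z)) / z\<^sup>2) \<le> ?f z * (1 + - c0 / z\<^sup>2)"
      by (intro mult_left_mono add_left_mono) auto
    also have "\<dots> = ?f z - c0 * z powr (a - 2)"
      using z by (simp add: f powr_diff powr_numeral algebra_simps)
    also have "\<dots> \<le> ?f z - c0 * (y + exp 1) powr (a - 2)"
      using z a c0 by (intro diff_left_mono mult_left_mono powr_mono2') auto
    finally have *: "?f z * (1 + (rate a 0 (1 / ln z) + c0 * (1 / ln z)) / z\<^sup>2) \<le> ?f z - c0 * (y + exp 1) powr (a - 2)" .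
    have "IE A (\<lambda>\<omega>. ?f (min (X (t + 1) \<omega> + exp 1) (y + exp 1)))
       \<le> ?f z * ((1 + (rate a 0 (1 / ln z) + c0 * (1 / ln z)) / z\<^sup>2) * prob A)"
      using z by (intro dr[OF x(1) _ st z_def]) auto
    also have "\<dots> \<le> (?f z - c0 * (y + exp 1) powr (a - 2)) * prob A"
      unfolding mult.assoc[symmetric] using * by (intro mult_right_mono) auto
    finally show ?thesis unfolding z_def .
  qed
  have main: "real (n - t0) * prob (B \<inter> {\<omega> \<in> space M. \<forall>s\<in>{t0..n}. X s \<omega> \<in> {x0<..<y}}) \<le> 1 / c0 * (y + exp 1)\<^sup>2 * prob B"
    if y: "0 < y" and t0: "1 \<le> t0" and B: "B \<in> sets (F t0)" and n: "t0 \<le> n" for y t0 B n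
  proof -
    define Y where "Y = y + exp 1"
    have Y: "exp 1 \<le> Y" "0 < Y" using y exp_gt_zero[of "1::real"] unfolding Y_def by linarith+
    define G where "G t = B \<inter> {\<omega> \<in> space M. \<forall>s\<in>{t0..t}. X s \<omega> \<in> {x0<..<y}}" for t
    have GF: "G t \<in> sets (F t)" if t: "t0 \<le> t" for t
      unfolding G_def using t t0 B filt_mono[of t0 t] by (intro sets.Int event_path) auto
    have GM: "G t \<in> events" if "t0 \<le> t" for t using GF that sets_F_events t0 by (meson order_trans)
    have Gd: "G (Suc t) \<subseteq> G t" for t by (auto simp: G_def)
    have Gmono: "G n \<subseteq> G t" if "t \<le> n" for t using that by (auto simp: G_def)
    define Z where "Z t \<omega> = ?f (min (X t \<omega> + exp 1) Y)" for t \<omega>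
    have Zi: "integrable M (Z t)" if "t0 \<le> t" for t
      unfolding Z_def using that t0 Y a by (intro integrable_lyap_min) auto
    have inc: "IE (G t) (\<lambda>\<omega>. Z (Suc t) \<omega> - Z t \<omega>) \<le> - c0 * Y powr (a - 2) * prob (G t)" if t: "t0 \<le> t" for t
    proof -
      have t1: "1 \<le> t" using t t0 by simp
      have "IE (G t) (\<lambda>\<omega>. Z (Suc t) \<omega> - Z t \<omega>) \<le> IE (G t) (\<lambda>_. - c0 * Y powr (a - 2))"
      proof (rule IE_mono_states[OF t1 GF[OF t]])
        show "integrable M (\<lambda>\<omega>. Z (Suc t) \<omega> - Z t \<omega>)" using Zi t by simp
        fix x A \<omega>0 assume st: "at_state t x A" and A: "A \<subseteq> G t" and w0: "\<omega>0 \<in> A"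
        note AM = at_stateD(3)[OF st] and AX = at_stateD(5)[OF st]
        show "IE A (\<lambda>\<omega>. Z (Suc t) \<omega> - Z t \<omega>) \<le> IE A (\<lambda>_. - c0 * Y powr (a - 2))"
        proof -
          have "\<omega>0 \<in> G t" using A w0 by blast
          then have "X t \<omega>0 \<in> {x0<..<y}" using t unfolding G_def by auto
          then have xy: "x0 \<le> x" "x < y" using AX[OF w0] by auto
          have "IE A (Z t) = IE A (\<lambda>_. ?f (x + exp 1))"
            using AX xy by (intro IE_cong) (simp add: Z_def Y_def)
          then have Zt: "IE A (Z t) = ?f (x + exp 1) * prob A" using IE_const[OF AM] by simp
          have d: "IE A (\<lambda>\<omega>. Z (Suc t) \<omega> - Z t \<omega>) = IE A (Z (Suc t)) - ?f (x + exp 1) * prob A"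
            using Zt IE_diff[OF AM Zi Zi] t by simp
          have "IE A (Z (Suc t)) \<le> (?f (x + exp 1) - c0 * Y powr (a - 2)) * prob A"
            unfolding Z_def Y_def using dr2[OF xy st] by simp
          then show ?thesis unfolding d IE_const[OF AM] by (simp add: algebra_simps)
        qed
      qed simp
      then show ?thesis using IE_const[OF GM[OF t]] by simp
    qed
    have "0 \<le> IE (G n) (Z n) + (\<Sum>t=t0..<n. IE (G t - G (Suc t)) (Z (Suc t)))"
      by (intro add_nonneg_nonneg sum_nonneg IE_nonneg) (simp_all add: Z_def)
    also have "\<dots> = IE (G t0) (Z t0) + (\<Sum>t=t0..<n. IE (G t) (\<lambda>\<omega>. Z (Suc t) \<omega> - Z t \<omega>))"
      using n GM Gd Zi by (intro IE_stopped[symmetric]) auto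
    also have "\<dots> \<le> Y powr a * prob B + (\<Sum>t=t0..<n. - c0 * Y powr (a - 2) * prob (G n))"
    proof (intro add_mono sum_mono)
      have "IE (G t0) (Z t0) \<le> IE (G t0) (\<lambda>_. Y powr a)"
      proof (rule IE_mono)
        fix \<omega> assume "\<omega> \<in> G t0"
        then have "0 \<le> X t0 \<omega>" using X_nonneg t0 by (auto simp: G_def)
        then have "Z t0 \<omega> \<le> ?f Y" unfolding Z_def using Y a by (intro lyap_mono) auto
        then show "Z t0 \<omega> \<le> Y powr a" using f Y by simp
      qed (use GM Zi in auto)
      also have "\<dots> \<le> Y powr a * prob B"
        using GM[of t0] sets_F_events[OF t0 B]
        by (auto simp: IE_const G_def intro!: mult_left_mono finite_measure_mono)
      finally show "IE (G t0) (Z t0) \<le> Y powr a * prob B" .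
      fix t assume t: "t \<in> {t0..<n}"
      have "c0 * Y powr (a - 2) * prob (G n) \<le> c0 * Y powr (a - 2) * prob (G t)"
        using c0 t Gmono GM by (intro mult_left_mono finite_measure_mono) auto
      then show "IE (G t) (\<lambda>\<omega>. Z (Suc t) \<omega> - Z t \<omega>) \<le> - c0 * Y powr (a - 2) * prob (G n)"
        using inc[of t] t by simp
    qed
    finally have "real (n - t0) * (c0 * Y powr (a - 2) * prob (G n)) \<le> Y powr a * prob B" by simp
    then have "real (n - t0) * (c0 * (Y powr a / Y\<^sup>2) * prob (G n)) \<le> Y powr a * prob B"
      using Y by (simp add: powr_diff powr_numeral)
    then have "Y powr a * (real (n - t0) * prob (G n) * c0 / Y\<^sup>2) \<le> Y powr a * prob B"
      by (simp add: mult_ac)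
    then have "real (n - t0) * prob (G n) * c0 / Y\<^sup>2 \<le> prob B"
      by (rule mult_left_le_imp_le) (use Y in simp)
    then have "real (n - t0) * prob (G n) \<le> 1 / c0 * Y\<^sup>2 * prob B" using Y c0 by (simp add: field_simps)
    then show ?thesis unfolding G_def Y_def .
  qed
  show thesis by (rule that[of x0 "1 / c0"]) (use x0 c0 main in auto)
qed

lemma prob_below_geometric:
  obtains K q where "0 < K" "0 < q" "q < 1"
    "\<And>y N. 1 \<le> y \<Longrightarrow> \<exists>L. real L \<le> K * y\<^sup>2 \<and> prob (below y (1 + N * L)) \<le> q ^ N"
proof -
  obtain x0 K where x0: "1 < x0" and K: "0 < K" and stay:
    "\<forall>y>0. \<forall>t0\<ge>1. \<forall>B\<in>sets (F t0). \<forall>n\<ge>t0.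
       real (n - t0) * prob (B \<inter> {\<omega> \<in> space M. \<forall>s\<in>{t0..n}. X s \<omega> \<in> {x0<..<y}}) \<le> K * (y + exp 1)\<^sup>2 * prob B"
    using stay_in_strip by blast
  obtain m0 :: nat and \<phi>0 :: real where \<phi>0: "0 < \<phi>0" "\<phi>0 \<le> 1" and hz:
    "\<forall>t\<ge>1. \<forall>B\<in>sets (F t). (\<forall>\<omega>\<in>B. X t \<omega> \<le> x0) \<longrightarrow>
       \<phi>0 * prob B \<le> prob (B \<inter> {\<omega> \<in> space M. \<exists>s\<in>{t<..t+m0}. X s \<omega> = 0})"
    by (rule hit_zero[of x0]) (rule that, assumption+)
  have step: "prob (below y (t0 + (k + m0))) \<le> (1 - \<phi>0 / 2) * prob (below y t0)"
    if y: "0 < y" and t0: "1 \<le> t0" and k: "2 * K * (y + exp 1)\<^sup>2 \<le> real k" "1 \<le> k" for y t0 k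
  proof -
    let ?B = "below y t0"
    let ?I = "{x0<..<y}"
    define n where "n = t0 + k"
    define G where "G t = ?B \<inter> {\<omega> \<in> space M. \<forall>s\<in>{t0..<t}. X s \<omega> \<in> ?I}" for t
    have BF: "?B \<in> sets (F t0)" using below_sets t0 by blast
    have G_eq: "G t = ?B \<inter> {\<omega> \<in> space M. \<forall>s\<in>{t0..t-1}. X s \<omega> \<in> ?I}" if "t0 < t" for t
    proof -
      have "{t0..<t} = {t0..t-1}" using that by auto
      then show ?thesis unfolding G_def by simp
    qed
    have GF: "G t \<in> sets (F t)" if t: "t0 \<le> t" for t
    proof (cases "t = t0")
      case True
      have "G t0 = ?B" using sets.sets_into_space[OF sets_F_events[OF t0 BF]] by (auto simp: G_def)
      then show ?thesis using True BF by simp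
    next
      case False
      then have tt: "t0 < t" using t by simp
      show ?thesis unfolding G_eq[OF tt] using tt t0 BF filt_mono[of t0 t] by (intro sets.Int event_path) auto
    qed
    have GM: "G t \<in> events" if "t0 \<le> t" for t using GF that sets_F_events t0 by (meson order_trans)
    have Gd: "G (Suc t) \<subseteq> G t" for t by (auto simp: G_def)
    have G0: "G t0 = ?B" using sets.sets_into_space[OF sets_F_events[OF t0 BF]] by (auto simp: G_def)
    have half: "prob (G (Suc n)) \<le> prob ?B / 2"
    proof -
      have tn: "t0 \<le> n" by (simp add: n_def)
      have "G (Suc n) = ?B \<inter> {\<omega> \<in> space M. \<forall>s\<in>{t0..n}. X s \<omega> \<in> ?I}"
        unfolding G_def by (simp add: atLeastLessThanSuc_atLeastAtMost)
      then have "real k * prob (G (Suc n)) \<le> K * (y + exp 1)\<^sup>2 * prob ?B"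
        using stay[rule_format, OF y t0 BF tn] by (simp add: n_def)
      also have "\<dots> \<le> real k / 2 * prob ?B" using k by (intro mult_right_mono) auto
      finally show ?thesis using k(2) by (simp add: field_simps)
    qed
    let ?T = "below y (t0 + (k + m0))"
    have TM: "?T \<in> events" using below_sets[of "t0 + (k+m0)" y] sets_F_events[of "t0+(k+m0)"] t0 by simp
    have exit: "prob (?T \<inter> (G t - G (Suc t))) \<le> (1 - \<phi>0) * prob (G t - G (Suc t))" if t: "t0 \<le> t" "t \<le> n" for t
    proof -
      have t1: "1 \<le> t" using t t0 by simp
      let ?E = "G t - G (Suc t)"
      let ?E' = "?E \<inter> {\<omega> \<in> space M. X t \<omega> \<in> {..x0}}"
      have EF: "?E \<in> sets (F t)"
      proof -
        have "?E = G t - (G t \<inter> {\<omega> \<in> space M. X t \<omega> \<in> ?I})"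
          using t unfolding G_def by (auto simp: less_Suc_eq)
        also have "\<dots> \<in> sets (F t)" using GF t t1 by (intro sets.Diff sets.Int event_state) auto
        finally show ?thesis .
      qed
      have EF': "?E' \<in> sets (F t)" using EF t1 by (intro sets.Int event_state) auto
      have EM: "?E \<in> events" "?E' \<in> events" using EF EF' sets_F_events t1 by blast+
      have "?T \<inter> ?E \<subseteq> ?E' - (?E' \<inter> {\<omega> \<in> space M. \<exists>s\<in>{t<..t+m0}. X s \<omega> = 0})"
      proof
        fix \<omega> assume w: "\<omega> \<in> ?T \<inter> ?E"
        then have "X t \<omega> < y" using t t1 by (auto simp: below_def n_def)
        moreover have "X t \<omega> \<notin> ?I" using w t unfolding G_def by (auto simp: less_Suc_eq)
        ultimately have "X t \<omega> \<le> x0" by auto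
        moreover have "\<forall>s\<in>{t<..t+m0}. X s \<omega> \<noteq> 0"
          using w t t1 unfolding below_def alive_def n_def by auto
        ultimately show "\<omega> \<in> ?E' - (?E' \<inter> {\<omega> \<in> space M. \<exists>s\<in>{t<..t+m0}. X s \<omega> = 0})"
          using w by (auto simp: below_def)
      qed
      moreover have hM: "{\<omega> \<in> space M. \<exists>s\<in>{t<..t+m0}. X s \<omega> = 0} \<in> events"
      proof -
        have "{\<omega> \<in> space M. \<exists>s\<in>{t<..t+m0}. X s \<omega> = 0} = (\<Union>s\<in>{t<..t+m0}. {\<omega> \<in> space M. X s \<omega> = 0})" by auto
        also have "\<dots> \<in> events" using t1 event_eq by (intro sets.finite_UN) auto
        finally show ?thesis .
      qed
      ultimately have "prob (?T \<inter> ?E) \<le> prob (?E' - (?E' \<inter> {\<omega> \<in> space M. \<exists>s\<in>{t<..t+m0}. X s \<omega> = 0}))"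
        using EM by (intro finite_measure_mono) auto
      also have "\<dots> = prob ?E' - prob (?E' \<inter> {\<omega> \<in> space M. \<exists>s\<in>{t<..t+m0}. X s \<omega> = 0})"
        using EM hM by (intro finite_measure_Diff) auto
      also have "\<dots> \<le> prob ?E' - \<phi>0 * prob ?E'"
        using hz[rule_format, OF t1 EF'] by simp
      also have "\<dots> = (1 - \<phi>0) * prob ?E'" by (simp add: algebra_simps)
      also have "\<dots> \<le> (1 - \<phi>0) * prob ?E"
        using \<phi>0 EM by (intro mult_left_mono finite_measure_mono) auto
      finally show ?thesis .
    qed
    have tn: "t0 \<le> Suc n" by (simp add: n_def)
    have "?T \<subseteq> ?B" by (auto simp: below_def alive_def)
    have "prob ?T = IE (G t0) (\<lambda>\<omega>. indicator ?T \<omega>)"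
    proof -
      have "IE (G t0) (\<lambda>\<omega>. indicator ?T \<omega>) = (\<integral>\<omega>. indicator ?T \<omega> \<partial>M)"
        unfolding IE_def G0 using \<open>?T \<subseteq> ?B\<close>
        by (intro Bochner_Integration.integral_cong) (auto split: split_indicator)
      then show ?thesis using TM by simp
    qed
    also have "\<dots> = IE (G (Suc n)) (\<lambda>\<omega>. indicator ?T \<omega>) + (\<Sum>t=t0..<Suc n. IE (G t - G (Suc t)) (\<lambda>\<omega>. indicator ?T \<omega>))"
      using IE_stopped[OF tn, of G "\<lambda>_ \<omega>. indicator ?T \<omega>"] GM Gd TM
      by (simp add: IE_const[OF GM, of _ 0, simplified] integrable_indicator_iff less_top[symmetric])
    also have "\<dots> \<le> prob (G (Suc n)) + (\<Sum>t=t0..<Suc n. (1 - \<phi>0) * prob (G t - G (Suc t)))"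
    proof (intro add_mono sum_mono)
      have IEi: "IE A (\<lambda>\<omega>. indicator ?T \<omega>) = prob (?T \<inter> A)" if "A \<in> events" for A
      proof -
        have "IE A (\<lambda>\<omega>. indicator ?T \<omega>) = (\<integral>\<omega>. indicator (?T \<inter> A) \<omega> \<partial>M)"
          unfolding IE_def by (intro Bochner_Integration.integral_cong) (auto split: split_indicator)
        then show ?thesis using that TM by (simp add: Int_assoc)
      qed
      show "IE (G (Suc n)) (\<lambda>\<omega>. indicator ?T \<omega>) \<le> prob (G (Suc n))"
        using GM tn TM by (simp add: IEi finite_measure_mono)
      fix t assume "t \<in> {t0..<Suc n}"
      then have t: "t0 \<le> t" "t \<le> n" by auto
      show "IE (G t - G (Suc t)) (\<lambda>\<omega>. indicator ?T \<omega>) \<le> (1 - \<phi>0) * prob (G t - G (Suc t))"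
        using exit[OF t] GM[of t] GM[of "Suc t"] t by (simp add: IEi)
    qed
    also have "\<dots> = prob (G (Suc n)) + (1 - \<phi>0) * (prob ?B - prob (G (Suc n)))"
      unfolding sum_distrib_left[symmetric] using sum_prob_diff[OF tn, of G] GM Gd G0 by simp
    also have "\<dots> = (1 - \<phi>0) * prob ?B + \<phi>0 * prob (G (Suc n))" by (simp add: algebra_simps)
    also have "\<dots> \<le> (1 - \<phi>0) * prob ?B + \<phi>0 * (prob ?B / 2)"
      using half \<phi>0 by (intro add_left_mono mult_left_mono) auto
    also have "\<dots> = (1 - \<phi>0 / 2) * prob ?B" by (simp add: algebra_simps)
    finally show ?thesis .
  qed
  define K' where "K' = 2 * K * (1 + exp 1)\<^sup>2 + 2 + real m0"
  have "0 \<le> 2 * K * (1 + exp 1)\<^sup>2" using K by simp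
  then have K'0: "0 < K'" unfolding K'_def by linarith
  show thesis
  proof (rule that[of K' "1 - \<phi>0 / 2"])
    show "0 < K'" by (rule K'0)
    show "0 < 1 - \<phi>0 / 2" "1 - \<phi>0 / 2 < 1" using \<phi>0 by auto
    fix y :: real and N :: nat assume y: "1 \<le> y"
    define k where "k = nat \<lceil>2 * K * (y + exp 1)\<^sup>2\<rceil> + 1"
    define L where "L = k + m0"
    have k: "2 * K * (y + exp 1)\<^sup>2 \<le> real k" "1 \<le> k" unfolding k_def by linarith+
    have kk: "real k \<le> 2 * K * (y + exp 1)\<^sup>2 + 2"
      unfolding k_def using K by (simp add: of_nat_nat) linarith
    have y2: "1 \<le> y\<^sup>2" using y by simp
    have "(y + exp 1)\<^sup>2 \<le> (y * (1 + exp 1))\<^sup>2"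
      using y mult_right_mono[of 1 y "exp 1"] by (intro power_mono) (auto simp: algebra_simps)
    then have "2 * K * (y + exp 1)\<^sup>2 \<le> 2 * K * (y * (1 + exp 1))\<^sup>2" using K by simp
    also have "\<dots> = 2 * K * (1 + exp 1)\<^sup>2 * y\<^sup>2" by (simp add: power_mult_distrib)
    finally have "real L \<le> 2 * K * (1 + exp 1)\<^sup>2 * y\<^sup>2 + 2 * 1 + real m0 * 1" using kk by (simp add: L_def)
    also have "\<dots> \<le> 2 * K * (1 + exp 1)\<^sup>2 * y\<^sup>2 + 2 * y\<^sup>2 + real m0 * y\<^sup>2"
      using mult_left_mono[OF y2, of "real m0"] y2 by simp
    also have "\<dots> = K' * y\<^sup>2" by (simp add: K'_def algebra_simps)
    finally have L: "real L \<le> K' * y\<^sup>2" .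
    have "prob (below y (1 + N * L)) \<le> (1 - \<phi>0 / 2) ^ N"
    proof (induction N)
      case (Suc N)
      have "prob (below y (1 + Suc N * L)) = prob (below y ((1 + N * L) + (k + m0)))" by (simp add: L_def algebra_simps)
      also have "\<dots> \<le> (1 - \<phi>0 / 2) * prob (below y (1 + N * L))"
        using step[of y "1 + N * L" k] k y by simp
      also have "\<dots> \<le> (1 - \<phi>0 / 2) * (1 - \<phi>0 / 2) ^ N" using Suc \<phi>0 by (intro mult_left_mono) auto
      finally show ?case by simp
    qed (simp add: prob_le_1)
    then show "\<exists>L. real L \<le> K' * y\<^sup>2 \<and> prob (below y (1 + N * L)) \<le> (1 - \<phi>0 / 2) ^ N" using L by blast
  qed
qed


lemma prob_reach_lower:
  assumes \<nu>: "0 < \<nu>"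
  obtains x1 where
    "\<forall>v\<in>S. \<forall>t0\<ge>1. x1 < v \<longrightarrow> 0 < prob (alive t0 \<inter> {\<omega> \<in> space M. X t0 \<omega> = v}) \<longrightarrow>
       (\<exists>k>0. \<forall>y>v. k / lyap (1 + r) \<nu> (2 * (y + exp 1)) \<le> prob (reach y))"
proof -
  let ?a = "1 + r"
  let ?f = "lyap ?a \<nu>"
  have a: "0 < ?a" "0 \<le> \<nu>" "0 \<le> ?a" "0 \<le> ?a + \<nu>" using \<nu> r_gt by auto
  have e: "0 < \<nu> * (s2 / 2) * (1 + r)" using \<nu> s2_pos r_gt by simp
  obtain x2 where x2: "1 < x2" and dr:
    "\<And>Y t x B y. x2 \<le> x \<Longrightarrow> y \<le> Y \<Longrightarrow> at_state t x B \<Longrightarrow> y = x + exp 1 \<Longrightarrow>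
       ?f y * ((1 + (rate ?a \<nu> (1 / ln y) - \<nu> * (s2 / 2) * (1 + r) * (1 / ln y)) / y\<^sup>2) * prob B)
         \<le> IE B (\<lambda>\<omega>. ?f (min (X (t + 1) \<omega> + exp 1) (2 * Y)))"
    using lyap_sub_drift[OF a(1,2) e] by blast
  obtain x3 K where x3: "1 < x3" and K: "0 < K" and stay:
    "\<forall>y>0. \<forall>t0\<ge>1. \<forall>B\<in>sets (F t0). \<forall>n\<ge>t0.
       real (n - t0) * prob (B \<inter> {\<omega> \<in> space M. \<forall>s\<in>{t0..n}. X s \<omega> \<in> {x3<..<y}}) \<le> K * (y + exp 1)\<^sup>2 * prob B"
    using stay_in_strip by blast
  define x1 where "x1 = max x2 x3"
  have x1: "1 < x1" "x2 \<le> x1" "x3 \<le> x1" using x2 by (auto simp: x1_def)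
  have main: "(?f (v + exp 1) - ?f (x1 + exp 1)) * prob B \<le> ?f (2 * (y + exp 1)) * prob (reach y)"
    if v: "v \<in> S" "x1 < v" and t0: "1 \<le> t0" and B_def: "B = alive t0 \<inter> {\<omega> \<in> space M. X t0 \<omega> = v}" and vy: "v < y" for v t0 B y
  proof -
    have y0: "0 < y" "1 < y" using vy v x1 by auto
    define Y where "Y = y + exp 1"
    have e0: "0 < exp (1::real)" by simp
    then have Y: "exp 1 \<le> Y" "exp 1 \<le> 2 * Y" "0 < Y" using y0(1) unfolding Y_def by argo+
    have BF: "B \<in> sets (F t0)"
      unfolding B_def using alive_sets[OF t0] event_state[of t0 t0 "{v}"] t0 by simp
    have BM: "B \<in> events" using BF sets_F_events t0 by blast
    define G where "G t = B \<inter> {\<omega> \<in> space M. \<forall>s\<in>{t0..t}. X s \<omega> \<in> {x1<..<y}}" for t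
    have GF: "G t \<in> sets (F t)" if t: "t0 \<le> t" for t
      unfolding G_def using t t0 BF filt_mono[of t0 t] by (intro sets.Int event_path) auto
    have GM: "G t \<in> events" if "t0 \<le> t" for t using GF that sets_F_events t0 by (meson order_trans)
    have Gd: "G (Suc t) \<subseteq> G t" for t by (auto simp: G_def)
    have G0: "G t0 = B" using v vy by (auto simp: G_def B_def)
    define Z where "Z t \<omega> = ?f (min (X t \<omega> + exp 1) (2 * Y))" for t \<omega>
    have Zi: "integrable M (Z t)" if "t0 \<le> t" for t
      unfolding Z_def using that t0 Y a by (intro integrable_lyap_min) auto
    have Zle: "Z t \<omega> \<le> ?f (2 * Y)" if "1 \<le> t" "\<omega> \<in> space M" for t \<omega>
      unfolding Z_def using that X_nonneg[of t \<omega>] Y a by (intro lyap_mono) auto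
    have inc: "0 \<le> IE (G t) (\<lambda>\<omega>. Z (Suc t) \<omega> - Z t \<omega>)" if t: "t0 \<le> t" for t
    proof -
      have t1: "1 \<le> t" using t t0 by simp
      have "IE (G t) (Z t) \<le> IE (G t) (Z (Suc t))"
      proof (rule IE_mono_states[OF t1 GF[OF t]])
        show "integrable M (Z t)" "integrable M (Z (Suc t))" using Zi t by auto
        fix x A \<omega>0 assume st: "at_state t x A" and A: "A \<subseteq> G t" and w0: "\<omega>0 \<in> A"
        note AM = at_stateD(3)[OF st] and AX = at_stateD(5)[OF st]
        show "IE A (Z t) \<le> IE A (Z (Suc t))"
        proof -
          have "\<omega>0 \<in> G t" using A w0 by blast
          then have "X t \<omega>0 \<in> {x1<..<y}" using t unfolding G_def by auto
          then have xy: "x2 \<le> x" "x < y" using AX[OF w0] x1 by auto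
          have "IE A (Z t) = IE A (\<lambda>_. ?f (x + exp 1))"
            using AX xy Y by (intro IE_cong) (simp add: Z_def Y_def min_def)
          also have "\<dots> = ?f (x + exp 1) * prob A" using IE_const[OF AM] by simp
          also have "\<dots> \<le> IE A (Z (Suc t))"
            unfolding Z_def using dr[OF xy(1) _ st refl, of Y] xy by (simp add: rate_critical Y_def)
          finally show ?thesis .
        qed
      qed
      then show ?thesis using IE_diff[OF GM[OF t] Zi Zi] t by simp
    qed
    have ineq: "?f (v + exp 1) * prob B \<le> ?f (2 * Y) * prob (G n) + (?f (x1 + exp 1) * prob B + ?f (2 * Y) * prob (reach y))"
      if n: "t0 \<le> n" for n
    proof -
      define R where "R t = G t \<inter> {\<omega> \<in> space M. X (Suc t) \<omega> \<in> {y..}}" for t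
      have RM: "R t \<in> events" if "t0 \<le> t" for t
        unfolding R_def using GM that sets_F_events[OF _ event_state[of "Suc t" "Suc t" "{y..}"]] by auto
      have "?f (v + exp 1) * prob B = IE (G t0) (Z t0)"
      proof -
        have "IE B (Z t0) = IE B (\<lambda>_. ?f (v + exp 1))"
          using vy Y by (intro IE_cong) (auto simp: Z_def Y_def B_def min_def)
        then show ?thesis using IE_const[OF BM] G0 by simp
      qed
      also have "\<dots> \<le> IE (G t0) (Z t0) + (\<Sum>t=t0..<n. IE (G t) (\<lambda>\<omega>. Z (Suc t) \<omega> - Z t \<omega>))"
        using sum_nonneg[of "{t0..<n}" "\<lambda>t. IE (G t) (\<lambda>\<omega>. Z (Suc t) \<omega> - Z t \<omega>)"] inc by simp
      also have "\<dots> = IE (G n) (Z n) + (\<Sum>t=t0..<n. IE (G t - G (Suc t)) (Z (Suc t)))"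
        using n GM Gd Zi by (intro IE_stopped) auto
      also have "\<dots> \<le> ?f (2 * Y) * prob (G n)
          + (\<Sum>t=t0..<n. ?f (x1 + exp 1) * prob (G t - G (Suc t)) + ?f (2 * Y) * prob (R t))"
      proof (intro add_mono sum_mono)
        have "IE (G n) (Z n) \<le> IE (G n) (\<lambda>_. ?f (2 * Y))"
          using Zle[of n] t0 n GM Zi by (intro IE_mono) (auto simp: G_def)
        then show "IE (G n) (Z n) \<le> ?f (2 * Y) * prob (G n)" using IE_const GM n by simp
        fix t assume "t \<in> {t0..<n}"
        then have t: "t0 \<le> t" by simp
        let ?E = "G t - G (Suc t)"
        have EM: "?E \<in> events" using GM t by auto
        have iR: "integrable M (\<lambda>\<omega>. ?f (2 * Y) * indicator (R t) \<omega>)" 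
          using RM t by (simp add: integrable_indicator_iff less_top[symmetric])
        have "IE ?E (Z (Suc t)) \<le> IE ?E (\<lambda>\<omega>. ?f (x1 + exp 1) + ?f (2 * Y) * indicator (R t) \<omega>)"
        proof (rule IE_mono[OF EM])
          fix \<omega> assume w: "\<omega> \<in> ?E"
          have sp: "\<omega> \<in> space M" using w by (auto simp: G_def)
          show "Z (Suc t) \<omega> \<le> ?f (x1 + exp 1) + ?f (2 * Y) * indicator (R t) \<omega>"
          proof (cases "\<omega> \<in> R t")
            case True
            then show ?thesis using Zle[of "Suc t" \<omega>] sp by (simp add: add_increasing)
          next
            case False
            then have "X (Suc t) \<omega> < y" using w sp by (auto simp: R_def)
            moreover have "X (Suc t) \<omega> \<notin> {x1<..<y}" using w t by (auto simp: G_def le_Suc_eq)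
            ultimately have "X (Suc t) \<omega> \<le> x1" by auto
            then have "Z (Suc t) \<omega> \<le> ?f (x1 + exp 1)"
              unfolding Z_def using X_nonneg[of "Suc t" \<omega>] sp Y a by (intro lyap_mono) auto
            then show ?thesis using False by simp
          qed
        qed (use Zi t iR in auto)
        also have "\<dots> = ?f (x1 + exp 1) * prob ?E + IE ?E (\<lambda>\<omega>. ?f (2 * Y) * indicator (R t) \<omega>)"
          using EM iR by (simp add: IE_add IE_const)
        also have "IE ?E (\<lambda>\<omega>. ?f (2 * Y) * indicator (R t) \<omega>) \<le> ?f (2 * Y) * prob (R t)"
        proof -
          have "IE ?E (\<lambda>\<omega>. ?f (2 * Y) * indicator (R t) \<omega>) \<le> (\<integral>\<omega>. ?f (2 * Y) * indicator (R t) \<omega> \<partial>M)"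
            unfolding IE_def using iR EM RM[OF t] by (intro integral_mono IE_integrable) (auto split: split_indicator)
          then show ?thesis using RM t by simp
        qed
        finally show "IE ?E (Z (Suc t)) \<le> ?f (x1 + exp 1) * prob ?E + ?f (2 * Y) * prob (R t)" by simp
      qed
      also have "\<dots> = ?f (2 * Y) * prob (G n) + (?f (x1 + exp 1) * (prob B - prob (G n)) + ?f (2 * Y) * (\<Sum>t=t0..<n. prob (R t)))"
        unfolding sum.distrib sum_distrib_left[symmetric] using sum_prob_diff[OF n, of G] GM Gd G0 by simp
      also have "\<dots> \<le> ?f (2 * Y) * prob (G n) + (?f (x1 + exp 1) * prob B + ?f (2 * Y) * prob (reach y))"
      proof (intro add_left_mono add_mono mult_left_mono)
        have disj: "disjoint_family_on R {t0..<n}"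
        proof -
          have "R i \<inter> R j = {}" if ij: "t0 \<le> i" "i < j" for i j
          proof (rule ccontr)
            assume "R i \<inter> R j \<noteq> {}"
            then obtain \<omega> where w: "\<omega> \<in> R i" "\<omega> \<in> R j" by blast
            then have "y \<le> X (Suc i) \<omega>" by (simp add: R_def)
            moreover have "X (Suc i) \<omega> < y" using w(2) ij by (auto simp: R_def G_def)
            ultimately show False by simp
          qed
          then show ?thesis unfolding disjoint_family_on_def
            by (metis Int_commute atLeastLessThan_iff linorder_neqE_nat)
        qed
        have "(\<Sum>t=t0..<n. prob (R t)) = prob (\<Union>t\<in>{t0..<n}. R t)"
          using disj RM by (intro finite_measure_finite_Union[symmetric]) auto
        also have "\<dots> \<le> prob (reach y)"
        proof (rule finite_measure_mono[OF _ reach_events])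
          show "(\<Union>t\<in>{t0..<n}. R t) \<subseteq> reach y"
          proof
            fix \<omega> assume "\<omega> \<in> (\<Union>t\<in>{t0..<n}. R t)"
            then obtain t where t: "t0 \<le> t" "\<omega> \<in> R t" by auto
            have "\<forall>s\<in>{2..Suc t}. X s \<omega> \<noteq> 0"
            proof
              fix s assume s: "s \<in> {2..Suc t}"
              consider "s \<le> t0" | "t0 \<le> s" "s \<le> t" | "s = Suc t" using s by fastforce
              then show "X s \<omega> \<noteq> 0"
              proof cases
                case 1
                then show ?thesis using t s by (auto simp: R_def G_def B_def alive_def)
              next
                case 2
                then have "x1 < X s \<omega>" using t by (auto simp: R_def G_def)
                then show ?thesis using x1 by simp
              next
                case 3
                then have "y \<le> X s \<omega>" using t by (simp add: R_def)
                then show ?thesis using y0 by simp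
              qed
            qed
            then have "\<omega> \<in> alive (Suc t)" "y \<le> X (Suc t) \<omega>" using t by (auto simp: alive_def R_def)
            then show "\<omega> \<in> reach y" by (auto simp: reach_def intro!: bexI[of _ "Suc t"])
          qed
        qed
        finally show "(\<Sum>t=t0..<n. prob (R t)) \<le> prob (reach y)" .
      qed auto
      finally show ?thesis .
    qed
    have lim: "(\<lambda>k. prob (G (t0 + k))) \<longlonglongrightarrow> 0"
    proof (rule real_tendsto_sandwich)
      show "\<forall>\<^sub>F k in sequentially. 0 \<le> prob (G (t0 + k))" by simp
      show "(\<lambda>k. K * (y + exp 1)\<^sup>2 * prob B / real k) \<longlonglongrightarrow> 0" by (rule lim_const_over_n)
      show "\<forall>\<^sub>F k in sequentially. prob (G (t0 + k)) \<le> K * (y + exp 1)\<^sup>2 * prob B / real k"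
      proof (rule eventually_sequentiallyI[of 1])
        fix k :: nat assume k: "1 \<le> k"
        have tk: "t0 \<le> t0 + k" by simp
        let ?H = "B \<inter> {\<omega> \<in> space M. \<forall>s\<in>{t0..t0 + k}. X s \<omega> \<in> {x3<..<y}}"
        have "?H \<in> sets (F (t0 + k))" using t0 BF filt_mono[of t0 "t0+k"] by (intro sets.Int event_path) auto
        then have HM: "?H \<in> events" using sets_F_events[of "t0+k"] t0 by simp
        have "real k * prob ?H \<le> K * (y + exp 1)\<^sup>2 * prob B"
          using stay[rule_format, OF y0(1) t0 BF tk] by simp
        moreover have "prob (G (t0 + k)) \<le> prob ?H"
          using x1(3) by (intro finite_measure_mono HM) (auto simp: G_def)
        ultimately have "real k * prob (G (t0 + k)) \<le> K * (y + exp 1)\<^sup>2 * prob B"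
          by (meson mult_left_mono of_nat_0_le_iff order_trans)
        then show "prob (G (t0 + k)) \<le> K * (y + exp 1)\<^sup>2 * prob B / real k"
          using k by (simp add: pos_le_divide_eq mult.commute)
      qed
    qed simp
    have "(\<lambda>k. ?f (2 * Y) * prob (G (t0 + k)) + (?f (x1 + exp 1) * prob B + ?f (2 * Y) * prob (reach y)))
       \<longlonglongrightarrow> ?f (2 * Y) * 0 + (?f (x1 + exp 1) * prob B + ?f (2 * Y) * prob (reach y))"
      by (intro tendsto_add tendsto_mult tendsto_const lim)
    then have "?f (v + exp 1) * prob B \<le> ?f (2 * Y) * 0 + (?f (x1 + exp 1) * prob B + ?f (2 * Y) * prob (reach y))"
      by (rule LIMSEQ_le_const) (use ineq in \<open>auto intro!: exI[of _ 0]\<close>)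
    then show ?thesis unfolding Y_def by (simp add: algebra_simps)
  qed
  show thesis
  proof (rule that[of x1], intro ballI allI impI)
    fix v and t0 :: nat
    assume v: "v \<in> S" and t0: "1 \<le> t0" and vx: "x1 < v" and P: "0 < prob (alive t0 \<inter> {\<omega> \<in> space M. X t0 \<omega> = v})"
    define B where "B = alive t0 \<inter> {\<omega> \<in> space M. X t0 \<omega> = v}"
    define k where "k = (?f (v + exp 1) - ?f (x1 + exp 1)) * prob B"
    have "?f (x1 + exp 1) < ?f (v + exp 1)" using vx x1 a by (intro lyap_strict_mono) auto
    then have k: "0 < k" using P by (simp add: k_def B_def)
    have "k / ?f (2 * (y + exp 1)) \<le> prob (reach y)" if y: "v < y" for y
    proof -
      have "0 < y" using y vx x1 by simp
      then have "0 < ?f (2 * (y + exp 1))" using exp_gt_zero[of "1::real"] by (intro lyap_pos) argo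
      then show ?thesis using main[OF v vx t0 B_def y] by (simp add: k_def pos_divide_le_eq mult.commute)
    qed
    then show "\<exists>k>0. \<forall>y>v. k / ?f (2 * (y + exp 1)) \<le> prob (reach y)" using k by blast
  qed
qed

definition long_stay :: "real \<Rightarrow> nat \<Rightarrow> 'a set" where
  "long_stay y l = (\<Union>s\<in>{1..}. alive (s + l) \<inter> {\<omega> \<in> space M. \<forall>u\<in>{s..s+l}. y / 2 < X u \<omega>})"

lemma long_stay_events: "long_stay y l \<in> events"
proof -
  have "alive (s + l) \<inter> {\<omega> \<in> space M. \<forall>u\<in>{s..s+l}. X u \<omega> \<in> {y/2<..}} \<in> events" if "1 \<le> s" for s
    using that by (intro sets_F_events[of "s+l"] sets.Int alive_sets event_path) auto
  then show ?thesis unfolding long_stay_def by (intro sets.countable_UN'') auto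
qed

lemma prob_long_stay:
  obtains k y0 where "0 < k" "0 < y0" "\<And>y l. y0 \<le> y \<Longrightarrow> real l \<le> k * y\<^sup>2 \<Longrightarrow> prob (reach y) / 2 \<le> prob (long_stay y l)"
proof -
  obtain x0 where mom:
    "\<And>t x B. x0 \<le> x \<Longrightarrow> at_state t x B \<Longrightarrow> \<bar>IE B (D t) - c / x * prob B\<bar> \<le> 1 / (x * ln x) * prob B"
    "\<And>t x B. x0 \<le> x \<Longrightarrow> at_state t x B \<Longrightarrow> \<bar>IE B (\<lambda>\<omega>. (D t \<omega>)\<^sup>2) - s2 * prob B\<bar> \<le> 1 / ln x * prob B"
    using local_moments[of 1] zero_less_one by blast
  define C2 where "C2 = 2 * (\<bar>c\<bar> + 1) + s2 + 1"
  have C2: "0 < C2" using s2_pos by (simp add: C2_def)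
  define y0 where "y0 = 2 * max x0 (exp 1)"
  have y0: "0 < y0" using exp_gt_zero[of "1::real"] unfolding y0_def by linarith
  have main: "prob (passage y s) / 2 \<le> prob (passage y s \<inter> {\<omega> \<in> space M. \<forall>u\<in>{s..s+l}. X u \<omega> \<in> {y/2<..}})"
    if y: "y0 \<le> y" and l: "real l \<le> 1 / (8 * C2) * y\<^sup>2" and s: "1 \<le> s" for y l s
  proof -
    let ?B = "passage y s"
    have yp: "0 < y" "x0 \<le> y / 2" "exp 1 \<le> y / 2" using y y0 unfolding y0_def by linarith+
    have BF: "?B \<in> sets (F s)" using passage_sets s by blast
    define G where "G t = ?B \<inter> {\<omega> \<in> space M. \<forall>u\<in>{s..t}. X u \<omega> \<in> {y/2<..}}" for t
    have GF: "G t \<in> sets (F t)" if t: "s \<le> t" for t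
      unfolding G_def using t s BF filt_mono[of s t] by (intro sets.Int event_path) auto
    have GM: "G t \<in> events" if "s \<le> t" for t using GF that sets_F_events s by (meson order_trans)
    have Gd: "G (Suc t) \<subseteq> G t" for t by (auto simp: G_def)
    have G0: "G s = ?B" using yp by (auto simp: G_def passage_def alive_def)
    define Z where "Z t \<omega> = (max 0 (y - X t \<omega>))\<^sup>2" for t \<omega>
    have Zi: "integrable M (Z t)" if "s \<le> t" for t
    proof (rule integrable_bounded)
      have "X t \<in> borel_measurable M" using X_measurable that s by simp
      then show "Z t \<in> borel_measurable M" unfolding Z_def by measurable
      fix \<omega> assume "\<omega> \<in> space M"
      then have "0 \<le> X t \<omega>" using X_nonneg that s by simp
      then have "(max 0 (y - X t \<omega>))\<^sup>2 \<le> y\<^sup>2" using yp by (intro power_mono) auto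
      then show "\<bar>Z t \<omega>\<bar> \<le> y\<^sup>2" by (simp add: Z_def)
    qed
    have inc: "IE (G t) (\<lambda>\<omega>. Z (Suc t) \<omega> - Z t \<omega>) \<le> C2 * prob ?B" if t: "s \<le> t" for t
    proof -
      have t1: "1 \<le> t" using t s by simp
      have "IE (G t) (\<lambda>\<omega>. Z (Suc t) \<omega> - Z t \<omega>) \<le> IE (G t) (\<lambda>_. C2)"
      proof (rule IE_mono_states[OF t1 GF[OF t]])
        show "integrable M (\<lambda>\<omega>. Z (Suc t) \<omega> - Z t \<omega>)" using Zi t by simp
        fix x A \<omega>0 assume st: "at_state t x A" and A: "A \<subseteq> G t" and w0: "\<omega>0 \<in> A"
        note AM = at_stateD(3)[OF st] and AX = at_stateD(5)[OF st]
        show "IE A (\<lambda>\<omega>. Z (Suc t) \<omega> - Z t \<omega>) \<le> IE A (\<lambda>_. C2)"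
        proof -
          have "\<omega>0 \<in> G t" using A w0 by blast
          then have "y / 2 < X t \<omega>0" using t unfolding G_def by auto
          then have xy: "y / 2 < x" using AX[OF w0] by simp
          have xp: "exp 1 \<le> x" "x0 \<le> x" "0 < x" using xy yp by linarith+
          have lx: "1 / ln x \<le> 1" using ln_ge_1[OF xp(1)] by simp
          have m1: "\<bar>IE A (D t) - c / x * prob A\<bar> \<le> 1 / (x * ln x) * prob A"
            by (rule mom(1)[OF xp(2) st])
          have m2: "\<bar>IE A (\<lambda>\<omega>. (D t \<omega>)\<^sup>2) - s2 * prob A\<bar> \<le> 1 / ln x * prob A"
            by (rule mom(2)[OF xp(2) st])
          define g where "g = max 0 (y - x)"
          have g: "0 \<le> g" "g \<le> x" using xy xp by (auto simp: g_def)
          have i: "integrable M (\<lambda>\<omega>. (- 2 * g) * D t \<omega>)" "integrable M (\<lambda>\<omega>. (D t \<omega>)\<^sup>2)"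
            using integrable_D integrable_D2 t1 by auto
          have "IE A (\<lambda>\<omega>. Z (Suc t) \<omega> - Z t \<omega>) \<le> IE A (\<lambda>\<omega>. (- 2 * g) * D t \<omega> + (D t \<omega>)\<^sup>2)"
          proof (rule IE_mono[OF AM])
            fix \<omega> assume w: "\<omega> \<in> A"
            have eq: "X (Suc t) \<omega> = x + D t \<omega>" using AX[OF w] by (simp add: D_def)
            have "\<bar>max 0 (y - X (Suc t) \<omega>)\<bar> \<le> \<bar>g - D t \<omega>\<bar>" unfolding eq g_def by linarith
            then have "(max 0 (y - X (Suc t) \<omega>))\<^sup>2 \<le> (g - D t \<omega>)\<^sup>2" by (simp only: abs_le_square_iff)
            moreover have "Z t \<omega> = g\<^sup>2" using AX[OF w] by (simp add: Z_def g_def)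
            ultimately show "Z (Suc t) \<omega> - Z t \<omega> \<le> (- 2 * g) * D t \<omega> + (D t \<omega>)\<^sup>2"
              unfolding Z_def[of "Suc t"] by (simp add: power2_diff)
          qed (use Zi t i in auto)
          also have "\<dots> = (- 2 * g) * IE A (D t) + IE A (\<lambda>\<omega>. (D t \<omega>)\<^sup>2)"
            unfolding IE_add[OF AM i] IE_cmult ..
          also have "\<dots> \<le> 2 * (\<bar>c\<bar> + 1) * prob A + (s2 + 1) * prob A"
          proof (intro add_mono)
            have tri: "\<bar>u\<bar> \<le> \<bar>v\<bar> + w" if "\<bar>u - v\<bar> \<le> w" for u v w :: real using that by linarith
            have "\<bar>IE A (D t)\<bar> \<le> \<bar>c / x * prob A\<bar> + 1 / (x * ln x) * prob A"
              by (rule tri[OF m1])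
            also have "\<dots> \<le> \<bar>c\<bar> / x * prob A + 1 / x * prob A"
            proof (intro add_mono mult_right_mono)
              show "\<bar>c / x * prob A\<bar> \<le> \<bar>c\<bar> / x * prob A" using xp by (simp add: abs_mult)
              have "(1 / x) * (1 / ln x) \<le> (1 / x) * 1" using xp lx by (intro mult_left_mono) auto
              then show "1 / (x * ln x) \<le> 1 / x" by simp
            qed simp
            also have "\<dots> = (\<bar>c\<bar> + 1) * prob A / x" using xp by (simp add: field_simps)
            finally have "\<bar>IE A (D t)\<bar> * g \<le> (\<bar>c\<bar> + 1) * prob A / x * x"
              using g xp by (intro mult_mono) auto
            then have "\<bar>IE A (D t)\<bar> * g \<le> (\<bar>c\<bar> + 1) * prob A" using xp by simp
            moreover have "(- IE A (D t)) * g \<le> \<bar>IE A (D t)\<bar> * g"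
              using g(1) by (intro mult_right_mono) auto
            moreover have "(- 2 * g) * IE A (D t) = 2 * ((- IE A (D t)) * g)" by simp
            ultimately show "(- 2 * g) * IE A (D t) \<le> 2 * (\<bar>c\<bar> + 1) * prob A" by linarith
            have "1 / ln x * prob A \<le> 1 * prob A" using lx by (intro mult_right_mono) auto
            then show "IE A (\<lambda>\<omega>. (D t \<omega>)\<^sup>2) \<le> (s2 + 1) * prob A"
              using m2 by (simp add: algebra_simps)
          qed
          also have "\<dots> = IE A (\<lambda>_. C2)" using IE_const[OF AM] by (simp add: C2_def algebra_simps)
          finally show ?thesis .
        qed
      qed simp
      also have "\<dots> \<le> C2 * prob ?B"
        using GM[OF t] C2 sets_F_events[OF s BF] by (auto simp: IE_const G_def intro!: mult_left_mono finite_measure_mono)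
      finally show ?thesis .
    qed
    define n where "n = s + l"
    have n: "s \<le> n" by (simp add: n_def)
    have "(y / 2)\<^sup>2 * (prob ?B - prob (G n)) = (\<Sum>t=s..<n. (y / 2)\<^sup>2 * prob (G t - G (Suc t)))"
      unfolding sum_distrib_left[symmetric] using sum_prob_diff[OF n, of G] GM Gd G0 by simp
    also have "\<dots> \<le> (\<Sum>t=s..<n. IE (G t - G (Suc t)) (Z (Suc t)))"
    proof (intro sum_mono)
      fix t assume "t \<in> {s..<n}"
      then have t: "s \<le> t" by simp
      have EM: "G t - G (Suc t) \<in> events" using GM t by auto
      have "IE (G t - G (Suc t)) (\<lambda>_. (y / 2)\<^sup>2) \<le> IE (G t - G (Suc t)) (Z (Suc t))"
      proof (rule IE_mono[OF EM])
        fix \<omega> assume w: "\<omega> \<in> G t - G (Suc t)"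
        then have "X (Suc t) \<omega> \<le> y / 2" using t by (auto simp: G_def le_Suc_eq)
        then show "(y / 2)\<^sup>2 \<le> Z (Suc t) \<omega>" unfolding Z_def using yp by (intro power_mono) auto
      qed (use Zi t in auto)
      then show "(y / 2)\<^sup>2 * prob (G t - G (Suc t)) \<le> IE (G t - G (Suc t)) (Z (Suc t))"
        using IE_const[OF EM] by simp
    qed
    also have "\<dots> \<le> IE (G n) (Z n) + (\<Sum>t=s..<n. IE (G t - G (Suc t)) (Z (Suc t)))"
      using IE_nonneg[of "G n" "Z n"] by (simp add: Z_def)
    also have "\<dots> = IE (G s) (Z s) + (\<Sum>t=s..<n. IE (G t) (\<lambda>\<omega>. Z (Suc t) \<omega> - Z t \<omega>))"
      using n GM Gd Zi by (intro IE_stopped[symmetric]) auto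
    also have "\<dots> \<le> 0 + (\<Sum>t=s..<n. C2 * prob ?B)"
    proof (intro add_mono sum_mono inc)
      have "IE (G s) (Z s) = IE (G s) (\<lambda>_. 0)"
        unfolding G0 by (intro IE_cong) (simp add: passage_def Z_def)
      then show "IE (G s) (Z s) \<le> 0" by (simp add: IE_def)
    qed auto
    also have "\<dots> = real l * C2 * prob ?B" by (simp add: n_def)
    also have "\<dots> \<le> 1 / (8 * C2) * y\<^sup>2 * C2 * prob ?B"
      using l C2 by (intro mult_right_mono) auto
    also have "\<dots> = (y / 2)\<^sup>2 * (prob ?B / 2)" using C2 by (simp add: field_simps power2_eq_square)
    finally have "prob ?B - prob (G n) \<le> prob ?B / 2"
      by (rule mult_left_le_imp_le) (use yp in simp)
    then show ?thesis unfolding G_def n_def by simp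
  qed
  show thesis
  proof (rule that[of "1 / (8 * C2)" y0])
    show "0 < 1 / (8 * C2)" using C2 by simp
    show "0 < y0" by (rule y0)
    fix y l assume y: "y0 \<le> y" and l: "real l \<le> 1 / (8 * C2) * y\<^sup>2"
    define H where "H i = passage y (Suc i) \<inter> {\<omega> \<in> space M. \<forall>u\<in>{Suc i..Suc i+l}. X u \<omega> \<in> {y/2<..}}" for i
    have HM: "H i \<in> events" for i
    proof -
      have "passage y (Suc i) \<in> sets (F (Suc i + l))" using passage_sets[of "Suc i" y] filt_mono[of "Suc i" "Suc i + l"] by auto
      then have "H i \<in> sets (F (Suc i + l))" unfolding H_def by (intro sets.Int event_path) auto
      then show ?thesis using sets_F_events[of "Suc i + l"] by simp
    qed
    have dj: "disjoint_family H"
    proof -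
      have "H i \<inter> H j = {}" if "i \<noteq> j" for i j
      proof -
        have "passage y (Suc i) \<inter> passage y (Suc j) = {}"
          using passage_disjoint[of y] that unfolding disjoint_family_on_def by simp
        then show ?thesis unfolding H_def by blast
      qed
      then show ?thesis unfolding disjoint_family_on_def by blast
    qed
    have sH: "(\<lambda>i. prob (H i)) sums prob (\<Union>i. H i)"
      using HM dj by (intro finite_measure_UNION) auto
    have "(\<lambda>i. prob (passage y (Suc i)) / 2) sums (prob (reach y) / 2)"
      using prob_passage_sums by (rule sums_divide)
    then have "prob (reach y) / 2 \<le> prob (\<Union>i. H i)"
    proof (rule sums_le[rotated])
      show "(\<lambda>i. prob (H i)) sums prob (\<Union>i. H i)" by (rule sH)
      show "prob (passage y (Suc i)) / 2 \<le> prob (H i)" for i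
        using main[OF y l, of "Suc i"] unfolding H_def by simp
    qed
    also have "\<dots> \<le> prob (long_stay y l)"
    proof (rule finite_measure_mono[OF _ long_stay_events])
      show "(\<Union>i. H i) \<subseteq> long_stay y l"
      proof
        fix \<omega> assume "\<omega> \<in> (\<Union>i. H i)"
        then obtain i where w: "\<omega> \<in> H i" by blast
        have "\<forall>s\<in>{2..Suc i + l}. X s \<omega> \<noteq> 0"
        proof
          fix u assume u: "u \<in> {2..Suc i + l}"
          show "X u \<omega> \<noteq> 0"
          proof (cases "u \<le> Suc i")
            case True
            then show ?thesis using w u by (auto simp: H_def passage_def alive_def)
          next
            case False
            then have "y / 2 < X u \<omega>" using w u by (auto simp: H_def)
            then show ?thesis using y y0 by auto
          qed
        qed
        then have "\<omega> \<in> alive (Suc i + l) \<inter> {\<omega> \<in> space M. \<forall>u\<in>{Suc i..Suc i+l}. y / 2 < X u \<omega>}"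
          using w by (auto simp: H_def alive_def)
        then show "\<omega> \<in> long_stay y l" unfolding long_stay_def by (intro UN_I[of "Suc i"]) auto
      qed
    qed
    finally show "prob (reach y) / 2 \<le> prob (long_stay y l)" .
  qed
qed

end

section \<open>Moments from tails\<close>

lemma enn_pow_ge_dyadic_sum:
  fixes z :: ennreal and \<theta> :: real
  assumes "0 < \<theta>"
  shows "(\<Sum>k<n. ennreal ((1 - 2 powr (-\<theta>)) * 2 powr (\<theta> * real k)) * (if ennreal (2 ^ k) \<le> z then 1 else 0)) \<le> enn_pow z \<theta>"
proof (cases "z = \<infinity>")
  case False
  define w where "w = enn2real z"
  have zw: "z = ennreal w" "0 \<le> w" using False by (auto simp: w_def less_top)
  have iff: "ennreal (2 ^ k) \<le> z \<longleftrightarrow> 2 ^ k \<le> w" for k :: nat unfolding zw(1) using zw(2) by (simp add: ennreal_le_iff)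
  define a where "a k = 2 powr (\<theta> * (real k - 1))" for k :: nat
  have ca: "(1 - 2 powr (-\<theta>)) * 2 powr (\<theta> * real k) = a (Suc k) - a k" for k
    by (simp add: a_def algebra_simps flip: powr_add)
  have a0: "0 \<le> a k" for k by (simp add: a_def)
  have am: "a k \<le> a (Suc k)" for k unfolding a_def using assms by (intro powr_mono) auto
  define s where "s n = (\<Sum>k<n. (a (Suc k) - a k) * (if 2 ^ k \<le> w then 1 else 0))" for n
  have s: "s n \<le> w powr \<theta> \<and> s n \<le> a n" for n
  proof (induction n)
    case 0
    then show ?case using a0 by (simp add: s_def)
  next
    case (Suc n)
    show ?case
    proof (cases "2 ^ n \<le> w")
      case True
      have "a (Suc n) = (2 ^ n) powr \<theta>" by (simp add: a_def powr_powr mult.commute flip: powr_realpow)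
      also have "\<dots> \<le> w powr \<theta>" using True assms by (intro powr_mono2) auto
      finally show ?thesis using True Suc by (simp add: s_def)
    next
      case False
      then show ?thesis using Suc am[of n] by (simp add: s_def)
    qed
  qed
  have "(\<Sum>k<n. ennreal ((1 - 2 powr (-\<theta>)) * 2 powr (\<theta> * real k)) * (if ennreal (2 ^ k) \<le> z then 1 else 0))
      = (\<Sum>k<n. ennreal ((a (Suc k) - a k) * (if 2 ^ k \<le> w then 1 else 0)))"
    unfolding ca iff by (intro sum.cong) auto
  also have "\<dots> = ennreal (s n)" unfolding s_def using am by (intro sum_ennreal) auto
  also have "\<dots> \<le> ennreal (w powr \<theta>)" using s by (intro ennreal_leI) auto
  also have "\<dots> = enn_pow z \<theta>" using False assms by (simp add: enn_pow_def pow0_def w_def)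
  finally show ?thesis .
qed (simp add: enn_pow_def)

lemma (in prob_space) nn_integral_enn_pow_infinite:
  fixes f :: "'a \<Rightarrow> ennreal"
  assumes [measurable]: "f \<in> borel_measurable M" and \<theta>: "0 < \<theta>"
    and tail: "\<forall>\<^sub>F x in at_top. x powr (-\<theta>) * ln x powr (-1) \<le> prob {\<omega> \<in> space M. ennreal x \<le> f \<omega>}"
  shows "(\<integral>\<^sup>+\<omega>. enn_pow (f \<omega>) \<theta> \<partial>M) = \<infinity>"
proof (rule ccontr)
  assume fin: "(\<integral>\<^sup>+\<omega>. enn_pow (f \<omega>) \<theta> \<partial>M) \<noteq> \<infinity>"
  define I where "I = enn2real (\<integral>\<^sup>+\<omega>. enn_pow (f \<omega>) \<theta> \<partial>M)"
  have I: "(\<integral>\<^sup>+\<omega>. enn_pow (f \<omega>) \<theta> \<partial>M) = ennreal I" "0 \<le> I"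
    using fin by (auto simp: I_def less_top)
  define T where "T k = prob {\<omega> \<in> space M. ennreal (2 ^ k) \<le> f \<omega>}" for k :: nat
  define c where "c = 1 - 2 powr (-\<theta>)"
  have c: "0 < c" using \<theta> by (simp add: c_def powr_less_one)
  have bound: "(\<Sum>k<n. c * 2 powr (\<theta> * real k) * T k) \<le> I" for n
  proof -
    have "ennreal (\<Sum>k<n. c * 2 powr (\<theta> * real k) * T k) = (\<Sum>k<n. ennreal (c * 2 powr (\<theta> * real k) * T k))"
      using c by (intro sum_ennreal[symmetric]) (auto simp: T_def)
    also have "\<dots> = (\<Sum>k<n. \<integral>\<^sup>+\<omega>. ennreal (c * 2 powr (\<theta> * real k)) * indicator {\<omega> \<in> space M. ennreal (2 ^ k) \<le> f \<omega>} \<omega> \<partial>M)"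
      using c by (intro sum.cong) (auto simp: T_def nn_integral_cmult_indicator emeasure_eq_measure ennreal_mult)
    also have "\<dots> = (\<integral>\<^sup>+\<omega>. (\<Sum>k<n. ennreal (c * 2 powr (\<theta> * real k)) * indicator {\<omega> \<in> space M. ennreal (2 ^ k) \<le> f \<omega>} \<omega>) \<partial>M)"
      by (intro nn_integral_sum[symmetric]) measurable
    also have "\<dots> = (\<integral>\<^sup>+\<omega>. (\<Sum>k<n. ennreal (c * 2 powr (\<theta> * real k)) * (if ennreal (2 ^ k) \<le> f \<omega> then 1 else 0)) \<partial>M)"
      by (intro nn_integral_cong sum.cong) (auto split: split_indicator)
    also have "\<dots> \<le> (\<integral>\<^sup>+\<omega>. enn_pow (f \<omega>) \<theta> \<partial>M)"
      unfolding c_def using enn_pow_ge_dyadic_sum[OF \<theta>] by (intro nn_integral_mono) auto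
    finally show ?thesis using I by (simp add: ennreal_le_iff)
  qed
  have sm: "summable (\<lambda>k. c * 2 powr (\<theta> * real k) * T k)"
  proof (rule bounded_imp_summable)
    show "0 \<le> c * 2 powr (\<theta> * real n) * T n" for n using c by (simp add: T_def)
    show "(\<Sum>k\<le>n. c * 2 powr (\<theta> * real k) * T k) \<le> I" for n
      using bound[of "Suc n"] by (simp only: lessThan_Suc_atMost)
  qed
  have "filterlim (\<lambda>k::nat. (2::real) ^ k) at_top sequentially"
    by real_asymp
  then have ev: "\<forall>\<^sub>F k in sequentially. (2 ^ k) powr (-\<theta>) * ln (2 ^ k) powr (-1) \<le> T k"
    unfolding T_def using tail by (rule eventually_compose_filterlim[rotated])
  have "summable (\<lambda>k. inverse (real k))"
  proof (rule summable_comparison_test_ev)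
    show "summable (\<lambda>k. (ln 2 / c) * (c * 2 powr (\<theta> * real k) * T k))" by (rule summable_mult[OF sm])
    show "\<forall>\<^sub>F k in sequentially. norm (inverse (real k)) \<le> (ln 2 / c) * (c * 2 powr (\<theta> * real k) * T k)"
      using ev eventually_gt_at_top[of 0]
    proof eventually_elim
      case (elim k)
      have "(2 ^ k) powr (-\<theta>) = 2 powr (- (\<theta> * real k))" by (simp add: powr_powr mult.commute flip: powr_realpow)
      moreover have "ln (2 ^ k) powr (-1) = inverse (real k * ln 2)"
        using elim(2) by (simp add: ln_realpow powr_minus)
      ultimately have "2 powr (- (\<theta> * real k)) * inverse (real k * ln 2) \<le> T k" using elim by simp
      then have "2 powr (\<theta> * real k) * (2 powr (- (\<theta> * real k)) * inverse (real k * ln 2)) \<le> 2 powr (\<theta> * real k) * T k"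
        by (intro mult_left_mono) auto
      then have "inverse (real k * ln 2) \<le> 2 powr (\<theta> * real k) * T k"
        by (simp add: mult.assoc[symmetric] flip: powr_add)
      then have "ln 2 * inverse (real k * ln 2) \<le> ln 2 * (2 powr (\<theta> * real k) * T k)"
        by (intro mult_left_mono) auto
      then show ?case using c elim(2) by (simp add: field_simps)
    qed
  qed
  then show False by (rule notE[OF not_summable_harmonic])
qed

lemma (in prob_space) nn_integral_enn_pow_finite:
  fixes f :: "'a \<Rightarrow> ennreal"
  assumes [measurable]: "f \<in> borel_measurable M" and q: "0 < q" "q < s"
    and tail: "\<forall>\<^sub>F x in at_top. prob {\<omega> \<in> space M. ennreal x \<le> f \<omega>} \<le> x powr (-s)"
  shows "(\<integral>\<^sup>+\<omega>. enn_pow (f \<omega>) q \<partial>M) < \<infinity>"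
proof -
  define T where "T k = prob {\<omega> \<in> space M. ennreal (2 ^ k) \<le> f \<omega>}" for k :: nat
  have "filterlim (\<lambda>k::nat. (2::real) ^ k) at_top sequentially"
    by real_asymp
  then have ev: "\<forall>\<^sub>F k in sequentially. T k \<le> (2 ^ k) powr (-s)"
    unfolding T_def using tail by (rule eventually_compose_filterlim[rotated])
  have fin: "AE \<omega> in M. f \<omega> \<noteq> \<infinity>"
  proof -
    have "prob {\<omega> \<in> space M. f \<omega> = \<infinity>} \<le> 0"
    proof (rule tendsto_lowerbound)
      show "((\<lambda>k::nat. (2 ^ k) powr (-s)) \<longlongrightarrow> 0) sequentially" using q by real_asymp
      show "\<forall>\<^sub>F k in sequentially. prob {\<omega> \<in> space M. f \<omega> = \<infinity>} \<le> (2 ^ k) powr (-s)"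
        using ev
      proof eventually_elim
        case (elim k)
        have "prob {\<omega> \<in> space M. f \<omega> = \<infinity>} \<le> T k"
          unfolding T_def by (intro finite_measure_mono) (auto, measurable)
        then show ?case using elim by simp
      qed
    qed simp
    then have "prob {\<omega> \<in> space M. f \<omega> = \<infinity>} = 0" by (simp add: measure_le_0_iff)
    then show ?thesis by (subst (asm) prob_eq_0) auto
  qed
  have pw: "enn_pow z q \<le> 1 + (\<Sum>k. ennreal (2 powr (q * (real k + 1))) * (if ennreal (2 ^ k) \<le> z then 1 else 0))"
    if "z \<noteq> \<infinity>" for z
  proof -
    define w where "w = enn2real z"
    have zw: "z = ennreal w" "0 \<le> w" using that by (auto simp: w_def less_top)
    have e: "enn_pow z q = ennreal (w powr q)" using that q by (simp add: enn_pow_def pow0_def w_def)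
    show ?thesis
    proof (cases "w < 1")
      case True
      then have "w powr q \<le> 1" using zw q by (simp add: powr_le1)
      then have "enn_pow z q \<le> 1" unfolding e by (simp add: ennreal_le_1)
      then show ?thesis by (meson order_trans le_iff_add)
    next
      case False
      define m where "m = nat \<lfloor>log 2 w\<rfloor>"
      have l0: "0 \<le> log 2 w" using False by simp
      have m: "real m \<le> log 2 w" "log 2 w < real m + 1" unfolding m_def using l0 by linarith+
      have "2 powr real m \<le> 2 powr log 2 w" using m by (intro powr_mono) auto
      then have m1: "2 ^ m \<le> w" using False by (simp add: powr_realpow)
      have "w = 2 powr log 2 w" using False by simp
      also have "\<dots> \<le> 2 powr (real m + 1)" using m by (intro powr_mono) auto
      finally have "w powr q \<le> (2 powr (real m + 1)) powr q" using zw q by (intro powr_mono2) auto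
      also have "\<dots> = 2 powr (q * (real m + 1))" by (simp add: powr_powr mult.commute)
      finally have "enn_pow z q \<le> ennreal (2 powr (q * (real m + 1)))" unfolding e by (rule ennreal_leI)
      also have "\<dots> = (\<Sum>k\<in>{m}. ennreal (2 powr (q * (real k + 1))) * (if ennreal (2 ^ k) \<le> z then 1 else 0))"
        using m1 zw by (simp add: ennreal_le_iff)
      also have "\<dots> \<le> (\<Sum>k. ennreal (2 powr (q * (real k + 1))) * (if ennreal (2 ^ k) \<le> z then 1 else 0))"
        by (intro sum_le_suminf) auto
      finally show ?thesis by (meson add_increasing zero_le order_trans)
    qed
  qed
  have "(\<integral>\<^sup>+\<omega>. enn_pow (f \<omega>) q \<partial>M)
      \<le> (\<integral>\<^sup>+\<omega>. 1 + (\<Sum>k. ennreal (2 powr (q * (real k + 1))) * indicator {\<omega> \<in> space M. ennreal (2 ^ k) \<le> f \<omega>} \<omega>) \<partial>M)"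
  proof (rule nn_integral_mono_AE)
    show "AE \<omega> in M. enn_pow (f \<omega>) q \<le> 1 + (\<Sum>k. ennreal (2 powr (q * (real k + 1))) * indicator {\<omega> \<in> space M. ennreal (2 ^ k) \<le> f \<omega>} \<omega>)"
      using fin AE_space
    proof eventually_elim
      case (elim \<omega>)
      have "(\<lambda>k. indicator {\<omega> \<in> space M. ennreal (2 ^ k) \<le> f \<omega>} \<omega> :: ennreal) = (\<lambda>k. if ennreal (2 ^ k) \<le> f \<omega> then 1 else 0)"
        using elim by (auto split: split_indicator)
      then show ?case using pw[of "f \<omega>"] elim by (simp add: fun_eq_iff)
    qed
  qed
  also have "\<dots> = 1 + (\<Sum>k. ennreal (2 powr (q * (real k + 1)) * T k))"
  proof -
    let ?g = "\<lambda>k \<omega>. ennreal (2 powr (q * (real k + 1))) * indicator {\<omega> \<in> space M. ennreal (2 ^ k) \<le> f \<omega>} \<omega>"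
    have ev: "{\<omega> \<in> space M. ennreal (2 ^ k) \<le> f \<omega>} \<in> events" for k :: nat by measurable
    then have g: "?g k \<in> borel_measurable M" for k by simp
    have "(\<integral>\<^sup>+\<omega>. 1 + (\<Sum>k. ?g k \<omega>) \<partial>M) = (\<integral>\<^sup>+\<omega>. 1 \<partial>M) + (\<integral>\<^sup>+\<omega>. (\<Sum>k. ?g k \<omega>) \<partial>M)"
      using g by (intro nn_integral_add) auto
    also have "(\<integral>\<^sup>+\<omega>. (\<Sum>k. ?g k \<omega>) \<partial>M) = (\<Sum>k. \<integral>\<^sup>+\<omega>. ?g k \<omega> \<partial>M)"
      using g by (intro nn_integral_suminf)
    also have "(\<lambda>k. \<integral>\<^sup>+\<omega>. ?g k \<omega> \<partial>M) = (\<lambda>k. ennreal (2 powr (q * (real k + 1)) * T k))"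
      using ev by (simp add: nn_integral_cmult_indicator T_def emeasure_eq_measure ennreal_mult)
    finally show ?thesis by (simp add: emeasure_space_1)
  qed
  also have "\<dots> < \<infinity>"
  proof -
    have "summable (\<lambda>k. 2 powr (q * (real k + 1)) * T k)"
    proof (rule summable_comparison_test_ev)
      show "summable (\<lambda>k. 2 powr q * (2 powr (q - s)) ^ k)"
        using q by (intro summable_mult summable_geometric) (simp add: powr_less_one)
      show "\<forall>\<^sub>F k in sequentially. norm (2 powr (q * (real k + 1)) * T k) \<le> 2 powr q * (2 powr (q - s)) ^ k"
        using ev
      proof eventually_elim
        case (elim k)
        have "2 powr (q * (real k + 1)) * T k \<le> 2 powr (q * (real k + 1)) * (2 ^ k) powr (-s)"
          using elim by (intro mult_left_mono) auto
        also have "\<dots> = 2 powr (q * (real k + 1)) * 2 powr (- (s * real k))"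
          by (simp add: powr_powr mult.commute flip: powr_realpow)
        also have "\<dots> = 2 powr (q + (q - s) * real k)"
          by (simp add: algebra_simps flip: powr_add)
        also have "\<dots> = 2 powr q * (2 powr (q - s)) ^ k"
          by (simp add: powr_add powr_powr flip: powr_realpow)
        finally show ?case by (simp add: T_def)
      qed
    qed
    then have "(\<Sum>k. ennreal (2 powr (q * (real k + 1)) * T k)) \<noteq> \<top>"
      by (intro ennreal_suminf_neq_top) (auto simp: T_def)
    then show ?thesis by (simp add: less_top)
  qed
  finally show ?thesis .
qed

section \<open>The path functional\<close>

lemma exc_time_Suc_finite:
  assumes "exc_time X n \<omega> = enat k" "exc_time X (Suc n) \<omega> = enat l"
  shows "k < l" "X l \<omega> = 0"
proof -
  have ex: "\<exists>t. k < t \<and> X t \<omega> = 0" and l: "l = (LEAST t. k < t \<and> X t \<omega> = 0)"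
    using assms by (auto split: if_splits)
  show "k < l" "X l \<omega> = 0" using LeastI_ex[OF ex] l by auto
qed

lemma exc_time_1_iff:
  assumes "1 \<le> t"
  shows "enat t < exc_time X 1 \<omega> \<longleftrightarrow> (\<forall>s\<in>{2..t}. X s \<omega> \<noteq> 0)"
proof (cases "\<exists>s>1. X s \<omega> = 0")
  case True
  define l where "l = (LEAST s. 1 < s \<and> X s \<omega> = 0)"
  have e: "exc_time X 1 \<omega> = enat l" using True by (simp add: one_enat_def l_def)
  have l: "1 < l" "X l \<omega> = 0" using LeastI_ex[of "\<lambda>s. 1 < s \<and> X s \<omega> = 0"] True by (auto simp: l_def)
  have least: "l \<le> s" if "1 < s" "X s \<omega> = 0" for s using that unfolding l_def by (intro Least_le) auto
  have "t < l \<longleftrightarrow> (\<forall>s\<in>{2..t}. X s \<omega> \<noteq> 0)"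
  proof
    assume tl: "t < l"
    show "\<forall>s\<in>{2..t}. X s \<omega> \<noteq> 0"
    proof (intro ballI notI)
      fix s assume "s \<in> {2..t}" "X s \<omega> = 0"
      then show False using least[of s] tl by simp
    qed
  next
    assume a: "\<forall>s\<in>{2..t}. X s \<omega> \<noteq> 0"
    show "t < l"
    proof (rule ccontr)
      assume "\<not> t < l"
      then have "l \<in> {2..t}" using l by auto
      then show False using a l by blast
    qed
  qed
  then show ?thesis using e by simp
next
  case False
  then have "exc_time X 1 \<omega> = \<infinity>" by (auto simp: one_enat_def)
  moreover have "\<forall>s\<in>{2..t}. X s \<omega> \<noteq> 0" using False by auto
  ultimately show ?thesis by simp
qed

lemma exc_count_infinite_iff: "exc_count X \<omega> = \<infinity> \<longleftrightarrow> (\<forall>n\<ge>1. exc_time X n \<omega> < \<infinity>)"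
  by (auto simp: exc_count_def)

lemma exc_time_finite_mono: "exc_time X (Suc n) \<omega> < \<infinity> \<Longrightarrow> exc_time X n \<omega> < \<infinity>"
  by (cases "exc_time X n \<omega>") auto

lemma ex_excursion_containing:
  assumes fin: "\<forall>n\<ge>1. exc_time X n \<omega> < \<infinity>" and t: "1 \<le> t"
  obtains n where "1 \<le> n" "X t \<omega> \<in> set (excursion X n \<omega>)"
proof -
  define T where "T n = the_enat (exc_time X n \<omega>)" for n
  have T: "exc_time X n \<omega> = enat (T n)" for n
  proof (cases "n = 0")
    case True
    then show ?thesis by (simp add: T_def one_enat_def)
  next
    case False
    then have "exc_time X n \<omega> < \<infinity>" using fin by simp
    then obtain k where "exc_time X n \<omega> = enat k" by (cases "exc_time X n \<omega>") auto
    then show ?thesis by (simp add: T_def)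
  qed
  have inc: "T n < T (Suc n)" for n using exc_time_Suc_finite[OF T T] by simp
  have T0: "T 0 = 1" by (simp add: T_def one_enat_def)
  have ge: "n < T n" for n
  proof (induction n)
    case (Suc n)
    then show ?case using inc[of n] by simp
  qed (simp add: T0)
  define m where "m = (LEAST n. t < T n)"
  have m: "t < T m" unfolding m_def by (rule LeastI[of _ t]) (rule ge)
  have m0: "m \<noteq> 0" using m t T0 by (cases "m = 0") auto
  then have "\<not> t < T (m - 1)" unfolding m_def by (intro not_less_Least) simp
  then have "t \<in> set [T (m - 1)..<T m]" using m by simp
  then have "X t \<omega> \<in> set (excursion X m \<omega>)" by (simp add: excursion_def T)
  then show thesis using m0 by (intro that[of m]) auto
qed

context lamperti_recurrent
begin

lemma xi_eq:
  assumes "\<omega> \<in> space M"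
  shows "xi X \<alpha> \<omega> = (\<Sum>t. if 1 \<le> t \<and> \<omega> \<in> alive t then ennreal (pow0 (X t \<omega>) \<alpha>) else 0)"
proof -
  have "(exc_time X 0 \<omega> \<le> enat t \<and> enat t < exc_time X 1 \<omega>) \<longleftrightarrow> (1 \<le> t \<and> \<omega> \<in> alive t)" for t
  proof -
    have "exc_time X 0 \<omega> = enat 1" by (simp add: one_enat_def)
    moreover have "\<omega> \<in> alive t \<longleftrightarrow> (\<forall>s\<in>{2..t}. X s \<omega> \<noteq> 0)" using assms by (simp add: alive_def)
    ultimately show ?thesis using exc_time_1_iff[of t X \<omega>] by (metis enat_ord_simps(1))
  qed
  then show ?thesis unfolding xi_def by presburger
qed

lemma xi_measurable: "xi X \<alpha> \<in> borel_measurable M"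
proof -
  have "(\<lambda>\<omega>. if 1 \<le> t \<and> \<omega> \<in> alive t then ennreal (pow0 (X t \<omega>) \<alpha>) else 0) \<in> borel_measurable M" for t
  proof (cases "1 \<le> t")
    case True
    have [measurable]: "X t \<in> borel_measurable M" "alive t \<in> events" using X_measurable alive_events True by auto
    show ?thesis unfolding pow0_def by measurable
  qed simp
  then have "(\<lambda>\<omega>. \<Sum>t. if 1 \<le> t \<and> \<omega> \<in> alive t then ennreal (pow0 (X t \<omega>) \<alpha>) else 0) \<in> borel_measurable M"
    by (intro borel_measurable_suminf_order)
  then show ?thesis by (subst measurable_cong[OF xi_eq])
qed

lemma xi_tail_events: "{\<omega> \<in> space M. ennreal x \<le> xi X \<alpha> \<omega>} \<in> events"
  using xi_measurable[of \<alpha>] by measurable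

lemma prob_xi_ge_long_stay:
  assumes \<alpha>: "0 \<le> \<alpha>" and y: "0 < y" and x: "x \<le> (real l + 1) * (y / 2) powr \<alpha>"
  shows "prob (long_stay y l) \<le> prob {\<omega> \<in> space M. ennreal x \<le> xi X \<alpha> \<omega>}"
proof (rule finite_measure_mono[OF _ xi_tail_events])
  show "long_stay y l \<subseteq> {\<omega> \<in> space M. ennreal x \<le> xi X \<alpha> \<omega>}"
  proof
    fix \<omega> assume "\<omega> \<in> long_stay y l"
    then obtain s where s: "1 \<le> s" and al: "\<omega> \<in> alive (s + l)" and X: "\<forall>u\<in>{s..s+l}. y / 2 < X u \<omega>" and sp: "\<omega> \<in> space M"
      by (auto simp: long_stay_def)
    have p: "(y / 2) powr \<alpha> \<le> pow0 (X u \<omega>) \<alpha>" if "u \<in> {s..s+l}" for u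
    proof -
      have "y / 2 < X u \<omega>" using X that by blast
      then show ?thesis using \<alpha> y unfolding pow0_def by (auto intro!: powr_mono2)
    qed
    have "ennreal x \<le> ennreal ((real l + 1) * (y / 2) powr \<alpha>)" using x by (rule ennreal_leI)
    also have "\<dots> = (\<Sum>u\<in>{s..s+l}. ennreal ((y / 2) powr \<alpha>))"
      by (simp add: ennreal_mult ennreal_of_nat_eq_real_of_nat add.commute flip: ennreal_plus)
    also have "\<dots> \<le> (\<Sum>u\<in>{s..s+l}. if 1 \<le> u \<and> \<omega> \<in> alive u then ennreal (pow0 (X u \<omega>) \<alpha>) else 0)"
    proof (intro sum_mono)
      fix u assume u: "u \<in> {s..s+l}"
      then have "\<omega> \<in> alive u" using al alive_antimono[of u "s+l"] by auto
      then show "ennreal ((y / 2) powr \<alpha>) \<le> (if 1 \<le> u \<and> \<omega> \<in> alive u then ennreal (pow0 (X u \<omega>) \<alpha>) else 0)"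
        using u s p[OF u] by (auto intro!: ennreal_leI)
    qed
    also have "\<dots> \<le> xi X \<alpha> \<omega>"
      unfolding xi_eq[OF sp] by (intro sum_le_suminf) auto
    finally show "\<omega> \<in> {\<omega> \<in> space M. ennreal x \<le> xi X \<alpha> \<omega>}" using sp by simp
  qed
qed

lemma prob_xi_ge_upper:
  assumes \<alpha>: "0 \<le> \<alpha>" and y: "1 \<le> y" and x: "real n * y powr \<alpha> < x"
  shows "prob {\<omega> \<in> space M. ennreal x \<le> xi X \<alpha> \<omega>} \<le> prob (reach y) + prob (below y (1 + n))"
proof -
  have bM: "below y (1 + n) \<in> events" using below_sets[of "1+n" y] sets_F_events[of "1+n"] by simp
  have "{\<omega> \<in> space M. ennreal x \<le> xi X \<alpha> \<omega>} \<subseteq> reach y \<union> below y (1 + n)"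
  proof (rule subsetI, rule ccontr)
    fix \<omega> assume w: "\<omega> \<in> {\<omega> \<in> space M. ennreal x \<le> xi X \<alpha> \<omega>}" and nb: "\<omega> \<notin> reach y \<union> below y (1 + n)"
    have sp: "\<omega> \<in> space M" using w by simp
    have lt: "X t \<omega> < y" if "1 \<le> t" "\<omega> \<in> alive t" for t
      using nb that by (auto simp: reach_def not_le)
    have na: "\<omega> \<notin> alive (1 + n)"
    proof
      assume a: "\<omega> \<in> alive (1 + n)"
      have "X s \<omega> < y" if "s \<in> {1..1+n}" for s
        using lt[of s] alive_antimono[of s "1+n"] a that by auto
      then have "\<omega> \<in> below y (1 + n)" using a sp by (auto simp: below_def)
      then show False using nb by blast
    qed
    have na': "\<omega> \<notin> alive t" if "t \<notin> {1..n}" "1 \<le> t" for t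
      using na alive_antimono[of "1+n" t] that by auto
    have p: "pow0 (X t \<omega>) \<alpha> \<le> y powr \<alpha>" if "1 \<le> t" "\<omega> \<in> alive t" for t
      unfolding pow0_def using lt[OF that] X_nonneg[of t \<omega>] that sp \<alpha> y by (auto intro!: powr_mono2)
    have "xi X \<alpha> \<omega> = (\<Sum>t\<in>{1..n}. if 1 \<le> t \<and> \<omega> \<in> alive t then ennreal (pow0 (X t \<omega>) \<alpha>) else 0)"
      unfolding xi_eq[OF sp] using na' by (intro suminf_finite) auto
    also have "\<dots> \<le> (\<Sum>t\<in>{1..n}. ennreal (y powr \<alpha>))"
      using p by (intro sum_mono) (auto intro!: ennreal_leI)
    also have "\<dots> = ennreal (real n * y powr \<alpha>)" by (simp add: ennreal_mult ennreal_of_nat_eq_real_of_nat)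
    also have "\<dots> < ennreal x" using x by (intro ennreal_lessI) (auto intro: le_less_trans[OF _ x])
    finally show False using w leD by blast
  qed
  then have "prob {\<omega> \<in> space M. ennreal x \<le> xi X \<alpha> \<omega>} \<le> prob (reach y \<union> below y (1 + n))"
    using reach_events bM by (intro finite_measure_mono) auto
  also have "\<dots> \<le> prob (reach y) + prob (below y (1 + n))"
    using reach_events bM by (intro measure_Un_le)
  finally show ?thesis .
qed

lemma xi_tail_upper:
  assumes \<alpha>: "0 \<le> \<alpha>" and e: "0 < e"
  shows "\<forall>\<^sub>F x in at_top. prob {\<omega> \<in> space M. ennreal x \<le> xi X \<alpha> \<omega>}
     \<le> x powr (- (1 + r) / (\<alpha> + 2)) * ln x powr ((2 + 2 * r) / (\<alpha> + 2) + 1 + e)"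
proof -
  define \<nu> where "\<nu> = min 1 (1 + r)"
  have \<nu>: "0 < \<nu>" "\<nu> \<le> 1 + r" "\<nu> \<le> 1" using r_gt by (auto simp: \<nu>_def)
  obtain K where K: "0 < K" and up: "\<And>y. 0 < y \<Longrightarrow> prob (reach y) \<le> K / lyap (1 + r) (-\<nu>) (y + exp 1)"
    using prob_reach_upper[OF \<nu>(1,2)] by blast
  obtain K2 q where K2: "0 < K2" and q: "0 < q" "q < 1" and geo:
    "\<And>y N. 1 \<le> y \<Longrightarrow> \<exists>L. real L \<le> K2 * y\<^sup>2 \<and> prob (below y (1 + N * L)) \<le> q ^ N"
    using prob_below_geometric by blast
  define A where "A = (1 + r) / - ln q"
  have lq: "ln q < 0" using q by simp
  have A: "0 < A" unfolding A_def using lq r_gt by (intro divide_pos_pos) auto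
  have a2: "0 < \<alpha> + 2" using \<alpha> by simp
  define Y where "Y x = x powr (1 / (\<alpha> + 2)) * ln x powr (- 2 / (\<alpha> + 2))" for x
  have lim: "filterlim Y at_top at_top" unfolding Y_def using a2 by real_asymp
  have e1: "\<forall>\<^sub>F x in at_top. 1 \<le> Y x" using lim by (simp add: filterlim_at_top)
  have e2: "\<forall>\<^sub>F x in at_top. (A * ln x + 1) * K2 * ln x powr (-2) < 1" by real_asymp
  have e3: "\<forall>\<^sub>F x in at_top. K * ln (x + exp 1) + 1 \<le> ln x powr (1 + e)" using e K by real_asymp
  have e4: "\<forall>\<^sub>F x in at_top. exp 1 \<le> (x::real)" by (rule eventually_ge_at_top)
  show ?thesis using e1 e2 e3 e4
  proof eventually_elim
    case (elim x)
    define y where "y = Y x"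
    have x1: "1 \<le> x" using elim(4) exp_ge_add_one_self[of "1::real"] by linarith
    have x: "0 < x" "1 \<le> ln x" using x1 ln_ge_1[OF elim(4)] by auto
    have y: "1 \<le> y" using elim by (simp add: y_def)
    have "y \<le> x powr 1 * ln x powr 0"
      unfolding y_def Y_def using x x1 a2 \<alpha> by (intro mult_mono powr_mono) (auto simp: field_simps)
    then have yx: "y \<le> x" using x by (auto split: if_splits)
    have y_pow: "y powr b = x powr (b / (\<alpha> + 2)) * ln x powr (- 2 * b / (\<alpha> + 2))" for b
      unfolding y_def Y_def using x by (simp add: powr_mult powr_powr)
    define N where "N = nat \<lceil>A * ln y\<rceil>"
    have ly: "0 \<le> A * ln y" using A y by simp
    have N: "A * ln y \<le> real N" "real N \<le> A * ln y + 1" unfolding N_def using ly by linarith+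
    obtain L where L: "real L \<le> K2 * y\<^sup>2" "prob (below y (1 + N * L)) \<le> q ^ N" using geo[OF y] by blast
    have "q ^ N = q powr real N" using q by (simp add: powr_realpow)
    also have "\<dots> \<le> q powr (A * ln y)" using N(1) q by (intro powr_mono') auto
    also have "\<dots> = y powr (- (1 + r))" using lq q y by (simp add: A_def powr_def) (simp add: algebra_simps)
    finally have qN: "q ^ N \<le> y powr (- (1 + r))" .
    have "real (N * L) * y powr \<alpha> \<le> (A * ln x + 1) * (K2 * y\<^sup>2) * y powr \<alpha>"
    proof -
      have "A * ln y \<le> A * ln x" using A y yx by simp
      then have "real N \<le> A * ln x + 1" using N by linarith
      then have "real N * real L \<le> (A * ln x + 1) * (K2 * y\<^sup>2)"
        using L K2 by (intro mult_mono) auto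
      then show ?thesis by (intro mult_right_mono) auto
    qed
    also have "\<dots> = (A * ln x + 1) * K2 * y powr (\<alpha> + 2)"
      using y by (simp add: powr_add powr_numeral)
    also have "\<dots> = x * ((A * ln x + 1) * K2 * ln x powr (-2))"
    proof -
      have "(\<alpha> + 2) / (\<alpha> + 2) = 1" "- 2 * (\<alpha> + 2) / (\<alpha> + 2) = - 2"
        using a2 by (auto simp: field_simps)
      then show ?thesis unfolding y_pow using x by (simp only: powr_one mult_ac)
    qed
    also have "\<dots> < x * 1" using elim(2) x by (intro mult_strict_left_mono) auto
    finally have small: "real (N * L) * y powr \<alpha> < x" by simp
    have "prob (reach y) \<le> K / lyap (1 + r) (-\<nu>) (y + exp 1)" using up y by simp
    also have "\<dots> \<le> K * (y powr (- (1 + r)) * ln (x + exp 1))"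
    proof -
      have z: "exp 1 \<le> y + exp 1" using y by simp
      have l1: "1 \<le> ln (y + exp 1)" using ln_ge_1[OF z] .
      have "inverse (lyap (1 + r) (-\<nu>) (y + exp 1)) = (y + exp 1) powr (- (1 + r)) * ln (y + exp 1) powr \<nu>"
        by (simp only: lyap_def powr_minus inverse_mult_distrib inverse_inverse_eq)
      also have "\<dots> \<le> y powr (- (1 + r)) * ln (x + exp 1)"
      proof (intro mult_mono)
        show "(y + exp 1) powr (- (1 + r)) \<le> y powr (- (1 + r))" using y r_gt by (intro powr_mono2') auto
        have "ln (y + exp 1) powr \<nu> \<le> ln (y + exp 1) powr 1" using l1 \<nu> by (intro powr_mono) auto
        also have "\<dots> = ln (y + exp 1)" using l1 by (intro powr_one) linarith
        also have "\<dots> \<le> ln (x + exp 1)" using y yx x by (intro ln_mono) (auto intro: add_pos_pos)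
        finally show "ln (y + exp 1) powr \<nu> \<le> ln (x + exp 1)" .
      qed auto
      finally have "K * inverse (lyap (1 + r) (-\<nu>) (y + exp 1)) \<le> K * (y powr (- (1 + r)) * ln (x + exp 1))"
        using K by (intro mult_left_mono) auto
      then show ?thesis by (simp add: divide_inverse)
    qed
    finally have R: "prob (reach y) \<le> K * (y powr (- (1 + r)) * ln (x + exp 1))" .
    have "prob {\<omega> \<in> space M. ennreal x \<le> xi X \<alpha> \<omega>} \<le> prob (reach y) + prob (below y (1 + N * L))"
      by (rule prob_xi_ge_upper[OF \<alpha> y small])
    also have "\<dots> \<le> K * (y powr (- (1 + r)) * ln (x + exp 1)) + y powr (- (1 + r))"
      using R L(2) qN by linarith
    also have "\<dots> = y powr (- (1 + r)) * (K * ln (x + exp 1) + 1)" by (simp add: algebra_simps)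
    also have "\<dots> \<le> y powr (- (1 + r)) * ln x powr (1 + e)" using elim(3) by (intro mult_left_mono) auto
    also have "\<dots> = x powr (- (1 + r) / (\<alpha> + 2)) * (ln x powr (2 * (1 + r) / (\<alpha> + 2)) * ln x powr (1 + e))"
      unfolding y_pow by (simp add: algebra_simps)
    also have "ln x powr (2 * (1 + r) / (\<alpha> + 2)) * ln x powr (1 + e) = ln x powr ((2 + 2 * r) / (\<alpha> + 2) + 1 + e)"
      by (simp add: add.assoc flip: powr_add)
    finally show ?case .
  qed
qed

lemma xi_tail_lower:
  assumes \<alpha>: "0 \<le> \<alpha>" and e: "0 < e"
    and pos: "\<And>x1. \<exists>v\<in>S. \<exists>t0\<ge>1. x1 < v \<and> 0 < prob (alive t0 \<inter> {\<omega> \<in> space M. X t0 \<omega> = v})"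
  shows "\<forall>\<^sub>F x in at_top. x powr (- (1 + r) / (\<alpha> + 2)) * ln x powr (- e)
     \<le> prob {\<omega> \<in> space M. ennreal x \<le> xi X \<alpha> \<omega>}"
proof -
  define \<nu> where "\<nu> = e / 2"
  have \<nu>: "0 < \<nu>" using e by (simp add: \<nu>_def)
  obtain x1 where low: "\<forall>v\<in>S. \<forall>t0\<ge>1. x1 < v \<longrightarrow> 0 < prob (alive t0 \<inter> {\<omega> \<in> space M. X t0 \<omega> = v}) \<longrightarrow>
       (\<exists>k>0. \<forall>y>v. k / lyap (1 + r) \<nu> (2 * (y + exp 1)) \<le> prob (reach y))"
    using prob_reach_lower[OF \<nu>] by blast
  obtain v t0 where "v \<in> S" "1 \<le> t0" "x1 < v" "0 < prob (alive t0 \<inter> {\<omega> \<in> space M. X t0 \<omega> = v})"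
    using pos by blast
  then obtain k0 where k0: "0 < k0" and reach: "\<And>y. v < y \<Longrightarrow> k0 / lyap (1 + r) \<nu> (2 * (y + exp 1)) \<le> prob (reach y)"
    using low by blast
  obtain k y0 where k: "0 < k" and y0: "0 < y0"
    and long: "\<And>y l. y0 \<le> y \<Longrightarrow> real l \<le> k * y\<^sup>2 \<Longrightarrow> prob (reach y) / 2 \<le> prob (long_stay y l)"
    using prob_long_stay by blast
  define \<beta> where "\<beta> = 1 / (\<alpha> + 2)"
  have \<beta>: "0 < \<beta>" "\<beta> < 1" "\<beta> * (\<alpha> + 2) = 1" using \<alpha> by (auto simp: \<beta>_def)
  define B where "B = (2 powr \<alpha> / k) powr \<beta>"
  have B: "0 < B" using k by (simp add: B_def)
  define Y where "Y x = B * x powr \<beta>" for x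
  define k1 where "k1 = k0 / 2 / (4 * B) powr (1 + r)"
  have k1: "0 < k1" using k0 B by (simp add: k1_def)
  have lim: "filterlim Y at_top at_top" unfolding Y_def using \<beta>(1) B by real_asymp
  have e1: "\<forall>\<^sub>F x in at_top. max y0 (max (v + 1) (exp 1)) \<le> Y x" using lim by (simp only: filterlim_at_top)
  have e2: "\<forall>\<^sub>F x in at_top. 4 * Y x \<le> x" unfolding Y_def using \<beta>(1,2) B by real_asymp
  have e3: "\<forall>\<^sub>F x in at_top. 1 \<le> k1 * ln x powr \<nu>" using k1 \<nu> by real_asymp
  have e4: "\<forall>\<^sub>F x in at_top. exp 1 \<le> (x::real)" by (rule eventually_ge_at_top)
  show ?thesis using e1 e2 e3 e4
  proof eventually_elim
    case (elim x)
    define y where "y = Y x"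
    have x1: "1 \<le> x" using elim(4) exp_ge_add_one_self[of "1::real"] by linarith
    have x: "0 < x" "1 \<le> ln x" using x1 ln_ge_1[OF elim(4)] by auto
    have y: "y0 \<le> y" "v < y" "exp 1 \<le> y" "0 < y" using elim(1) y0 by (auto simp: y_def)
    define l where "l = nat \<lfloor>k * y\<^sup>2\<rfloor>"
    have ky: "0 \<le> k * y\<^sup>2" using k by simp
    have l: "real l \<le> k * y\<^sup>2" "k * y\<^sup>2 \<le> real l + 1" unfolding l_def using ky by linarith+
    have "x = k / 2 powr \<alpha> * (2 powr \<alpha> / k * x)" using k by simp
    also have "2 powr \<alpha> / k * x = y powr (\<alpha> + 2)"
      unfolding y_def Y_def B_def using x k \<beta>(3) by (simp add: powr_mult powr_powr)
    also have "k / 2 powr \<alpha> * y powr (\<alpha> + 2) = k * y\<^sup>2 * (y / 2) powr \<alpha>"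
      using y by (simp add: powr_add powr_divide powr_numeral)
    also have "\<dots> \<le> (real l + 1) * (y / 2) powr \<alpha>" using l by (intro mult_right_mono) auto
    finally have xl: "x \<le> (real l + 1) * (y / 2) powr \<alpha>" .
    have "1 \<le> y" using y(3) exp_ge_add_one_self[of "1::real"] by linarith
    then have ln4: "0 \<le> ln (4 * y)" "ln (4 * y) \<le> ln x" using elim(2) x(1) by (simp_all add: y_def)
    have z: "exp 1 \<le> 2 * (y + exp 1)" "2 * (y + exp 1) \<le> 4 * y" using y(3) exp_gt_zero[of "1::real"] by argo+
    have "lyap (1 + r) \<nu> (2 * (y + exp 1)) \<le> lyap (1 + r) \<nu> (4 * y)"
      using z r_gt \<nu> by (intro lyap_mono) auto
    also have "\<dots> \<le> (4 * y) powr (1 + r) * ln x powr \<nu>"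
      unfolding lyap_def using ln4 \<nu> by (intro mult_left_mono powr_mono2) auto
    also have "(4 * y) powr (1 + r) = (4 * B) powr (1 + r) * x powr (\<beta> * (1 + r))"
      unfolding y_def Y_def using B x by (simp add: powr_mult powr_powr)
    finally have ly: "lyap (1 + r) \<nu> (2 * (y + exp 1)) \<le> (4 * B) powr (1 + r) * x powr (\<beta> * (1 + r)) * ln x powr \<nu>" .
    have lp: "0 < lyap (1 + r) \<nu> (2 * (y + exp 1))" using z(1) by (rule lyap_pos)
    have "x powr (- (1 + r) / (\<alpha> + 2)) * ln x powr (- e) \<le> x powr (- (\<beta> * (1 + r))) * (k1 * ln x powr (- \<nu>))"
    proof -
      have "1 * ln x powr (- e) \<le> k1 * ln x powr \<nu> * ln x powr (- e)" using elim(3) by (intro mult_right_mono) auto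
      also have "\<dots> = k1 * ln x powr (\<nu> + - e)" by (simp only: powr_add mult.assoc)
      also have "\<nu> + - e = - \<nu>" by (simp add: \<nu>_def)
      finally have "ln x powr (- e) \<le> k1 * ln x powr (- \<nu>)" by simp
      moreover have "- (1 + r) / (\<alpha> + 2) = - (\<beta> * (1 + r))"
        by (simp add: \<beta>_def diff_divide_distrib add_divide_distrib)
      ultimately show ?thesis by (simp add: mult_left_mono)
    qed
    also have "\<dots> = k0 / ((4 * B) powr (1 + r) * x powr (\<beta> * (1 + r)) * ln x powr \<nu>) / 2"
      by (simp only: k1_def powr_minus divide_inverse inverse_mult_distrib mult_ac)
    also have "\<dots> \<le> k0 / lyap (1 + r) \<nu> (2 * (y + exp 1)) / 2"
    proof -
      have "0 < (4 * B) powr (1 + r) * x powr (\<beta> * (1 + r)) * ln x powr \<nu>" using lp ly by (rule less_le_trans)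
      then show ?thesis using ly lp k0 by (intro divide_right_mono divide_left_mono mult_pos_pos) auto
    qed
    also have "\<dots> \<le> prob (reach y) / 2" using reach[OF y(2)] by simp
    also have "\<dots> \<le> prob (long_stay y l)" using long y l by blast
    also have "\<dots> \<le> prob {\<omega> \<in> space M. ennreal x \<le> xi X \<alpha> \<omega>}"
      by (rule prob_xi_ge_long_stay[OF \<alpha> y(4) xl])
    finally show ?case .
  qed
qed

text \<open>If the first excursion almost surely stayed below \<open>x\<^sub>1\<close>, the process would be recurrent and all
  excursions, having the same law, would stay below \<open>x\<^sub>1\<close>, contradicting irreducibility.\<close>
lemma positive_excursion:
  assumes A3a: "emeasure M {\<omega>\<in>space M. exc_count X \<omega> = \<infinity>} > 0 \<longrightarrow>
               (let M' = uniform_measure M {\<omega>\<in>space M. exc_count X \<omega> = \<infinity>} in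
                  prob_space.indep_vars M' (\<lambda>_. count_space UNIV) (excursion X) {1..} \<and>
                  (\<forall>n\<ge>1. distr M' (count_space UNIV) (excursion X n)
                          = distr M' (count_space UNIV) (excursion X 1)))"
    and A3b: "\<forall>n. prob {\<omega>\<in>space M. exc_time X n \<omega> < \<infinity>} > 0 \<longrightarrow>
               prob {\<omega>\<in>space M. exc_len X (n + 1) \<omega> < \<infinity> \<and> exc_time X n \<omega> < \<infinity>}
                 / prob {\<omega>\<in>space M. exc_time X n \<omega> < \<infinity>}
               = prob {\<omega>\<in>space M. exc_len X 1 \<omega> < \<infinity>}"
  shows "\<exists>v\<in>S. \<exists>t0\<ge>1. x1 < v \<and> 0 < prob (alive t0 \<inter> {\<omega> \<in> space M. X t0 \<omega> = v})"
proof (rule ccontr)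
  assume neg: "\<not> ?thesis"
  have null: "prob (alive t \<inter> {\<omega> \<in> space M. X t \<omega> = v}) = 0" if "v \<in> S" "1 \<le> t" "x1 < v" for v t
  proof -
    have "\<not> 0 < prob (alive t \<inter> {\<omega> \<in> space M. X t \<omega> = v})" using neg that by blast
    then show ?thesis using measure_nonneg[of M "alive t \<inter> {\<omega> \<in> space M. X t \<omega> = v}"] by linarith
  qed
  have ae_first: "AE \<omega> in M. \<forall>t\<ge>1. \<omega> \<in> alive t \<longrightarrow> X t \<omega> \<le> x1"
  proof -
    have "AE \<omega> in M. \<forall>v\<in>{v \<in> S. x1 < v}. \<not> (\<omega> \<in> alive t \<and> X t \<omega> = v)" if t: "1 \<le> t" for t
    proof (rule AE_ball_countable')
      show "countable {v \<in> S. x1 < v}" using countable_S by (rule countable_subset[rotated]) auto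
      fix v assume v: "v \<in> {v \<in> S. x1 < v}"
      have "alive t \<inter> {\<omega> \<in> space M. X t \<omega> = v} \<in> events" using alive_events[OF t] event_eq[OF t] by blast
      moreover have "prob (alive t \<inter> {\<omega> \<in> space M. X t \<omega> = v}) = 0" using null v t by simp
      ultimately have "AE \<omega> in M. \<omega> \<notin> alive t \<inter> {\<omega> \<in> space M. X t \<omega> = v}" by (simp add: prob_eq_0)
      then show "AE \<omega> in M. \<not> (\<omega> \<in> alive t \<and> X t \<omega> = v)" using AE_space by eventually_elim auto
    qed
    then have "AE \<omega> in M. 1 \<le> t \<longrightarrow> \<omega> \<in> alive t \<longrightarrow> X t \<omega> \<le> x1" for t
    proof (cases "1 \<le> t")
      case True
      from \<open>\<And>t. 1 \<le> t \<Longrightarrow> AE \<omega> in M. \<forall>v\<in>{v \<in> S. x1 < v}. \<not> (\<omega> \<in> alive t \<and> X t \<omega> = v)\<close>[OF True] AE_space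
      show ?thesis by eventually_elim (use S_valued[OF True] in force)
    qed simp
    then show ?thesis by (simp add: AE_all_countable)
  qed
  have dead: "AE \<omega> in M. \<exists>t\<ge>1. \<omega> \<notin> alive t"
  proof -
    define y where "y = max x1 0 + 1"
    have y: "1 \<le> y" by (simp add: y_def)
    obtain K2 q where q: "0 < q" "q < 1" and geo:
      "\<And>y N. 1 \<le> y \<Longrightarrow> \<exists>L. real L \<le> K2 * y\<^sup>2 \<and> prob (below y (1 + N * L)) \<le> q ^ N"
      using prob_below_geometric by metis
    define I where "I = (\<Inter>i. alive (Suc i))"
    have IM: "I \<in> events" unfolding I_def using alive_events by (intro sets.countable_INT) auto
    have "prob I \<le> q ^ N" for N
    proof -
      obtain L where L: "prob (below y (1 + N * L)) \<le> q ^ N" using geo[OF y] by blast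
      have "prob I \<le> prob (below y (1 + N * L))"
      proof (rule finite_measure_mono_AE)
        show "AE \<omega> in M. \<omega> \<in> I \<longrightarrow> \<omega> \<in> below y (1 + N * L)"
          using ae_first AE_space
        proof eventually_elim
          case (elim \<omega>)
          show ?case
          proof
            assume w: "\<omega> \<in> I"
            have al: "\<omega> \<in> alive t" if "1 \<le> t" for t
              using w that unfolding I_def by (metis INT_E UNIV_I Suc_pred' less_eq_Suc_le One_nat_def)
            have "X t \<omega> < y" if "1 \<le> t" for t using elim al[OF that] that unfolding y_def by force
            then show "\<omega> \<in> below y (1 + N * L)" using al[of "1 + N * L"] elim by (auto simp: below_def)
          qed
        qed
        show "below y (1 + N * L) \<in> events" using below_sets[of "1+N*L" y] sets_F_events[of "1+N*L"] by simp
      qed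
      then show ?thesis using L by simp
    qed
    moreover have "(\<lambda>N. q ^ N) \<longlonglongrightarrow> 0" using q by (intro LIMSEQ_realpow_zero) auto
    ultimately have "prob I \<le> 0" by (intro LIMSEQ_le_const) auto
    then have "prob I = 0" by (simp add: measure_le_0_iff)
    then have "AE \<omega> in M. \<omega> \<notin> I" using IM by (simp add: prob_eq_0)
    then show ?thesis by eventually_elim (auto simp: I_def)
  qed
  have fin1: "AE \<omega> in M. exc_time X 1 \<omega> < \<infinity>"
    using dead AE_space
  proof eventually_elim
    case (elim \<omega>)
    then obtain t where "1 \<le> t" "\<omega> \<notin> alive t" by blast
    then have "\<not> enat t < exc_time X 1 \<omega>" using exc_time_1_iff[of t X \<omega>] elim by (simp add: alive_def)
    then show ?case by (cases "exc_time X 1 \<omega>") (auto simp del: exc_time.simps)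
  qed
  have len1: "prob {\<omega>\<in>space M. exc_len X 1 \<omega> < \<infinity>} = 1"
  proof -
    have "{\<omega>\<in>space M. exc_len X 1 \<omega> < \<infinity>} = (\<Union>t\<in>{1<..}. {\<omega> \<in> space M. X t \<omega> = 0})"
      by (auto simp: exc_len_def one_enat_def split: if_splits)
    also have "\<dots> \<in> events" using event_eq by (intro sets.countable_UN'') auto
    finally have ev: "{\<omega>\<in>space M. exc_len X 1 \<omega> < \<infinity>} \<in> events" .
    have "AE \<omega> in M. \<omega> \<in> {\<omega>\<in>space M. exc_len X 1 \<omega> < \<infinity>}"
      using fin1 AE_space
    proof eventually_elim
      case (elim \<omega>)
      have "exc_len X 1 \<omega> \<le> exc_time X 1 \<omega>" unfolding exc_len_def by (cases "exc_time X 1 \<omega>") (auto simp: one_enat_def)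
      then have "exc_len X 1 \<omega> < \<infinity>" using elim(1) by (rule order_le_less_trans)
      then show ?case using elim(2) by blast
    qed
    then show ?thesis using ev by (simp add: prob_eq_1)
  qed
  have tau: "prob {\<omega>\<in>space M. exc_time X n \<omega> < \<infinity>} = 1" for n
  proof (induction n)
    case 0
    have "{\<omega>\<in>space M. exc_time X 0 \<omega> < \<infinity>} = space M" by (simp add: one_enat_def)
    then show ?case using prob_space by simp
  next
    case (Suc n)
    have eq: "{\<omega>\<in>space M. exc_len X (n + 1) \<omega> < \<infinity> \<and> exc_time X n \<omega> < \<infinity>} = {\<omega>\<in>space M. exc_time X (Suc n) \<omega> < \<infinity>}"
    proof -
      have "(exc_len X (n + 1) \<omega> < \<infinity> \<and> exc_time X n \<omega> < \<infinity>) \<longleftrightarrow> exc_time X (Suc n) \<omega> < \<infinity>" for \<omega>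
        using exc_time_finite_mono[of X n \<omega>] unfolding exc_len_def
        by (cases "exc_time X n \<omega>"; cases "exc_time X (Suc n) \<omega>") (auto simp del: exc_time.simps)
      then show ?thesis by blast
    qed
    have "0 < prob {\<omega>\<in>space M. exc_time X n \<omega> < \<infinity>}" using Suc.IH by simp
    from A3b[rule_format, OF this] show ?case unfolding eq Suc.IH len1 by (simp only: div_by_1)
  qed
  have tauM: "{\<omega>\<in>space M. exc_time X n \<omega> < \<infinity>} \<in> events" for n
    using tau[of n] measure_notin_sets by fastforce
  define E where "E = {\<omega>\<in>space M. exc_count X \<omega> = \<infinity>}"
  have EE: "E = (\<Inter>n. {\<omega>\<in>space M. exc_time X (Suc n) \<omega> < \<infinity>})"
  proof -
    have "(\<forall>n\<ge>1. exc_time X n \<omega> < \<infinity>) \<longleftrightarrow> (\<forall>n. exc_time X (Suc n) \<omega> < \<infinity>)" for \<omega>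
      by (metis One_nat_def Suc_le_D Suc_le_mono le0)
    then show ?thesis unfolding E_def exc_count_infinite_iff by blast
  qed
  have EM: "E \<in> events" unfolding EE by (intro sets.countable_INT image_subsetI UNIV_not_empty tauM)
  have aeE: "AE \<omega> in M. \<omega> \<in> E"
  proof -
    have "AE \<omega> in M. \<omega> \<in> {\<omega>\<in>space M. exc_time X (Suc n) \<omega> < \<infinity>}" for n
      using tau[of "Suc n"] tauM[of "Suc n"] by (simp only: prob_eq_1)
    then have "AE \<omega> in M. \<forall>n. \<omega> \<in> {\<omega>\<in>space M. exc_time X (Suc n) \<omega> < \<infinity>}" by (subst AE_all_countable) blast
    then show ?thesis unfolding EE by eventually_elim blast
  qed
  have PE: "emeasure M E = 1" using aeE EM by (simp add: emeasure_eq_measure prob_eq_1)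
  define M' where "M' = uniform_measure M E"
  have ps: "prob_space M'" unfolding M'_def using PE by (intro prob_space_uniform_measure) auto
  have "0 < emeasure M E" using PE by simp
  with A3a[unfolded Let_def] have a3: "prob_space.indep_vars M' (\<lambda>_. count_space UNIV) (excursion X) {1..} \<and>
      (\<forall>n\<ge>1. distr M' (count_space UNIV) (excursion X n) = distr M' (count_space UNIV) (excursion X 1))"
    unfolding M'_def E_def by (rule mp)
  note ind = conjunct1[OF a3]
  have dist: "distr M' (count_space UNIV) (excursion X n) = distr M' (count_space UNIV) (excursion X 1)" if "1 \<le> n" for n
    using conjunct2[OF a3] that by blast
  have meas: "excursion X n \<in> measurable M' (count_space UNIV)" if "1 \<le> n" for n
    using ind that by (auto simp: prob_space.indep_vars_def[OF ps])
  define Q where "Q = {l :: real list. \<exists>x\<in>set l. x1 < x}"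
  have sM': "space M' = space M" "sets M' = sets M" by (simp_all add: M'_def)
  have emM': "emeasure M' A = emeasure M A" if "A \<in> events" for A
  proof -
    have "emeasure M' A = emeasure M (E \<inter> A)" unfolding M'_def using EM that PE by (simp add: divide_ennreal_def)
    also have "\<dots> = emeasure M A" using aeE EM that by (intro emeasure_eq_AE) auto
    finally show ?thesis .
  qed
  have QM: "excursion X n -` Q \<inter> space M \<in> events" if "1 \<le> n" for n
    using measurable_sets[OF meas[OF that], of Q] sM' by simp
  have "AE \<omega> in M. excursion X n \<omega> \<notin> Q" if n: "1 \<le> n" for n
  proof -
    have "emeasure M (excursion X n -` Q \<inter> space M) = emeasure (distr M' (count_space UNIV) (excursion X n)) Q"
      using meas[OF n] QM[OF n] by (simp add: emeasure_distr sM' emM')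
    also have "\<dots> = emeasure (distr M' (count_space UNIV) (excursion X 1)) Q" using dist[OF n] by simp
    also have "\<dots> = emeasure M (excursion X 1 -` Q \<inter> space M)"
      using meas[of 1] QM[of 1] by (simp add: emeasure_distr sM' emM')
    also have "\<dots> = 0"
    proof -
      have "AE \<omega> in M. \<omega> \<notin> excursion X 1 -` Q \<inter> space M"
        using ae_first AE_space
      proof eventually_elim
        case (elim \<omega>)
        show ?case
        proof
          assume "\<omega> \<in> excursion X 1 -` Q \<inter> space M"
          then obtain x where x: "x \<in> set (excursion X 1 \<omega>)" "x1 < x" by (auto simp: Q_def)
          then obtain b where b: "exc_time X 1 \<omega> = enat b"
            by (cases "exc_time X 1 \<omega>") (auto simp: excursion_def simp del: exc_time.simps split: enat.splits)
          have "exc_time X 0 \<omega> = enat 1" by (simp add: one_enat_def)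
          then have "set (excursion X 1 \<omega>) = (\<lambda>t. X t \<omega>) ` {1..<b}" using b by (simp add: excursion_def del: exc_time.simps)
          then obtain t where t: "1 \<le> t" "t < b" "x = X t \<omega>" using x by auto
          then have "\<omega> \<in> alive t" using exc_time_1_iff[of t X \<omega>] b elim by (simp add: alive_def)
          then show False using elim t x by force
        qed
      qed
      then have "excursion X 1 -` Q \<inter> space M \<in> null_sets M" using QM[of 1] by (simp add: AE_iff_null_sets)
      then show ?thesis by (rule null_setsD1)
    qed
    finally have "emeasure M (excursion X n -` Q \<inter> space M) = 0" .
    then have "excursion X n -` Q \<inter> space M \<in> null_sets M" using QM[OF n] by (simp add: null_sets_def)
    then have "AE \<omega> in M. \<omega> \<notin> excursion X n -` Q \<inter> space M" by (rule AE_not_in)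
    then show ?thesis using AE_space by eventually_elim auto
  qed
  then have "AE \<omega> in M. 1 \<le> n \<longrightarrow> excursion X n \<omega> \<notin> Q" for n by (cases "1 \<le> n") auto
  then have "AE \<omega> in M. \<forall>n. 1 \<le> n \<longrightarrow> excursion X n \<omega> \<notin> Q" by (subst AE_all_countable) blast
  then have all: "AE \<omega> in M. \<forall>t\<ge>1. X t \<omega> \<le> x1"
    using aeE
  proof eventually_elim
    case (elim \<omega>)
    have f: "\<forall>n\<ge>1. exc_time X n \<omega> < \<infinity>" using elim(2) unfolding E_def exc_count_infinite_iff by blast
    show ?case
    proof (intro allI impI)
      fix t :: nat assume "1 \<le> t"
      then obtain n where "1 \<le> n" "X t \<omega> \<in> set (excursion X n \<omega>)" using ex_excursion_containing[OF f] by blast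
      then show "X t \<omega> \<le> x1" using elim(1) unfolding Q_def by force
    qed
  qed
  obtain v where v: "v \<in> S" "x1 < v" using S_unbdd unfolding bdd_above_def by (meson not_le)
  obtain s where s: "1 < s" "0 < prob {\<omega> \<in> space M. X s \<omega> = v}" using reach_state[OF v(1)] by blast
  have "AE \<omega> in M. \<omega> \<notin> {\<omega> \<in> space M. X s \<omega> = v}" 
    using all
  proof eventually_elim
    case (elim \<omega>)
    have "X s \<omega> \<le> x1" using elim s(1) by simp
    then show ?case using v(2) by auto
  qed
  then have "prob {\<omega> \<in> space M. X s \<omega> = v} = 0" using event_eq[of s v] s by (simp add: prob_eq_0)
  then show False using s by simp
qed

end

theorem theorem2p8:
  fixes M :: "'a measure" and F :: "nat \<Rightarrow> 'a measure"
    and S :: "real set" and X :: "nat \<Rightarrow> 'a \<Rightarrow> real"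
    and c s2 r p \<alpha> :: real
  assumes prob: "prob_space M"
    \<comment> \<open>(A0): state space\<close>
    and S_nonneg: "S \<subseteq> {0..}" and S_zero: "0 \<in> S"
    and S_locfin: "\<forall>b. finite (S \<inter> {..b})" and S_unbdd: "\<not> bdd_above S"
    \<comment> \<open>(A0): filtration indexed by t >= 1, adapted S-valued process\<close>
    and filt_sub: "\<forall>t\<ge>1. subalgebra M (F t)"
    and filt_mono: "\<forall>s t. 1 \<le> s \<longrightarrow> s \<le> t \<longrightarrow> sets (F s) \<subseteq> sets (F t)"
    and adapted: "\<forall>t\<ge>1. X t \<in> borel_measurable (F t)"
    and S_valued: "\<forall>t\<ge>1. \<forall>\<omega>\<in>space M. X t \<omega> \<in> S"
    and start: "measure M {\<omega>\<in>space M. X 1 \<omega> = 0} = 1"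
    \<comment> \<open>(A1)\<close>
    and A1: "\<exists>(m :: real \<Rightarrow> real \<Rightarrow> nat) (\<phi> :: real \<Rightarrow> real \<Rightarrow> real).
               (\<forall>x\<in>S. \<forall>y\<in>S. 1 \<le> m x y \<and> 0 < \<phi> x y) \<and>
               (\<forall>y\<in>S. \<forall>t\<ge>1. AE \<omega> in M.
                  real_cond_exp M (F t)
                    (indicator {\<omega>'\<in>space M. X (t + m (X t \<omega>') y) \<omega>' = y}) \<omega>
                  \<ge> \<phi> (X t \<omega>) y)"
    \<comment> \<open>(A2), with uniform o-terms; r = -2c/s^2\<close>
    and s2_pos: "0 < s2"
    and A2_mean: "\<forall>e>0. \<exists>x0. \<forall>t\<ge>1. AE \<omega> in M. X t \<omega> \<ge> x0 \<longrightarrow>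
               \<bar>real_cond_exp M (F t) (\<lambda>\<omega>'. X (t + 1) \<omega>' - X t \<omega>') \<omega> - c / X t \<omega>\<bar>
                 \<le> e / (X t \<omega> * ln (X t \<omega>))"
    and A2_var: "\<forall>e>0. \<exists>x0. \<forall>t\<ge>1. AE \<omega> in M. X t \<omega> \<ge> x0 \<longrightarrow>
               \<bar>real_cond_exp M (F t) (\<lambda>\<omega>'. (X (t + 1) \<omega>' - X t \<omega>')\<^sup>2) \<omega> - s2\<bar>
                 \<le> e / ln (X t \<omega>)"
    and r_def: "r = - 2 * c / s2"
    \<comment> \<open>(A3)(a): on {N = infinity} (i.e. conditionally on it) the excursions are i.i.d.\<close>
    and A3a: "emeasure M {\<omega>\<in>space M. exc_count X \<omega> = \<infinity>} > 0 \<longrightarrow>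
               (let M' = uniform_measure M {\<omega>\<in>space M. exc_count X \<omega> = \<infinity>} in
                  prob_space.indep_vars M' (\<lambda>_. count_space UNIV) (excursion X) {1..} \<and>
                  (\<forall>n\<ge>1. distr M' (count_space UNIV) (excursion X n)
                          = distr M' (count_space UNIV) (excursion X 1)))"
    \<comment> \<open>(A3)(b)\<close>
    and A3b: "\<forall>n. measure M {\<omega>\<in>space M. exc_time X n \<omega> < \<infinity>} > 0 \<longrightarrow>
               measure M {\<omega>\<in>space M. exc_len X (n + 1) \<omega> < \<infinity> \<and> exc_time X n \<omega> < \<infinity>}
                 / measure M {\<omega>\<in>space M. exc_time X n \<omega> < \<infinity>}
               = measure M {\<omega>\<in>space M. exc_len X 1 \<omega> < \<infinity>}"
    \<comment> \<open>r > -1 and (M_p) for some p > max 2 (1 + r)\<close>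
    and r_gt: "r > -1"
    and p_gt: "p > max 2 (1 + r)"
    and Mp: "\<exists>\<delta>>0. \<exists>C. \<forall>t\<ge>1. AE \<omega> in M.
               nn_cond_exp M (F t) (\<lambda>\<omega>'. ennreal (\<bar>X (t + 1) \<omega>' - X t \<omega>'\<bar> powr p)) \<omega>
                 \<le> ennreal (C * (1 + X t \<omega>) powr (p - 2 - \<delta>))"
    and alpha_nonneg: "\<alpha> \<ge> 0"
  shows "(\<forall>\<epsilon>>0. \<forall>\<^sub>F x in at_top.
            x powr (- (1 + r) / (\<alpha> + 2)) * ln x powr (- \<epsilon>)
              \<le> measure M {\<omega>\<in>space M. xi X \<alpha> \<omega> \<ge> ennreal x}
          \<and> measure M {\<omega>\<in>space M. xi X \<alpha> \<omega> \<ge> ennreal x}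
              \<le> x powr (- (1 + r) / (\<alpha> + 2)) * ln x powr ((2 + 2 * r) / (\<alpha> + 2) + 1 + \<epsilon>))
       \<and> (\<integral>\<^sup>+ \<omega>. enn_pow (xi X \<alpha> \<omega>) ((1 + r) / (\<alpha> + 2)) \<partial>M) = \<infinity>
       \<and> (\<forall>\<epsilon>. 0 < \<epsilon> \<and> \<epsilon> < (1 + r) / (\<alpha> + 2) \<longrightarrow>
            (\<integral>\<^sup>+ \<omega>. enn_pow (xi X \<alpha> \<omega>) ((1 + r) / (\<alpha> + 2) - \<epsilon>) \<partial>M) < \<infinity>)"
proof -
  interpret prob_space M by (rule prob)
  obtain \<delta> C0 where \<delta>: "0 < \<delta>" and C0: "\<forall>t\<ge>1. AE \<omega> in M.
       nn_cond_exp M (F t) (\<lambda>\<omega>'. ennreal (\<bar>X (t + 1) \<omega>' - X t \<omega>'\<bar> powr p)) \<omega>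
         \<le> ennreal (C0 * (1 + X t \<omega>) powr (p - 2 - \<delta>))"
    using Mp by blast
  define C where "C = max C0 0"
  have bound: "AE \<omega> in M. nn_cond_exp M (F t) (\<lambda>\<omega>'. ennreal (\<bar>X (t + 1) \<omega>' - X t \<omega>'\<bar> powr p)) \<omega>
         \<le> ennreal (C * (1 + X t \<omega>) powr (p - 2 - \<delta>))" if "1 \<le> t" for t
    using C0[rule_format, OF that]
  proof eventually_elim
    case (elim \<omega>)
    have "ennreal (C0 * (1 + X t \<omega>) powr (p - 2 - \<delta>)) \<le> ennreal (C * (1 + X t \<omega>) powr (p - 2 - \<delta>))"
      unfolding C_def by (intro ennreal_leI mult_right_mono) auto
    then show ?case using elim by (rule order_trans[rotated])
  qed
  have X1: "X 1 \<in> borel_measurable M"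
    using measurable_from_subalg[OF filt_sub[rule_format] adapted[rule_format], of 1] by simp
  have start_AE: "AE \<omega> in M. X 1 \<omega> = 0"
  proof -
    have "{\<omega>\<in>space M. X 1 \<omega> = 0} \<in> events" using X1 by measurable
    then have "AE \<omega> in M. \<omega> \<in> {\<omega>\<in>space M. X 1 \<omega> = 0}" using start by (simp add: prob_eq_1)
    then show ?thesis by eventually_elim simp
  qed
  interpret lamperti_recurrent M F S X c s2 p \<delta> C r
  proof (unfold_locales, goal_cases)
    case 1 show ?case by (rule S_nonneg)
  next
    case 2 show ?case by (rule S_zero)
  next
    case (3 b) show ?case using S_locfin by blast
  next
    case 4 show ?case by (rule S_unbdd)
  next
    case (5 t) then show ?case using filt_sub by blast
  next
    case (6 s t) then show ?case using filt_mono by blast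
  next
    case (7 t) then show ?case using adapted by blast
  next
    case (8 t \<omega>) then show ?case using S_valued by blast
  next
    case 9 show ?case by (rule start_AE)
  next
    case 10 show ?case by (rule A1)
  next
    case 11 show ?case by (rule s2_pos)
  next
    case (12 e) then show ?case using A2_mean by blast
  next
    case (13 e) then show ?case using A2_var by blast
  next
    case 14 show ?case using p_gt by simp
  next
    case 15 show ?case by (rule \<delta>)
  next
    case 16 show ?case by (simp add: C_def)
  next
    case (17 t) then show ?case by (rule bound)
  next
    case 18 show ?case by (rule r_def)
  next
    case 19 show ?case by (rule r_gt)
  next
    case 20 show ?case using p_gt by simp
  qed
  let ?\<theta> = "(1 + r) / (\<alpha> + 2)"
  have \<theta>: "0 < ?\<theta>" using r_gt alpha_nonneg by simp
  have neg: "- (1 + r) / (\<alpha> + 2) = - ?\<theta>" by (simp only: minus_divide_left)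
  note pos = positive_excursion[OF A3a A3b]
  have lower: "\<forall>\<^sub>F x in at_top. x powr (- (1 + r) / (\<alpha> + 2)) * ln x powr (- \<epsilon>)
      \<le> prob {\<omega> \<in> space M. ennreal x \<le> xi X \<alpha> \<omega>}" if "0 < \<epsilon>" for \<epsilon>
    using xi_tail_lower[OF alpha_nonneg that pos] .
  have upper: "\<forall>\<^sub>F x in at_top. prob {\<omega> \<in> space M. ennreal x \<le> xi X \<alpha> \<omega>}
      \<le> x powr (- (1 + r) / (\<alpha> + 2)) * ln x powr ((2 + 2 * r) / (\<alpha> + 2) + 1 + \<epsilon>)" if "0 < \<epsilon>" for \<epsilon>
    using xi_tail_upper[OF alpha_nonneg that] .
  have "(\<integral>\<^sup>+ \<omega>. enn_pow (xi X \<alpha> \<omega>) ?\<theta> \<partial>M) = \<infinity>"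
    using lower[of 1] unfolding neg by (intro nn_integral_enn_pow_infinite[OF xi_measurable \<theta>]) simp
  moreover have "(\<integral>\<^sup>+ \<omega>. enn_pow (xi X \<alpha> \<omega>) (?\<theta> - \<epsilon>) \<partial>M) < \<infinity>" if \<epsilon>: "0 < \<epsilon>" "\<epsilon> < ?\<theta>" for \<epsilon>
  proof (rule nn_integral_enn_pow_finite[OF xi_measurable])
    show "0 < ?\<theta> - \<epsilon>" "?\<theta> - \<epsilon> < ?\<theta> - \<epsilon> / 2" using \<epsilon> by auto
    define b where "b = (2 + 2 * r) / (\<alpha> + 2) + 1 + 1"
    have e2: "0 < \<epsilon> / 2" using \<epsilon> by simp
    have "\<forall>\<^sub>F x in at_top. ln x powr b \<le> x powr (\<epsilon> / 2)" using e2 by real_asymp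
    moreover have "\<forall>\<^sub>F x in at_top. prob {\<omega> \<in> space M. ennreal x \<le> xi X \<alpha> \<omega>} \<le> x powr (- ?\<theta>) * ln x powr b"
      using upper[of 1] unfolding neg b_def by simp
    ultimately show "\<forall>\<^sub>F x in at_top. prob {\<omega> \<in> space M. ennreal x \<le> xi X \<alpha> \<omega>} \<le> x powr (- (?\<theta> - \<epsilon> / 2))"
    proof eventually_elim
      case (elim x)
      have "x powr (- ?\<theta>) * ln x powr b \<le> x powr (- ?\<theta>) * x powr (\<epsilon> / 2)"
        using elim(1) by (intro mult_left_mono) auto
      also have "\<dots> = x powr (- ?\<theta> + \<epsilon> / 2)" by (simp only: powr_add)
      also have "- ?\<theta> + \<epsilon> / 2 = - (?\<theta> - \<epsilon> / 2)" by simp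
      finally show ?case using elim(2) by linarith
    qed
  qed
  ultimately show ?thesis
    using lower upper eventually_conj by blast
qed

end
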